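(* Let $k,\ell>0$, $n\in\mathbb{R}$, and let $\varphi:[1,\infty)\to[1,\infty)$ be an increasing and strictly convex function with $\varphi(1)=1$ and $\liminf_{t\to\infty}\frac{\varphi(t)}{t^2}>0$. Then there exist $\varepsilon_0>0$ and a function $\delta:(0,\varepsilon_0)\to(0,\infty)$ with $\lim_{\varepsilon\to0^+}\delta(\varepsilon)=0$ such that the following property holds. If $$\int_{Q_1}\varphi(K(z,f))\,d\mathcal{L}^2(z)\le(1+\varepsilon)\int_{Q_1}\varphi(K(z,f^* ))\,d\mathcal{L}^2(z)$$ holds for some $0<\varepsilon<\varepsilon_0$ and some $f\in\mathcal{F}$ with $f=f^*$ on $\partial Q_1$, then $$\int_{Q_1}|f-f^*|(z)\,d\mathcal{L}^2(z)\le\delta(\varepsilon).$$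
   Context: $\mathcal{L}^2$ is Lebesgue measure on $\mathbb{C}=\mathbb{R}^2$. For $k,\ell>0$, $n\in\mathbb{R}$, let $Q_1=\{x+iy:\ x\in[0,\ell],\ y\in[0,1]\}$. Finite distortion: an orientation-preserving map $f$ between (closures of) bounded planar domains $\Omega,\Omega'$ has finite distortion if $f\in W^{1,1}(\Omega,\Omega')$, its Jacobian $J(\cdot,f)\in L^1(\Omega)$, and there is a measurable $K:\Omega\to\mathbb{R}\cup\{\infty\}$ with $1\le K(z)<\infty$ and $|Df(z)|^2\le K(z)J(z,f)$ for a.e. $z\in\Omega$, where $|Df|=|f_z|+|f_{\bar z}|$ and $J(z,f)=|f_z|^2-|f_{\bar z}|^2$. The linear distortion of $f$ is defined a.e. by $K(z,f)=\frac{|f_z(z)|+|f_{\bar z}(z)|}{|f_z(z)|-|f_{\bar z}(z)|}$ if $|f_{\bar z}(z)|<|f_z(z)|$ and $K(z,f)=1$ otherwise. $\mathcal{F}$ is the class of all orientation-preserving homeomorphisms $f$ of $Q_1$ onto its image in $\mathbb{C}$, $f\in W^{1,1}(Q_1)$, of finite distortion, such that $f(0)=0$, $f(x+i)=f(x)+i$ for $x\in[0,\ell]$, and $f(\ell+iy)=f(iy)+k\ell+in\ell$ for $y\in[0,1]$. The linear stretch map is $f^*(x+iy)=kx+inx+iy$ on $Q_1$; it belongs to $\mathcal{F}$. *)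

theory Defs
  imports "HOL-Complex_Analysis.Complex_Analysis"
begin

primrec Ck :: "nat \<Rightarrow> (complex \<Rightarrow> real) \<Rightarrow> bool" where
  "Ck 0 u \<longleftrightarrow> continuous_on UNIV u"
| "Ck (Suc m) u \<longleftrightarrow> (\<forall>z. u differentiable (at z)) \<and>
     (\<forall>v. Ck m (\<lambda>z. frechet_derivative u (at z) v))"

definition test_function :: "complex set \<Rightarrow> (complex \<Rightarrow> real) \<Rightarrow> bool" where
  "test_function \<Omega> u \<longleftrightarrow>
     (\<forall>m. Ck m u) \<and> compact (closure {z. u z \<noteq> 0}) \<and> closure {z. u z \<noteq> 0} \<subseteq> \<Omega>"

text \<open>\<open>g\<close> is a weak partial derivative of \<open>f\<close> on the open set \<open>\<Omega>\<close> in the real direction \<open>v\<close>.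
  Integrability of \<open>f\<close> and \<open>g\<close> over \<open>\<Omega>\<close> (rather than local integrability) is built in, since only
  \<open>W\<^sup>1\<^sup>,\<^sup>1\<close> is needed.\<close>

definition has_weak_partial ::
  "complex set \<Rightarrow> (complex \<Rightarrow> complex) \<Rightarrow> complex \<Rightarrow> (complex \<Rightarrow> complex) \<Rightarrow> bool" where
  "has_weak_partial \<Omega> f v g \<longleftrightarrow>
     integrable (lebesgue_on \<Omega>) f \<and> integrable (lebesgue_on \<Omega>) g \<and>
     (\<forall>u. test_function \<Omega> u \<longrightarrow>
        (LINT z|lebesgue_on \<Omega>. frechet_derivative u (at z) v *\<^sub>R f z) =
        - (LINT z|lebesgue_on \<Omega>. u z *\<^sub>R g z))"

definition W11 :: "complex set \<Rightarrow> (complex \<Rightarrow> complex) \<Rightarrow> bool" where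
  "W11 \<Omega> f \<longleftrightarrow> (\<exists>g. has_weak_partial \<Omega> f 1 g) \<and> (\<exists>g. has_weak_partial \<Omega> f \<i> g)"

text \<open>For \<open>f\<close> in \<open>W\<^sup>1\<^sup>,\<^sup>1\<close> the function chosen here is determined almost everywhere on \<open>\<Omega>\<close>.\<close>

definition weak_partial ::
  "complex set \<Rightarrow> (complex \<Rightarrow> complex) \<Rightarrow> complex \<Rightarrow> complex \<Rightarrow> complex" where
  "weak_partial \<Omega> f v = (SOME g. has_weak_partial \<Omega> f v g)"

definition dz :: "complex set \<Rightarrow> (complex \<Rightarrow> complex) \<Rightarrow> complex \<Rightarrow> complex" where
  "dz \<Omega> f z = (weak_partial \<Omega> f 1 z - \<i> * weak_partial \<Omega> f \<i> z) / 2"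

definition dzbar :: "complex set \<Rightarrow> (complex \<Rightarrow> complex) \<Rightarrow> complex \<Rightarrow> complex" where
  "dzbar \<Omega> f z = (weak_partial \<Omega> f 1 z + \<i> * weak_partial \<Omega> f \<i> z) / 2"

definition jacobian :: "complex set \<Rightarrow> (complex \<Rightarrow> complex) \<Rightarrow> complex \<Rightarrow> real" where
  "jacobian \<Omega> f z = (cmod (dz \<Omega> f z))\<^sup>2 - (cmod (dzbar \<Omega> f z))\<^sup>2"

definition norm_D :: "complex set \<Rightarrow> (complex \<Rightarrow> complex) \<Rightarrow> complex \<Rightarrow> real" where
  "norm_D \<Omega> f z = cmod (dz \<Omega> f z) + cmod (dzbar \<Omega> f z)"

definition finite_distortion :: "complex set \<Rightarrow> (complex \<Rightarrow> complex) \<Rightarrow> bool" where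
  "finite_distortion \<Omega> f \<longleftrightarrow>
     W11 \<Omega> f \<and> integrable (lebesgue_on \<Omega>) (jacobian \<Omega> f) \<and>
     (\<exists>K :: complex \<Rightarrow> ereal. K \<in> borel_measurable (lebesgue_on \<Omega>) \<and>
        (AE z in lebesgue_on \<Omega>. 1 \<le> K z \<and> K z < \<infinity> \<and>
           ereal ((norm_D \<Omega> f z)\<^sup>2) \<le> K z * ereal (jacobian \<Omega> f z)))"

definition linear_distortion :: "complex set \<Rightarrow> (complex \<Rightarrow> complex) \<Rightarrow> complex \<Rightarrow> real" where
  "linear_distortion \<Omega> f z =
     (if cmod (dzbar \<Omega> f z) < cmod (dz \<Omega> f z)
      then (cmod (dz \<Omega> f z) + cmod (dzbar \<Omega> f z)) / (cmod (dz \<Omega> f z) - cmod (dzbar \<Omega> f z))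
      else 1)"

text \<open>For an injective continuous \<open>f\<close>, preserving orientation means having local degree 1: small
  positively oriented circles are mapped to curves winding once around the image of the centre.\<close>

definition orientation_preserving_on :: "complex set \<Rightarrow> (complex \<Rightarrow> complex) \<Rightarrow> bool" where
  "orientation_preserving_on \<Omega> f \<longleftrightarrow>
     (\<forall>z r. 0 < r \<and> cball z r \<subseteq> \<Omega> \<longrightarrow> winding_number (f \<circ> circlepath z r) (f z) = 1)"

definition Q1 :: "real \<Rightarrow> complex set" where
  "Q1 l = {z. Re z \<in> {0..l} \<and> Im z \<in> {0..1}}"

text \<open>Sobolev regularity and distortion refer to the open rectangle \<open>interior (Q1 l)\<close>.\<close>

definition competitors :: "real \<Rightarrow> real \<Rightarrow> real \<Rightarrow> (complex \<Rightarrow> complex) set" where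
  "competitors k l n = {f.
     (\<exists>g. homeomorphism (Q1 l) (f ` Q1 l) f g) \<and>
     orientation_preserving_on (interior (Q1 l)) f \<and>
     finite_distortion (interior (Q1 l)) f \<and>
     f 0 = 0 \<and>
     (\<forall>x\<in>{0..l}. f (of_real x + \<i>) = f (of_real x) + \<i>) \<and>
     (\<forall>y\<in>{0..1}. f (of_real l + \<i> * of_real y) = f (\<i> * of_real y) + of_real (k * l) + \<i> * of_real (n * l))}"

definition stretch :: "real \<Rightarrow> real \<Rightarrow> complex \<Rightarrow> complex" where
  "stretch k n z = of_real (k * Re z) + \<i> * of_real (n * Re z) + \<i> * of_real (Im z)"

definition distortion_energy ::
  "(real \<Rightarrow> real) \<Rightarrow> real \<Rightarrow> (complex \<Rightarrow> complex) \<Rightarrow> ennreal" where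
  "distortion_energy \<phi> l f =
     (\<integral>\<^sup>+ z. ennreal (\<phi> (linear_distortion (interior (Q1 l)) f z)) \<partial>lebesgue_on (Q1 l))"

definition strictly_convex_on :: "real set \<Rightarrow> (real \<Rightarrow> real) \<Rightarrow> bool" where
  "strictly_convex_on S \<phi> \<longleftrightarrow> convex S \<and>
     (\<forall>x\<in>S. \<forall>y\<in>S. \<forall>t. x \<noteq> y \<and> 0 < t \<and> t < 1 \<longrightarrow>
        \<phi> ((1 - t) * x + t * y) < (1 - t) * \<phi> x + t * \<phi> y)"

end

theory Submission
  imports Defs
begin

text \<open>Write \<open>A\<close> for the constant differential of the stretch map, \<open>\<Lambda>\<close> for its operator norm and
\<open>\<kappa> = \<Lambda>\<^sup>2 / k\<close> for its distortion, and choose unit vectors \<open>v\<close>, \<open>w\<close> with \<open>A v = \<Lambda> w\<close>. Let \<open>f\<close> be a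
competitor with the boundary values of the stretch, with Jacobian \<open>J\<close>, distortion \<open>K\<close> and
directional derivative \<open>D\<close> along \<open>v\<close>. All estimates rest on three facts. Because \<open>f\<close> minus the
stretch vanishes on the boundary, the mean of \<open>D\<close> over the rectangle is \<open>\<Lambda> w\<close>
(\<open>W10_integral_partials\<close>). Because \<open>f\<close> is injective and cannot leave the image parallelogram, the
integral of \<open>J\<close> is at most the area \<open>k l\<close> of that parallelogram (\<open>jacobian_integral_le_area\<close>). And
\<open>norm D \<le> N\<close> with \<open>N\<^sup>2 = K J\<close> for the operator norm \<open>N\<close> of the differential of \<open>f\<close>.

With \<open>c = k / \<Lambda>\<close> the arithmetic-geometric mean inequality gives \<open>D \<bullet> w \<le> N \<le> (c K + J / c) / 2\<close>,
and integration yields that the mean of \<open>K\<close> is at least \<open>\<kappa>\<close>. Hence a convex increasing energy is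
minimised by the stretch. For the stability of this inequality, strict convexity keeps \<open>\<phi>\<close> above a
tangent at \<open>\<kappa>\<close> by a multiple of the distance to \<open>\<kappa>\<close>, up to an arbitrarily small error
(\<open>strictly_convex_above_tangent\<close>), so a small energy excess forces \<open>K\<close> close to \<open>\<kappa>\<close> in \<open>L\<^sup>1\<close>. The
arithmetic-geometric and Cauchy-Schwarz inequalities above then have a small deficit, and so \<open>D\<close> is
close to \<open>\<Lambda> w\<close> in \<open>L\<^sup>1\<close> (\<open>derivative_deviation_L1\<close>). The Poincare inequality along the single
direction \<open>v\<close> (\<open>W10_poincare\<close>) turns this into closeness of \<open>f\<close> to the stretch.

The area inequality carries most of the work, because a homeomorphism in \<open>W\<^sup>1\<^sup>,\<^sup>1\<close> need not map null
sets to null sets. The difference \<open>g\<close> of \<open>f\<close> and the stretch, extended by zero, is weakly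
differentiable in the whole plane, since its uniform continuity beats the slope of cutoff functions
(\<open>weak_partial_extends_by_0\<close>), and so mollification gives smooth \<open>h\<^sub>j\<close> with derivatives converging in
\<open>L\<^sup>1\<close>, as fast as desired after passing to a subsequence. By a one-dimensional maximal inequality on horizontal and vertical lines, the difference
quotients of \<open>h\<^sub>j - h\<^sub>j\<^sub>+\<^sub>1\<close> based at \<open>z\<close> are at most \<open>2\<^sup>-\<^sup>j\<close> unless \<open>z\<close> lies in a set of tiny measure.
Two good points are joined through the corner of an axis-parallel rectangle: the horizontal side is
controlled at one end point, the vertical side at the other, whatever the corner is.
Therefore \<open>g\<close> is differentiable, with its weak derivative, within good sets that exhaust the
rectangle up to a null set (\<open>exhaustion_by_sets_of_differentiability\<close>), and on each of them the
change of variables formula applies.\<close>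

section \<open>Smooth bumps and test functions\<close>

text \<open>Derivatives are existentially quantified rather than given by an operator, so that closure
properties follow by plain induction on the order.\<close>

primrec smooth1 :: "nat \<Rightarrow> (real \<Rightarrow> real) \<Rightarrow> bool" where
  "smooth1 0 b \<longleftrightarrow> continuous_on UNIV b"
| "smooth1 (Suc m) b \<longleftrightarrow> (\<exists>b'. (\<forall>x. (b has_real_derivative b' x) (at x)) \<and> smooth1 m b')"

lemma smooth1_continuous: "smooth1 m b \<Longrightarrow> continuous_on UNIV b"
proof (cases m)
  case (Suc k)
  assume "smooth1 m b"
  then obtain b' where "\<And>x. (b has_real_derivative b' x) (at x)" using Suc by auto
  then show ?thesis by (intro DERIV_continuous_on[of UNIV b b']) (simp add: has_field_derivative_at_within)
qed simp

lemma smooth1_Suc_imp: "smooth1 (Suc m) b \<Longrightarrow> smooth1 m b"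
proof (induction m arbitrary: b)
  case 0
  then show ?case using smooth1_continuous[of "Suc 0" b] by simp
next
  case (Suc m)
  from Suc.prems obtain b' where b': "\<And>x. (b has_real_derivative b' x) (at x)" "smooth1 (Suc m) b'"
    unfolding smooth1.simps(2)[of "Suc m"] by blast
  show ?case unfolding smooth1.simps(2)[of m] using b'(1) Suc.IH[OF b'(2)] by blast
qed

lemma smooth1_const: "smooth1 m (\<lambda>x. c)"
proof (induction m arbitrary: c)
  case (Suc m)
  show ?case unfolding smooth1.simps by (rule exI[of _ "\<lambda>x. 0"]) (use Suc in auto)
qed auto

lemma smooth1_add: "smooth1 m a \<Longrightarrow> smooth1 m b \<Longrightarrow> smooth1 m (\<lambda>x. a x + b x)"
proof (induction m arbitrary: a b)
  case 0 then show ?case by (auto intro: continuous_intros)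
next
  case (Suc m)
  then obtain a' b' where "\<And>x. (a has_real_derivative a' x) (at x)" "smooth1 m a'"
    "\<And>x. (b has_real_derivative b' x) (at x)" "smooth1 m b'" by auto
  with Suc.IH[of a' b'] show ?case
    by (auto intro!: exI[of _ "\<lambda>x. a' x + b' x"] derivative_eq_intros)
qed

lemma smooth1_mult: "smooth1 m a \<Longrightarrow> smooth1 m b \<Longrightarrow> smooth1 m (\<lambda>x. a x * b x)"
proof (induction m arbitrary: a b)
  case 0 then show ?case by (auto intro: continuous_intros)
next
  case (Suc m)
  then obtain a' b' where *: "\<And>x. (a has_real_derivative a' x) (at x)" "smooth1 m a'"
    "\<And>x. (b has_real_derivative b' x) (at x)" "smooth1 m b'" by auto
  have "smooth1 m (\<lambda>x. a' x * b x + a x * b' x)"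
    using * Suc.prems[THEN smooth1_Suc_imp] by (intro smooth1_add Suc.IH)
  then show ?case using *
    by (auto intro!: exI[of _ "\<lambda>x. a' x * b x + a x * b' x"] derivative_eq_intros simp: algebra_simps)
qed

lemma smooth1_affine: "smooth1 m b \<Longrightarrow> smooth1 m (\<lambda>x. b (c * x + d))"
proof (induction m arbitrary: b)
  case 0 
  have "continuous_on UNIV (\<lambda>x. b (c * x + d))"
    by (rule continuous_on_compose2[of UNIV b]) (use 0 in \<open>auto intro: continuous_intros\<close>)
  then show ?case by simp
next
  case (Suc m)
  then obtain b' where *: "\<And>x. (b has_real_derivative b' x) (at x)" "smooth1 m b'" by auto
  have d: "((\<lambda>x. b (c * x + d)) has_real_derivative (c * b' (c * x + d))) (at x)" for x
  proof -
    have "((\<lambda>x. c * x + d) has_real_derivative c) (at x)" by (auto intro!: derivative_eq_intros)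
    from DERIV_chain2[OF *(1) this] show ?thesis by (simp add: mult.commute)
  qed
  have "smooth1 m (\<lambda>x. c * b' (c * x + d))"
    using Suc.IH[OF *(2)] by (intro smooth1_mult smooth1_const)
  with d show ?case unfolding smooth1.simps(2) by (intro exI[of _ "\<lambda>x. c * b' (c * x + d)"]) simp
qed

lemma poly_over_exp_tendsto_0: "((\<lambda>x::real. poly p x / exp x) \<longlongrightarrow> 0) at_top"
proof -
  have "((\<lambda>x::real. \<Sum>i\<le>degree p. coeff p i * (x ^ i / exp x)) \<longlongrightarrow> (\<Sum>i\<le>degree p. coeff p i * 0)) at_top"
    by (intro tendsto_sum tendsto_mult tendsto_const tendsto_power_div_exp_0)
  then show ?thesis by (simp add: poly_altdef sum_divide_distrib)
qed

text \<open>The functions \<open>p(1/t) exp(-1/t)\<close>, continued by \<open>0\<close>, form a family that is closed under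
differentiation, including at the origin; this makes each of them smooth.\<close>

definition flat :: "real poly \<Rightarrow> real \<Rightarrow> real" where
  "flat p t = (if t > 0 then poly p (1 / t) * exp (- (1 / t)) else 0)"

lemma flat_has_derivative:
  "(flat p has_real_derivative flat ([:0, 0, 1:] * (p - pderiv p)) t) (at t)"
proof -
  consider "t > 0" | "t < 0" | "t = 0" by linarith
  then show ?thesis
  proof cases
    case 1
    have "((\<lambda>t. poly p (1 / t) * exp (- (1 / t))) has_real_derivative
        flat ([:0, 0, 1:] * (p - pderiv p)) t) (at t)"
      using 1 unfolding flat_def
      by (auto intro!: derivative_eq_intros poly_DERIV[THEN DERIV_chain2] simp: field_simps power2_eq_square)
    then show ?thesis
      by (rule has_field_derivative_transform_within_open[where S="{0<..}"])
        (use 1 in \<open>auto simp: flat_def\<close>)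
  next
    case 2
    have "((\<lambda>t. 0) has_real_derivative 0) (at t)" by simp
    then have "(flat p has_real_derivative 0) (at t)"
      by (rule has_field_derivative_transform_within_open[where S="{..<0}"])
        (use 2 in \<open>auto simp: flat_def\<close>)
    then show ?thesis using 2 by (simp add: flat_def)
  next
    case 3
    have l: "((\<lambda>h. flat p h / h) \<longlongrightarrow> 0) (at_left 0)"
      by (rule tendsto_eventually) (auto simp: eventually_at_filter flat_def)
    have "((\<lambda>x. poly (pCons 0 p) (inverse x) / exp (inverse x)) \<longlongrightarrow> 0) (at_right (0::real))"
      by (rule filterlim_compose[OF poly_over_exp_tendsto_0 filterlim_inverse_at_top_right])
    then have r: "((\<lambda>h. flat p h / h) \<longlongrightarrow> 0) (at_right 0)"
      by (rule Lim_transform_eventually)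
        (auto simp: eventually_at_filter flat_def field_simps exp_minus)
    have "((\<lambda>h. flat p h / h) \<longlongrightarrow> 0) (at 0)"
      using l r by (simp add: filterlim_at_split)
    then show ?thesis using 3 unfolding DERIV_def by (simp add: flat_def)
  qed
qed

lemma smooth1_flat: "smooth1 m (flat p)"
proof (induction m arbitrary: p)
  case 0
  show ?case using flat_has_derivative[of p]
    by (auto intro!: DERIV_continuous_on intro: has_field_derivative_at_within)
next
  case (Suc m)
  then show ?case using flat_has_derivative[of p] by auto
qed

text \<open>The bump \<open>b\<close> serves as mollifier, its primitive \<open>s\<close> as cutoff. Taking \<open>s\<close> as a primitive of
the bump makes its smoothness immediate and normalises the mass of \<open>b\<close> to \<open>1\<close>.\<close>

lemma smooth_bump_and_step:
  obtains b s :: "real \<Rightarrow> real" where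
    "\<And>m. smooth1 m b" "\<And>m. smooth1 m s" "\<And>x. (s has_real_derivative b x) (at x)"
    "\<And>x. 0 \<le> b x" "\<And>x. x \<le> 0 \<Longrightarrow> b x = 0" "\<And>x. 1 \<le> x \<Longrightarrow> b x = 0"
    "\<And>x. x \<le> 0 \<Longrightarrow> s x = 0" "\<And>x. 1 \<le> x \<Longrightarrow> s x = 1" "\<And>x. 0 \<le> s x" "\<And>x. s x \<le> 1"
proof -
  define b0 where "b0 = (\<lambda>x. flat 1 x * flat 1 ((-1) * x + 1))"
  have sm0: "smooth1 m b0" for m
    unfolding b0_def by (intro smooth1_mult smooth1_flat smooth1_affine)
  have b0_nn: "b0 x \<ge> 0" for x by (auto simp: b0_def flat_def)
  have b0_0: "b0 x = 0" if "x \<le> 0 \<or> 1 \<le> x" for x using that by (auto simp: b0_def flat_def)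
  have b0_pos: "b0 x > 0" if "0 < x" "x < 1" for x using that by (auto simp: b0_def flat_def)
  have "isCont b0 x" for x
    using smooth1_continuous[OF sm0[of 0]] by (simp add: continuous_on_eq_continuous_at)
  then obtain F where F: "\<And>x. (F has_vector_derivative b0 x) (at x)"
    using einterval_antiderivative[of "-\<infinity>" "\<infinity>" b0] by auto
  have Fd: "(F has_real_derivative b0 x) (at x)" for x
    using F by (simp add: has_real_derivative_iff_has_vector_derivative)
  have Fcont: "continuous_on A F" for A
    using Fd by (auto intro!: DERIV_continuous_on intro: has_field_derivative_at_within)
  have mono: "F x \<le> F y" if "x \<le> y" for x y
    using that by (intro DERIV_nonneg_imp_nondecreasing[of x y F]) (auto intro: Fd b0_nn)
  have low: "F x = F 0" if "x \<le> 0" for x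
  proof (cases "x < 0")
    case True
    have "DERIV F y :> 0" if "y < 0" for y using Fd[of y] b0_0[of y] that by simp
    then show ?thesis by (intro DERIV_isconst_end[symmetric, OF True] Fcont) auto
  qed (use that in auto)
  have up: "F x = F 1" if "1 \<le> x" for x
  proof (cases "1 < x")
    case True
    have "DERIV F y :> 0" if "1 < y" for y using Fd[of y] b0_0[of y] that by simp
    then show ?thesis by (intro DERIV_isconst_end[OF True] Fcont) auto
  qed (use that in auto)
  define c where "c = F 1 - F 0"
  have c: "c > 0" unfolding c_def
    using DERIV_pos_imp_increasing_open[of 0 1 F] Fd b0_pos Fcont by force
  define s where "s = (\<lambda>x. (1 / c) * (F x + (- F 0)))"
  define b where "b = (\<lambda>x. (1 / c) * b0 x)"
  have bs: "smooth1 m b" for m unfolding b_def by (intro smooth1_mult smooth1_const sm0)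
  have sd: "(s has_real_derivative b x) (at x)" for x
    unfolding s_def b_def using DERIV_cmult[OF DERIV_add[OF Fd[of x] DERIV_const[of "- F 0"]], of "1 / c"] by simp
  have ss: "smooth1 m s" for m
  proof (cases m)
    case 0
    then show ?thesis using smooth1_continuous[of "Suc 0" s] sd bs[of 0] by auto
  qed (use sd bs in auto)
  show ?thesis
  proof (rule that[of b s, OF bs ss sd])
    fix x
    show "0 \<le> b x" using b0_nn c by (simp add: b_def)
    show "x \<le> 0 \<Longrightarrow> b x = 0" "1 \<le> x \<Longrightarrow> b x = 0" using b0_0 by (auto simp: b_def)
    show "x \<le> 0 \<Longrightarrow> s x = 0" "1 \<le> x \<Longrightarrow> s x = 1"
      using low[of x] up[of x] c by (auto simp: s_def c_def)
    have "F 0 \<le> F x" using mono[of 0 x] low[of x] by (cases "x \<le> 0") auto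
    moreover have "F x \<le> F 1" using mono[of x 1] up[of x] by (cases "x \<le> 1") auto
    ultimately show "0 \<le> s x" "s x \<le> 1" using c by (auto simp: s_def c_def divide_simps)
  qed
qed

lemma separated_has_derivative:
  assumes "(a has_real_derivative a') (at (Re z))" "(b has_real_derivative b') (at (Im z))"
  shows "((\<lambda>z. a (Re z) * b (Im z)) has_derivative
     (\<lambda>v. Re v * (a' * b (Im z)) + Im v * (a (Re z) * b'))) (at z)"
proof -
  have "((\<lambda>z. a (Re z)) has_derivative (\<lambda>v. a' * Re v)) (at z)"
    using has_derivative_compose[of Re Re z UNIV a "(*) a'"] assms(1)
    by (simp add: has_field_derivative_def bounded_linear_imp_has_derivative[OF bounded_linear_Re])
  moreover have "((\<lambda>z. b (Im z)) has_derivative (\<lambda>v. b' * Im v)) (at z)"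
    using has_derivative_compose[of Im Im z UNIV b "(*) b'"] assms(2)
    by (simp add: has_field_derivative_def bounded_linear_imp_has_derivative[OF bounded_linear_Im])
  ultimately show ?thesis
    by (rule has_derivative_eq_rhs[OF has_derivative_mult]) (simp add: algebra_simps)
qed

lemma Ck_add: "Ck m u \<Longrightarrow> Ck m w \<Longrightarrow> Ck m (\<lambda>z. u z + w z)"
proof (induction m arbitrary: u w)
  case 0 then show ?case by (auto intro: continuous_intros)
next
  case (Suc m)
  have "frechet_derivative (\<lambda>z. u z + w z) (at z) = 
     (\<lambda>v. frechet_derivative u (at z) v + frechet_derivative w (at z) v)" for z
    by (rule frechet_derivative_at[symmetric])
      (use Suc.prems in \<open>auto intro!: has_derivative_add simp flip: frechet_derivative_works\<close>)
  with Suc show ?case by (auto intro!: differentiable_add)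
qed

lemma Ck_cmult: "Ck m u \<Longrightarrow> Ck m (\<lambda>z. c * u z)"
proof (induction m arbitrary: u)
  case 0 then show ?case by (auto intro: continuous_intros)
next
  case (Suc m)
  have "frechet_derivative (\<lambda>z. c * u z) (at z) = (\<lambda>v. c * frechet_derivative u (at z) v)" for z
    by (rule frechet_derivative_at[symmetric])
      (use Suc.prems in \<open>auto intro!: has_derivative_mult_right simp flip: frechet_derivative_works\<close>)
  with Suc show ?case by (auto intro!: differentiable_mult)
qed

lemma Ck_separated: "smooth1 m a \<Longrightarrow> smooth1 m b \<Longrightarrow> Ck m (\<lambda>z. a (Re z) * b (Im z))"
proof (induction m arbitrary: a b)
  case 0
  have "continuous_on UNIV (\<lambda>z. a (Re z))" "continuous_on UNIV (\<lambda>z. b (Im z))"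
    using 0 by (auto intro!: continuous_on_compose2[of UNIV a] continuous_on_compose2[of UNIV b] continuous_intros)
  then show ?case by (auto intro: continuous_intros)
next
  case (Suc m)
  then obtain a' b' where *: "\<And>x. (a has_real_derivative a' x) (at x)" "smooth1 m a'"
    "\<And>x. (b has_real_derivative b' x) (at x)" "smooth1 m b'" by auto
  have hd: "((\<lambda>z. a (Re z) * b (Im z)) has_derivative
     (\<lambda>v. Re v * (a' (Re z) * b (Im z)) + Im v * (a (Re z) * b' (Im z)))) (at z)" for z
    by (rule separated_has_derivative) (use * in auto)
  have fd: "frechet_derivative (\<lambda>z. a (Re z) * b (Im z)) (at z) = 
     (\<lambda>v. Re v * (a' (Re z) * b (Im z)) + Im v * (a (Re z) * b' (Im z)))" for z
    by (rule frechet_derivative_at[symmetric, OF hd])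
  have "Ck m (\<lambda>z. Re v * (a' (Re z) * b (Im z)) + Im v * (a (Re z) * b' (Im z)))" for v
    using * Suc.prems by (intro Ck_add Ck_cmult Suc.IH) (auto intro: smooth1_Suc_imp simp del: smooth1.simps)
  then show ?case using hd by (auto simp: fd differentiable_def)
qed

text \<open>Products of one-variable functions suffice as test functions: the mollifying kernel and the cutoff
functions of a rectangle both have this form, and so does the product of the two.\<close>

lemma test_function_separated:
  assumes "\<And>m. smooth1 m a" "\<And>m. smooth1 m b"
    and "\<And>x. x \<notin> {Re p..Re q} \<Longrightarrow> a x = 0" "\<And>y. y \<notin> {Im p..Im q} \<Longrightarrow> b y = 0"
    and "cbox p q \<subseteq> \<Omega>"
  shows "test_function \<Omega> (\<lambda>z. a (Re z) * b (Im z))"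
proof -
  have "{z. a (Re z) * b (Im z) \<noteq> 0} \<subseteq> cbox p q"
    using assms(3,4) by (force simp: cbox_complex_eq)
  then have "closure {z. a (Re z) * b (Im z) \<noteq> 0} \<subseteq> cbox p q"
    by (intro closure_minimal closed_cbox)
  moreover from this have "compact (closure {z. a (Re z) * b (Im z) \<noteq> 0})"
    using compact_cbox closed_closure by (meson bounded_cbox bounded_subset compact_eq_bounded_closed)
  ultimately show ?thesis using assms(1,2,5) by (auto simp: test_function_def Ck_separated)
qed

section \<open>Lebesgue measure in the plane and translations in \<open>L\<^sup>1\<close>\<close>

lemma complex_Basis_prod: "(\<Prod>b\<in>Basis. f b) = f 1 * f \<i>"
  by (simp add: Basis_complex_def)

lemma lborel_complex_eq_distr:
  "(lborel :: complex measure) = distr (lborel \<Otimes>\<^sub>M lborel) borel (\<lambda>(x, y). Complex x y)"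
proof (rule lborel_eqI)
  have [measurable]: "(\<lambda>(x, y). Complex x y) \<in> borel \<rightarrow>\<^sub>M borel"
    by (intro borel_measurable_continuous_onI)
      (auto simp: case_prod_unfold Complex_eq intro!: continuous_intros)
  fix l u :: complex
  assume lu: "\<And>b. b \<in> Basis \<Longrightarrow> l \<bullet> b \<le> u \<bullet> b"
  have le: "Re l \<le> Re u" "Im l \<le> Im u" using lu[of 1] lu[of \<i>] by (auto simp: Basis_complex_def)
  have "(\<lambda>(x, y). Complex x y) -` box l u \<inter> space (lborel \<Otimes>\<^sub>M lborel) = {Re l<..<Re u} \<times> {Im l<..<Im u}"
    by (auto simp: box_def Basis_complex_def space_pair_measure)
  moreover have "emeasure (distr (lborel \<Otimes>\<^sub>M lborel) borel (\<lambda>(x, y). Complex x y)) (box l u) =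
      emeasure (lborel \<Otimes>\<^sub>M lborel) ((\<lambda>(x, y). Complex x y) -` box l u \<inter> space (lborel \<Otimes>\<^sub>M lborel))"
    by (rule emeasure_distr) (auto simp: lborel_prod)
  ultimately show "emeasure (distr (lborel \<Otimes>\<^sub>M lborel) borel (\<lambda>(x, y). Complex x y)) (box l u)
      = ennreal (\<Prod>b\<in>Basis. (u - l) \<bullet> b)"
    using le by (simp add: lborel.emeasure_pair_measure_Times complex_Basis_prod ennreal_mult)
qed simp

lemma nn_integral_complex:
  assumes [measurable]: "f \<in> borel_measurable borel"
  shows "(\<integral>\<^sup>+z. f z \<partial>lborel) = (\<integral>\<^sup>+y. \<integral>\<^sup>+x. f (Complex x y) \<partial>lborel \<partial>lborel)"
    and "(\<integral>\<^sup>+z. f z \<partial>lborel) = (\<integral>\<^sup>+x. \<integral>\<^sup>+y. f (Complex x y) \<partial>lborel \<partial>lborel)"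
proof -
  have c: "(\<lambda>p. Complex (fst p) (snd p)) \<in> borel \<rightarrow>\<^sub>M borel"
    by (intro borel_measurable_continuous_onI) (auto simp: Complex_eq intro!: continuous_intros)
  then have [measurable]: "(\<lambda>(x, y). Complex x y) \<in> borel \<rightarrow>\<^sub>M borel" by (simp add: case_prod_unfold)
  have m: "(\<lambda>p. f (Complex (fst p) (snd p))) \<in> borel_measurable (lborel \<Otimes>\<^sub>M lborel)"
    using measurable_compose[OF c assms] by (simp add: lborel_prod)
  have "(\<integral>\<^sup>+z. f z \<partial>lborel) = (\<integral>\<^sup>+p. f (Complex (fst p) (snd p)) \<partial>(lborel \<Otimes>\<^sub>M lborel))"
    unfolding lborel_complex_eq_distr using c
    by (subst nn_integral_distr) (auto simp: case_prod_unfold lborel_prod)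
  then show "(\<integral>\<^sup>+z. f z \<partial>lborel) = (\<integral>\<^sup>+y. \<integral>\<^sup>+x. f (Complex x y) \<partial>lborel \<partial>lborel)"
    and "(\<integral>\<^sup>+z. f z \<partial>lborel) = (\<integral>\<^sup>+x. \<integral>\<^sup>+y. f (Complex x y) \<partial>lborel \<partial>lborel)"
    using lborel_pair.nn_integral_snd[OF m] lborel.nn_integral_fst[OF m] by simp_all
qed

lemma nn_integral_lborel_shift:
  fixes f :: "'a::euclidean_space \<Rightarrow> ennreal"
  assumes [measurable]: "f \<in> borel_measurable borel"
  shows "(\<integral>\<^sup>+z. f (z + w) \<partial>lborel) = (\<integral>\<^sup>+z. f z \<partial>lborel)"
proof -
  have "(\<integral>\<^sup>+z. f z \<partial>lborel) = (\<integral>\<^sup>+z. f z \<partial>distr lborel borel ((+) w))"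
    by (simp add: lborel_distr_plus)
  also have "\<dots> = (\<integral>\<^sup>+z. f (w + z) \<partial>lborel)" by (rule nn_integral_distr) auto
  finally show ?thesis by (simp add: add.commute)
qed

lemma lborel_reflect_shift: "lborel = distr lborel borel (\<lambda>w. z - w :: 'a::euclidean_space)"
  using lborel_affine[of "-1" z] by (simp add: density_1)

text \<open>Translation is an isometry of \<open>L\<^sup>1\<close>, so that its continuity passes to \<open>L\<^sup>1\<close>-limits.\<close>

lemma L1_translation_approx:
  fixes G :: "'a::euclidean_space \<Rightarrow> 'b::{banach, second_countable_topology}"
  assumes [measurable]: "G \<in> borel_measurable borel"
    and approx: "\<And>e::real. (0::real) < e \<Longrightarrow> \<exists>G'. G' \<in> borel_measurable borel \<and>
      (\<integral>\<^sup>+z. norm (G z - G' z) \<partial>lborel) \<le> e \<and> (\<lambda>n. \<integral>\<^sup>+z. norm (G' (z + w n) - G' z) \<partial>lborel) \<longlonglongrightarrow> 0"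
  shows "(\<lambda>n. \<integral>\<^sup>+z. norm (G (z + w n) - G z) \<partial>lborel) \<longlonglongrightarrow> 0"
proof (rule tendsto_0_if_Limsup_eq_0_ennreal, rule ccontr)
  let ?L = "Limsup sequentially (\<lambda>n. \<integral>\<^sup>+z. norm (G (z + w n) - G z) \<partial>lborel)"
  assume "?L \<noteq> 0"
  then obtain x where x: "0 < x" "x < ?L" using dense[of 0 ?L] by (auto simp: zero_less_iff_neq_zero)
  then obtain e :: real where "x = ennreal e" by (cases x) auto
  with x have e: "0 < e" "ennreal e < ?L" by auto
  from approx[of "e / 4"] e(1) obtain G' where [measurable]: "G' \<in> borel_measurable borel"
    and G': "(\<integral>\<^sup>+z. norm (G z - G' z) \<partial>lborel) \<le> e / 4"
      "(\<lambda>n. \<integral>\<^sup>+z. norm (G' (z + w n) - G' z) \<partial>lborel) \<longlonglongrightarrow> 0" by auto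
  have "\<forall>\<^sub>F n in sequentially. (\<integral>\<^sup>+z. norm (G' (z + w n) - G' z) \<partial>lborel) < ennreal (e / 4)"
    using G'(2) e(1) by (intro order_tendstoD) auto
  then have "\<forall>\<^sub>F n in sequentially. (\<integral>\<^sup>+z. norm (G (z + w n) - G z) \<partial>lborel) \<le> ennreal e"
  proof eventually_elim
    case (elim n)
    have "(\<integral>\<^sup>+z. norm (G (z + w n) - G z) \<partial>lborel) \<le>
      (\<integral>\<^sup>+z. ennreal (norm (G (z + w n) - G' (z + w n))) + ennreal (norm (G' (z + w n) - G' z)) + ennreal (norm (G z - G' z)) \<partial>lborel)"
    proof (rule nn_integral_mono)
      fix z
      have "norm (G (z + w n) - G z) \<le> norm (G (z + w n) - G' (z + w n)) + norm (G' (z + w n) - G' z) + norm (G z - G' z)"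
        using norm_triangle_ineq[of "G (z + w n) - G' (z + w n)" "G' (z + w n) - G' z + (G' z - G z)"]
          norm_triangle_ineq[of "G' (z + w n) - G' z" "G' z - G z"]
        by (simp add: norm_minus_commute)
      then show "ennreal (norm (G (z + w n) - G z)) \<le> ennreal (norm (G (z + w n) - G' (z + w n))) + ennreal (norm (G' (z + w n) - G' z)) + ennreal (norm (G z - G' z))"
        by (simp add: ennreal_leI flip: ennreal_plus)
    qed
    also have "\<dots> = (\<integral>\<^sup>+z. norm (G z - G' z) \<partial>lborel) + (\<integral>\<^sup>+z. norm (G' (z + w n) - G' z) \<partial>lborel)
        + (\<integral>\<^sup>+z. norm (G z - G' z) \<partial>lborel)"
      by (simp add: nn_integral_add nn_integral_lborel_shift[of "\<lambda>z. ennreal (norm (G z - G' z))"])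
    also have "\<dots> \<le> ennreal (e / 4) + ennreal (e / 4) + ennreal (e / 4)"
      using G'(1) elim by (intro add_mono) auto
    also have "\<dots> \<le> ennreal e" using e(1) by (simp add: ennreal_leI flip: ennreal_plus)
    finally show ?case .
  qed
  then have "?L \<le> ennreal e" by (rule Limsup_bounded)
  with e(2) show False by simp
qed

text \<open>For an open set the products of the indicator with its translates converge pointwise, and
\<open>\<bar>x - y\<bar> = x + y - 2 x y\<close> for indicator values \<open>x\<close>, \<open>y\<close> reduces the claim to dominated convergence.\<close>

lemma L1_translation_open:
  fixes U :: "'a::euclidean_space set" and c :: "'b::{banach, second_countable_topology}"
  assumes U: "open U" "emeasure lborel U < \<infinity>" and w: "w \<longlonglongrightarrow> 0"
  shows "(\<lambda>n. \<integral>\<^sup>+z. norm (indicator U (z + w n) *\<^sub>R c - indicator U z *\<^sub>R c) \<partial>lborel) \<longlonglongrightarrow> 0"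
proof -
  let ?I = "indicator U :: 'a \<Rightarrow> real"
  have [measurable]: "U \<in> sets borel" using U(1) by simp
  have int: "integrable lborel ?I" using U by auto
  have sh: "integrable lborel (\<lambda>z. ?I (z + v)) \<and> (LINT z|lborel. ?I (z + v)) = (LINT z|lborel. ?I z)" for v
  proof -
    have d: "distr lborel borel ((+) v) = (lborel :: 'a measure)" by (rule lborel_distr_plus)
    have "integrable lborel (\<lambda>z. ?I (v + z))"
      using int by (subst (asm) d[symmetric], subst (asm) integrable_distr_eq) auto
    moreover have "(LINT z|lborel. ?I (v + z)) = (LINT z|lborel. ?I z)"
      by (subst (2) d[symmetric], subst integral_distr) auto
    ultimately show ?thesis by (simp add: add.commute)
  qed
  have prod: "integrable lborel (\<lambda>z. ?I z * ?I (z + v))" for v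
    by (rule Bochner_Integration.integrable_bound[OF int]) (auto split: split_indicator)
  have "(\<lambda>n. LINT z|lborel. ?I z * ?I (z + w n)) \<longlonglongrightarrow> (LINT z|lborel. ?I z)"
  proof (rule integral_dominated_convergence[where w="?I"])
    show "AE z in lborel. (\<lambda>n. ?I z * ?I (z + w n)) \<longlonglongrightarrow> ?I z"
    proof (intro AE_I2)
      fix z
      show "(\<lambda>n. ?I z * ?I (z + w n)) \<longlonglongrightarrow> ?I z"
      proof (cases "z \<in> U")
        case True
        have "(\<lambda>n. z + w n) \<longlonglongrightarrow> z" using tendsto_add[OF tendsto_const w, of z] by simp
        then have "\<forall>\<^sub>F n in sequentially. z + w n \<in> U" using U(1) True by (rule topological_tendstoD)
        then show ?thesis by (intro tendsto_eventually) (auto elim!: eventually_mono simp: True)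
      qed simp
    qed
  qed (use int in \<open>auto split: split_indicator\<close>)
  then have "(\<lambda>n. norm c * (2 * (LINT z|lborel. ?I z) - 2 * (LINT z|lborel. ?I z * ?I (z + w n)))) \<longlonglongrightarrow>
      norm c * (2 * (LINT z|lborel. ?I z) - 2 * (LINT z|lborel. ?I z))"
    by (intro tendsto_intros)
  moreover have "(\<integral>\<^sup>+z. norm (?I (z + v) *\<^sub>R c - ?I z *\<^sub>R c) \<partial>lborel) =
     ennreal (norm c * (2 * (LINT z|lborel. ?I z) - 2 * (LINT z|lborel. ?I z * ?I (z + v))))" for v
  proof -
    have *: "norm (?I (z + v) *\<^sub>R c - ?I z *\<^sub>R c) = norm c * (?I (z + v) + ?I z - 2 * (?I z * ?I (z + v)))" for z
      by (auto split: split_indicator)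
    have "integrable lborel (\<lambda>z. norm c * (?I (z + v) + ?I z - 2 * (?I z * ?I (z + v))))"
      using sh[of v] int prod[of v] by auto
    then have "(\<integral>\<^sup>+z. norm c * (?I (z + v) + ?I z - 2 * (?I z * ?I (z + v))) \<partial>lborel) =
       ennreal (LINT z|lborel. norm c * (?I (z + v) + ?I z - 2 * (?I z * ?I (z + v))))"
      by (intro nn_integral_eq_integral) (auto split: split_indicator)
    also have "(LINT z|lborel. norm c * (?I (z + v) + ?I z - 2 * (?I z * ?I (z + v)))) =
       norm c * (2 * (LINT z|lborel. ?I z) - 2 * (LINT z|lborel. ?I z * ?I (z + v)))"
      using sh[of v] int prod[of v] by simp
    finally show ?thesis unfolding * .
  qed
  ultimately show ?thesis using tendsto_ennrealI by force
qed

lemma L1_translation: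
  fixes G :: "'a::euclidean_space \<Rightarrow> 'b::{banach, second_countable_topology}"
  assumes "integrable lborel G" and w: "w \<longlonglongrightarrow> 0"
  shows "(\<lambda>n. \<integral>\<^sup>+z. norm (G (z + w n) - G z) \<partial>lborel) \<longlonglongrightarrow> 0"
  using assms(1)
proof (induction rule: integrable_induct)
  case (base A c)
  then have [measurable]: "A \<in> sets borel" by simp
  show ?case
  proof (rule L1_translation_approx[where w=w and G="\<lambda>z. indicator A z *\<^sub>R c"])
    fix e :: real assume e: "0 < e"
    define e' where "e' = e / (norm c + 1)"
    have c: "0 < norm c + 1" by (simp add: add_nonneg_pos)
    have e': "0 < e'" using e c by (simp add: e'_def)
    obtain U where U: "open U" "A \<subseteq> U" "emeasure lborel (U - A) < e'"
      using outer_regular_lborel[OF _ e', of A] by auto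
    have [measurable]: "U \<in> sets borel" using U(1) by simp
    have "emeasure lborel U \<le> emeasure lborel A + emeasure lborel (U - A)"
      using U(2) by (subst plus_emeasure) (auto simp: Un_absorb1)
    also have "\<dots> < \<infinity>" using base(2) U(3) by (auto simp: less_top[symmetric])
    finally have fin: "emeasure lborel U < \<infinity>" .
    have "(\<integral>\<^sup>+z. norm (indicator A z *\<^sub>R c - indicator U z *\<^sub>R c) \<partial>lborel) = (\<integral>\<^sup>+z. ennreal (norm c) * indicator (U - A) z \<partial>lborel)"
      using U(2) by (intro nn_integral_cong) (auto split: split_indicator)
    also have "\<dots> = ennreal (norm c) * emeasure lborel (U - A)"
      by (rule nn_integral_cmult_indicator) auto
    also have "\<dots> \<le> ennreal (norm c) * ennreal e'" using U(3) by (intro mult_left_mono) auto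
    also have "\<dots> \<le> ennreal e"
    proof -
      have "norm c * e \<le> e * (norm c + 1)" using e by (simp add: algebra_simps)
      then have "norm c * e' \<le> e" unfolding e'_def using c by (simp add: pos_divide_le_eq)
      then show ?thesis by (simp add: ennreal_leI flip: ennreal_mult')
    qed
    finally show "\<exists>G'. G' \<in> borel_measurable borel \<and>
      (\<integral>\<^sup>+z. norm (indicator A z *\<^sub>R c - G' z) \<partial>lborel) \<le> e \<and> (\<lambda>n. \<integral>\<^sup>+z. norm (G' (z + w n) - G' z) \<partial>lborel) \<longlonglongrightarrow> 0"
      using L1_translation_open[OF U(1) fin w, of c] by (intro exI[of _ "\<lambda>z. indicator U z *\<^sub>R c"]) auto
  qed auto
next
  case (add f g)
  have [measurable]: "f \<in> borel_measurable borel" "g \<in> borel_measurable borel" using add by auto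
  let ?T = "\<lambda>h v. \<integral>\<^sup>+z. norm (h (z + v) - h z) \<partial>lborel"
  have le: "?T (\<lambda>z. f z + g z) v \<le> ?T f v + ?T g v" for v
  proof -
    have "?T (\<lambda>z. f z + g z) v \<le> (\<integral>\<^sup>+z. ennreal (norm (f (z + v) - f z)) + ennreal (norm (g (z + v) - g z)) \<partial>lborel)"
      by (intro nn_integral_mono) (simp add: ennreal_leI norm_diff_triangle_ineq flip: ennreal_plus)
    also have "\<dots> = ?T f v + ?T g v" by (rule nn_integral_add) auto
    finally show ?thesis .
  qed
  have "(\<lambda>n. ?T f (w n) + ?T g (w n)) \<longlonglongrightarrow> 0" using tendsto_add[OF add(3,4)] by simp
  then show ?case
    by (rule tendsto_sandwich[OF _ _ tendsto_const[of 0], rotated 2]) (auto simp: le)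
next
  case (lim f s)
  show ?case
  proof (rule L1_translation_approx)
    fix e :: real assume e: "0 < e"
    have [measurable]: "f \<in> borel_measurable borel" "s i \<in> borel_measurable borel" for i
      using lim(1,4) by auto
    have "(\<lambda>i. \<integral>\<^sup>+z. norm (f z - s i z) \<partial>lborel) \<longlonglongrightarrow> 0"
    proof -
      have "(\<lambda>i. \<integral>\<^sup>+z. ennreal (norm (f z - s i z)) \<partial>lborel) \<longlonglongrightarrow> (\<integral>\<^sup>+z. 0 \<partial>(lborel :: 'a measure))"
      proof (rule nn_integral_dominated_convergence[where w="\<lambda>z. ennreal (3 * norm (f z))"])
        show "AE z in lborel. ennreal (norm (f z - s i z)) \<le> ennreal (3 * norm (f z))" for i
          using lim(3)[of _ i] norm_triangle_ineq4[of "f _" "s i _"]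
          by (intro AE_I2 ennreal_leI) (smt (verit) UNIV_I space_lborel)
        show "(\<integral>\<^sup>+z. ennreal (3 * norm (f z)) \<partial>lborel) < \<infinity>"
          using lim(4) integrable_mult_right[of 3 lborel "\<lambda>z. norm (f z)"] 
          by (simp add: integrable_iff_bounded abs_mult ennreal_mult nn_integral_cmult ennreal_mult_less_top)
        have "(\<lambda>i. norm (f z - s i z)) \<longlonglongrightarrow> norm (f z - f z)" for z
          using lim(2)[of z] by (intro tendsto_intros) auto
        then show "AE z in lborel. (\<lambda>i. ennreal (norm (f z - s i z))) \<longlonglongrightarrow> 0"
          using tendsto_ennrealI by fastforce
      qed auto
      then show ?thesis by simp
    qed
    then have "\<forall>\<^sub>F i in sequentially. (\<integral>\<^sup>+z. norm (f z - s i z) \<partial>lborel) < ennreal e"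
      using e by (intro order_tendstoD) auto
    then obtain i where "(\<integral>\<^sup>+z. norm (f z - s i z) \<partial>lborel) < ennreal e"
      by (auto simp: eventually_sequentially)
    then show "\<exists>G'. G' \<in> borel_measurable borel \<and>
      (\<integral>\<^sup>+z. norm (f z - G' z) \<partial>lborel) \<le> e \<and> (\<lambda>n. \<integral>\<^sup>+z. norm (G' (z + w n) - G' z) \<partial>lborel) \<longlonglongrightarrow> 0"
      using lim(5)[of i] by (intro exI[of _ "s i"]) auto
  qed (use lim(4) in auto)
qed

lemma L1_translation_uniform:
  fixes G :: "'a::euclidean_space \<Rightarrow> 'b::{banach, second_countable_topology}"
  assumes "integrable lborel G" and e: "0 < (e::real)"
  obtains d where "0 < d" "\<And>w. norm w < d \<Longrightarrow> (\<integral>\<^sup>+z. norm (G (z + w) - G z) \<partial>lborel) \<le> e"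
proof -
  have "\<exists>d>0. \<forall>w. norm w < d \<longrightarrow> (\<integral>\<^sup>+z. norm (G (z + w) - G z) \<partial>lborel) \<le> e"
  proof (rule ccontr)
    assume "\<not> ?thesis"
    then have "\<forall>n. \<exists>w. norm w < inverse (real (Suc n)) \<and> ennreal e < (\<integral>\<^sup>+z. norm (G (z + w) - G z) \<partial>lborel)"
      by (meson inverse_positive_iff_positive not_le of_nat_0_less_iff zero_less_Suc)
    then obtain w where w: "\<And>n. norm (w n) < inverse (real (Suc n))"
      "\<And>n. ennreal e < (\<integral>\<^sup>+z. norm (G (z + w n) - G z) \<partial>lborel)" by metis
    have "w \<longlonglongrightarrow> 0"
      by (rule Lim_null_comparison[OF _ LIMSEQ_inverse_real_of_nat])
        (use w(1) in \<open>auto intro!: always_eventually less_imp_le\<close>)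
    from L1_translation[OF assms(1) this]
    have "\<forall>\<^sub>F n in sequentially. (\<integral>\<^sup>+z. norm (G (z + w n) - G z) \<partial>lborel) < ennreal e"
      using e by (intro order_tendstoD) auto
    then show False using w(2) by (auto simp: eventually_sequentially) (meson le_refl order_less_asym)
  qed
  with that show ?thesis by blast
qed

text \<open>By Fubini, mollification moves \<open>G\<close> in \<open>L\<^sup>1\<close> by at most the average, with weight \<open>\<kappa>\<close>, of its
displacement under small translations.\<close>

lemma L1_mollify:
  fixes G :: "'a::euclidean_space \<Rightarrow> 'b::{banach, second_countable_topology}"
  assumes G: "integrable lborel G"
    and \<kappa>: "continuous_on UNIV \<kappa>" "\<And>w. 0 \<le> \<kappa> w" "\<And>w. \<kappa> w \<le> B" "(\<integral>\<^sup>+w. ennreal (\<kappa> w) \<partial>lborel) = 1"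
    and supp: "\<And>w. d \<le> norm w \<Longrightarrow> \<kappa> w = 0"
    and tr: "\<And>w. norm w < d \<Longrightarrow> (\<integral>\<^sup>+z. norm (G (z + w) - G z) \<partial>lborel) \<le> e"
  shows "(\<integral>\<^sup>+z. norm ((LINT w|lborel. \<kappa> (z - w) *\<^sub>R G w) - G z) \<partial>lborel) \<le> e"
proof -
  have [measurable]: "G \<in> borel_measurable borel" using G by auto
  have [measurable]: "\<kappa> \<in> borel_measurable borel" using \<kappa>(1) by (rule borel_measurable_continuous_onI)
  have intk: "integrable lborel \<kappa>" "(LINT w|lborel. \<kappa> w) = 1"
  proof -
    show "integrable lborel \<kappa>" using \<kappa>(2,4) by (intro integrableI_nonneg) auto
    show "(LINT w|lborel. \<kappa> w) = 1" using \<kappa>(2,4) by (subst integral_eq_nn_integral) auto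
  qed
  have pt: "ennreal (norm ((LINT w|lborel. \<kappa> (z - w) *\<^sub>R G w) - G z)) \<le>
      (\<integral>\<^sup>+w. ennreal (\<kappa> w) * ennreal (norm (G (z - w) - G z)) \<partial>lborel)" for z
  proof -
    have i1: "integrable lborel (\<lambda>w. \<kappa> (z - w) *\<^sub>R G w)"
    proof (rule Bochner_Integration.integrable_bound)
      show "integrable lborel (\<lambda>w. B *\<^sub>R G w)" using G by auto
      show "AE w in lborel. norm (\<kappa> (z - w) *\<^sub>R G w) \<le> norm (B *\<^sub>R G w)"
        using \<kappa>(2,3) by (auto intro!: mult_right_mono AE_I2 simp: abs_of_nonneg order_trans[OF \<kappa>(2,3)])
    qed auto
    then have i2: "integrable lborel (\<lambda>w. \<kappa> w *\<^sub>R G (z - w))"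
      by (subst (asm) lborel_reflect_shift[of z]) (simp add: integrable_distr_eq)
    have "(LINT w|lborel. \<kappa> (z - w) *\<^sub>R G w) = (LINT w|lborel. \<kappa> w *\<^sub>R G (z - w))"
      by (subst lborel_reflect_shift[of z]) (simp add: integral_distr)
    moreover have "(LINT w|lborel. \<kappa> w *\<^sub>R G z) = G z" using intk by simp
    ultimately have "(LINT w|lborel. \<kappa> (z - w) *\<^sub>R G w) - G z = (LINT w|lborel. \<kappa> w *\<^sub>R G (z - w) - \<kappa> w *\<^sub>R G z)"
      using i2 intk by (subst Bochner_Integration.integral_diff) auto
    also have "\<dots> = (LINT w|lborel. \<kappa> w *\<^sub>R (G (z - w) - G z))" by (simp add: scaleR_diff_right)
    finally have eq: "(LINT w|lborel. \<kappa> (z - w) *\<^sub>R G w) - G z = (LINT w|lborel. \<kappa> w *\<^sub>R (G (z - w) - G z))" .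
    have "integrable lborel (\<lambda>w. \<kappa> w *\<^sub>R (G (z - w) - G z))"
      using i2 intk by (simp add: scaleR_diff_right)
    then have "ennreal (norm ((LINT w|lborel. \<kappa> (z - w) *\<^sub>R G w) - G z)) \<le>
       (\<integral>\<^sup>+w. ennreal (norm (\<kappa> w *\<^sub>R (G (z - w) - G z))) \<partial>lborel)"
      unfolding eq by (rule integral_norm_bound_ennreal)
    then show ?thesis using \<kappa>(2) by (simp add: ennreal_mult)
  qed
  have "(\<integral>\<^sup>+z. norm ((LINT w|lborel. \<kappa> (z - w) *\<^sub>R G w) - G z) \<partial>lborel) \<le>
     (\<integral>\<^sup>+z. \<integral>\<^sup>+w. ennreal (\<kappa> w) * ennreal (norm (G (z - w) - G z)) \<partial>lborel \<partial>lborel)"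
    by (intro nn_integral_mono pt)
  also have "\<dots> = (\<integral>\<^sup>+w. \<integral>\<^sup>+z. ennreal (\<kappa> w) * ennreal (norm (G (z - w) - G z)) \<partial>lborel \<partial>lborel)"
    by (rule lborel_pair.Fubini'[symmetric]) (simp add: case_prod_unfold)
  also have "\<dots> = (\<integral>\<^sup>+w. ennreal (\<kappa> w) * (\<integral>\<^sup>+z. norm (G (z - w) - G z) \<partial>lborel) \<partial>lborel)"
    by (intro nn_integral_cong nn_integral_cmult) auto
  also have "\<dots> \<le> (\<integral>\<^sup>+w. ennreal (\<kappa> w) * e \<partial>lborel)"
  proof (intro nn_integral_mono)
    fix w :: 'a
    show "ennreal (\<kappa> w) * (\<integral>\<^sup>+z. norm (G (z - w) - G z) \<partial>lborel) \<le> ennreal (\<kappa> w) * e"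
      using tr[of "- w"] supp[of w] by (cases "norm w < d") (auto intro!: mult_left_mono)
  qed
  also have "\<dots> = e" using \<kappa>(4) by (subst nn_integral_multc) auto
  finally show ?thesis .
qed

section \<open>Extension by zero across the boundary of a rectangle\<close>

lemma measure_cbox_complex:
  assumes "Re a \<le> Re b" "Im a \<le> Im b"
  shows "measure lborel (cbox a b) = (Re b - Re a) * (Im b - Im a)"
proof -
  have "measure lborel (cbox a b) = (\<Prod>i\<in>Basis. (b - a) \<bullet> i)"
    using assms by (intro measure_lborel_cbox) (auto simp: Basis_complex_def)
  then show ?thesis by (simp add: complex_Basis_prod)
qed

lemma mem_box_0_complex: "z \<in> box 0 q \<longleftrightarrow> 0 < Re z \<and> Re z < Re q \<and> 0 < Im z \<and> Im z < Im q"
  by (auto simp: in_box_complex_iff)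

lemma integrable_continuous_vanishing:
  fixes F :: "'a::euclidean_space \<Rightarrow> 'b::{banach, second_countable_topology}"
  assumes "continuous_on UNIV F" "compact S" "\<And>z. z \<notin> S \<Longrightarrow> F z = 0"
  shows "integrable lborel F"
proof -
  have "integrable lborel (\<lambda>x. indicator S x *\<^sub>R F x)"
    using assms(1,2) by (intro borel_integrable_compact) (auto intro: continuous_on_subset)
  also have "(\<lambda>x. indicator S x *\<^sub>R F x) = F" using assms(3) by (auto simp: fun_eq_iff indicator_def)
  finally show ?thesis .
qed

lemma eventually_2_over_Suc_less:
  assumes "0 < m" shows "\<forall>\<^sub>F j in sequentially. 2 / real (Suc j) < m"
  using order_tendstoD(2)[OF tendsto_mult_right_zero[OF LIMSEQ_inverse_real_of_nat, of 2] assms]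
  by (simp only: divide_inverse)

text \<open>The cutoffs are supported at distance \<open>1/(j+1)\<close> from the end points and are constant at
distance \<open>2/(j+1)\<close>, so that a slope of order \<open>j+1\<close> is confined to strips of width of order
\<open>1/(j+1)\<close>.\<close>

lemma cutoff_sequence:
  fixes L :: real
  obtains S D :: "nat \<Rightarrow> real \<Rightarrow> real" and C :: real where
    "\<And>j m. smooth1 m (S j)" "\<And>j x. (S j has_real_derivative D j x) (at x)"
    "\<And>j. continuous_on UNIV (D j)"
    "\<And>j x. 0 \<le> S j x" "\<And>j x. S j x \<le> 1"
    "\<And>j x. x \<notin> {1 / Suc j..L - 1 / Suc j} \<Longrightarrow> S j x = 0"
    "\<And>x. 0 < x \<Longrightarrow> x < L \<Longrightarrow> (\<lambda>j. S j x) \<longlonglongrightarrow> 1"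
    "\<And>j x. \<bar>D j x\<bar> \<le> C * Suc j"
    "\<And>j x. 2 / Suc j \<le> x \<Longrightarrow> x \<le> L - 2 / Suc j \<Longrightarrow> D j x = 0"
proof -
  obtain b s :: "real \<Rightarrow> real" where
    b: "\<And>m. smooth1 m b" and s: "\<And>m. smooth1 m s" and sd: "\<And>x. (s has_real_derivative b x) (at x)"
    and bnn: "\<And>x. 0 \<le> b x" and b0: "\<And>x. x \<le> 0 \<Longrightarrow> b x = 0" "\<And>x. 1 \<le> x \<Longrightarrow> b x = 0"
    and s0: "\<And>x. x \<le> 0 \<Longrightarrow> s x = 0" and s1: "\<And>x. 1 \<le> x \<Longrightarrow> s x = 1" 
    and s01: "\<And>x. 0 \<le> s x" "\<And>x. s x \<le> 1"
    by (rule smooth_bump_and_step) blast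
  have bc: "continuous_on UNIV b" using smooth1_continuous[OF b[of 0]] .
  have "compact (b ` {0..1})" using bc by (intro compact_continuous_image) (auto intro: continuous_on_subset)
  then obtain B where B: "0 < B" "\<And>x. x \<in> {0..1} \<Longrightarrow> \<bar>b x\<bar> \<le> B"
    by (auto dest!: compact_imp_bounded simp: bounded_pos)
  have B': "b x \<le> B" for x
  proof (cases "x \<in> {0..1}")
    case True then show ?thesis using B(2)[of x] by simp
  next
    case False then show ?thesis using b0[of x] B(1) by auto
  qed
  define S where "S = (\<lambda>j x. s (real (Suc j) * x + (-1)) * s ((- real (Suc j)) * x + (real (Suc j) * L - 1)))"
  define D where "D = (\<lambda>j x. real (Suc j) * b (real (Suc j) * x + (-1)) * s ((- real (Suc j)) * x + (real (Suc j) * L - 1))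
     - real (Suc j) * (s (real (Suc j) * x + (-1)) * b ((- real (Suc j)) * x + (real (Suc j) * L - 1))))"
  have sc: "continuous_on UNIV (\<lambda>x. s (c * x + d))" "continuous_on UNIV (\<lambda>x. b (c * x + d))" for c d
    using smooth1_continuous[OF smooth1_affine[OF s[of 0]]] smooth1_continuous[OF smooth1_affine[OF b[of 0]]] by auto
  show ?thesis
  proof (rule that[of S D "2 * B"])
    fix j :: nat and x :: real
    let ?N = "real (Suc j)"
    have N: "?N > 0" by simp
    show "smooth1 m (S j)" for m unfolding S_def by (intro smooth1_mult smooth1_affine s)
    have d: "((\<lambda>x. s (c * x + d)) has_real_derivative c * b (c * x + d)) (at x)" for c d
    proof -
      have "((\<lambda>x. c * x + d) has_real_derivative c) (at x)" by (auto intro!: derivative_eq_intros)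
      from DERIV_chain2[OF sd this] show ?thesis by (simp add: mult.commute)
    qed
    show "(S j has_real_derivative D j x) (at x)"
      unfolding S_def D_def by (rule DERIV_cong[OF DERIV_mult[OF d d]]) (simp add: algebra_simps)
    show "continuous_on UNIV (D j)" unfolding D_def by (intro continuous_intros sc)
    show "0 \<le> S j x" "S j x \<le> 1" using s01 by (auto simp: S_def intro!: mult_le_one)
    have e: "?N * x + (-1) \<le> 0 \<longleftrightarrow> x \<le> 1 / ?N" "1 \<le> ?N * x + (-1) \<longleftrightarrow> 2 / ?N \<le> x"
      "(- ?N) * x + (?N * L - 1) \<le> 0 \<longleftrightarrow> L - 1 / ?N \<le> x" 
      "1 \<le> (- ?N) * x + (?N * L - 1) \<longleftrightarrow> x \<le> L - 2 / ?N"
      using N by (simp_all add: field_simps del: of_nat_Suc)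
    show "S j x = 0" if "x \<notin> {1 / ?N..L - 1 / ?N}"
      using that s0 e(1,3) unfolding S_def by (metis atLeastAtMost_iff linear mult_eq_0_iff)
    show "D j x = 0" if "2 / ?N \<le> x" "x \<le> L - 2 / ?N"
      using b0(2) that e(2,4) unfolding D_def by simp
    have "\<bar>D j x\<bar> \<le> ?N * (B * 1) + ?N * (1 * B)"
    proof -
      have "\<bar>D j x\<bar> \<le> \<bar>?N * (b (?N * x + (-1)) * s ((- ?N) * x + (?N * L - 1)))\<bar>
        + \<bar>?N * (s (?N * x + (-1)) * b ((- ?N) * x + (?N * L - 1)))\<bar>"
        unfolding D_def using abs_triangle_ineq4 by (simp add: mult.assoc)
      also have "\<dots> \<le> ?N * (B * 1) + ?N * (1 * B)"
        unfolding abs_mult using bnn s01 B' N B(1)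
        by (intro add_mono mult_mono mult_left_mono) (auto simp: abs_of_nonneg)
      finally show ?thesis .
    qed
    then show "\<bar>D j x\<bar> \<le> 2 * B * ?N" by simp
  next
    fix x :: real assume x: "0 < x" "x < L"
    define m where "m = min x (L - x)"
    have "m > 0" using x by (simp add: m_def)
      then have "\<forall>\<^sub>F j in sequentially. 2 / real (Suc j) < m" by (rule eventually_2_over_Suc_less)
    then have "\<forall>\<^sub>F j in sequentially. S j x = 1"
    proof eventually_elim
      case (elim j)
      have "2 / real (Suc j) < x" "2 / real (Suc j) < L - x" using elim by (auto simp: m_def)
      then have "1 \<le> real (Suc j) * x + (-1)" "1 \<le> (- real (Suc j)) * x + (real (Suc j) * L - 1)"
        by (simp_all add: field_simps)
      then show ?case unfolding S_def by (simp only: s1)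
    qed
    then show "(\<lambda>j. S j x) \<longlonglongrightarrow> 1" by (rule tendsto_eventually)
  qed
qed

text \<open>The strip has area of order \<open>1/(j+1)\<close>, which compensates the growth of \<open>h\<close>; uniform continuity
makes \<open>g\<close> small on the strip, because every point there is close to a boundary point.\<close>

lemma boundary_strip_integral_tendsto_0:
  fixes g :: "complex \<Rightarrow> complex" and h :: "nat \<Rightarrow> complex \<Rightarrow> real" and C :: real
  assumes q: "0 < Re q" "0 < Im q"
    and g: "continuous_on UNIV g" "\<And>z. z \<notin> box 0 q \<Longrightarrow> g z = 0"
    and h: "\<And>j. h j \<in> borel_measurable borel" "\<And>j z. z \<in> box 0 q \<Longrightarrow> \<bar>h j z\<bar> \<le> C * Suc j"
    and h0: "\<And>j z. 2 / Suc j \<le> Re z \<Longrightarrow> Re z \<le> Re q - 2 / Suc j \<Longrightarrow>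
       2 / Suc j \<le> Im z \<Longrightarrow> Im z \<le> Im q - 2 / Suc j \<Longrightarrow> h j z = 0"
  shows "(\<lambda>j. LINT z|lborel. h j z *\<^sub>R g z) \<longlonglongrightarrow> 0"
proof (rule LIMSEQ_I)
  fix e :: real assume e: "0 < e"
  have C: "0 \<le> C"
    using h(2)[of "q / 2" 0] q by (auto simp: mem_box_0_complex)
  define K where "K = 4 * (C + 1) * (Re q + Im q)"
  have K: "0 < K" using q C by (simp add: K_def add_pos_pos)
  \<comment> \<open>four strips of width \<open>2/(j+1)\<close> in which the integrand is at most \<open>C (j+1) \<eta>\<close>\<close>
  define \<eta> where "\<eta> = e / (2 * K)"
  have \<eta>: "0 < \<eta>" using e K by (simp add: \<eta>_def)
  have "uniformly_continuous_on (cbox 0 q) g"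
    using g(1) by (intro compact_uniformly_continuous) (auto intro: continuous_on_subset)
  then obtain d where d: "0 < d" "\<And>z w. z \<in> cbox 0 q \<Longrightarrow> w \<in> cbox 0 q \<Longrightarrow> dist z w < d \<Longrightarrow> dist (g z) (g w) < \<eta>"
    using \<eta> unfolding uniformly_continuous_on_def by metis
  define m where "m = min d (min (Re q) (Im q))"
  have m: "0 < m" using d q by (simp add: m_def)
  then obtain J where J: "\<And>j. j \<ge> J \<Longrightarrow> 2 / real (Suc j) < m"
    using eventually_2_over_Suc_less by (auto simp: eventually_sequentially)
  have small: "norm (g z) \<le> \<eta>" if z: "z \<in> box 0 q" and w: "w \<in> cbox 0 q - box 0 q" "dist z w < d" for z w
    using d(2)[of z w] g(2)[of w] that subsetD[OF box_subset_cbox z] by (auto simp: dist_norm)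
  show "\<exists>J. \<forall>j\<ge>J. norm ((LINT z|lborel. h j z *\<^sub>R g z) - 0) < e"
  proof (intro exI[of _ J] allI impI)
    fix j assume "j \<ge> J"
    define r where "r = 2 / real (Suc j)"
    have r: "0 < r" "r < d" "r < Re q" "r < Im q" using J[OF \<open>j \<ge> J\<close>] by (auto simp: r_def m_def)
    define M where "M = C * Suc j * \<eta>"
    have M: "0 \<le> M" using C \<eta> by (simp add: M_def)
    define b where "b = (\<lambda>z. M * (indicator (cbox 0 (Complex r (Im q))) z + indicator (cbox (Complex (Re q - r) 0) q) z
       + indicator (cbox 0 (Complex (Re q) r)) z + indicator (cbox (Complex 0 (Im q - r)) q) z) :: real)"
    have fin: "emeasure lborel (cbox u v) < \<infinity>" for u v :: complex by (rule emeasure_lborel_cbox_finite)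
    have bint: "integrable lborel b" "(LINT z|lborel. b z) = M * (2 * r * Im q + 2 * r * Re q)"
    proof -
      show "integrable lborel b" unfolding b_def using fin
        by (intro integrable_mult_right Bochner_Integration.integrable_add) auto
      have "(LINT z|lborel. b z) = M * (measure lborel (cbox 0 (Complex r (Im q))) + measure lborel (cbox (Complex (Re q - r) 0) q)
         + measure lborel (cbox 0 (Complex (Re q) r)) + measure lborel (cbox (Complex 0 (Im q - r)) q))"
        unfolding b_def using fin by simp
      also have "\<dots> = M * (r * Im q + r * Im q + Re q * r + Re q * r)"
        using r q by (simp add: measure_cbox_complex)
      finally show "(LINT z|lborel. b z) = M * (2 * r * Im q + 2 * r * Re q)" by (simp add: algebra_simps)
    qed
    have bnn: "0 \<le> b z" for z using M by (auto simp: b_def)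
    have bound: "norm (h j z *\<^sub>R g z) \<le> b z" for z
    proof (cases "z \<in> box 0 q \<and> h j z \<noteq> 0")
      case False
      then show ?thesis using bnn[of z] g(2)[of z] by auto
    next
      case True
      then have zb: "0 < Re z" "Re z < Re q" "0 < Im z" "Im z < Im q" by (auto simp: mem_box_0_complex)
      from True h0[of j z] have "Re z < r \<or> Re q - r < Re z \<or> Im z < r \<or> Im q - r < Im z"
        unfolding r_def by force
      \<comment> \<open>the boundary point \<open>w\<close> is the projection of \<open>z\<close> to the nearby side\<close>
      then obtain w where w: "w \<in> cbox 0 q - box 0 q" "dist z w < d" and in1:
         "z \<in> cbox 0 (Complex r (Im q)) \<or> z \<in> cbox (Complex (Re q - r) 0) q \<or> z \<in> cbox 0 (Complex (Re q) r) \<or> z \<in> cbox (Complex 0 (Im q - r)) q"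
      proof (elim disjE)
        assume "Re z < r"
        with zb r show thesis
          by (intro that[of "Complex 0 (Im z)"])
            (auto simp: mem_box_0_complex in_cbox_complex_iff dist_norm cmod_def)
      next
        assume "Re q - r < Re z"
        with zb r show thesis
          by (intro that[of "Complex (Re q) (Im z)"])
            (auto simp: mem_box_0_complex in_cbox_complex_iff dist_norm cmod_def)
      next
        assume "Im z < r"
        with zb r show thesis
          by (intro that[of "Complex (Re z) 0"])
            (auto simp: mem_box_0_complex in_cbox_complex_iff dist_norm cmod_def)
      next
        assume "Im q - r < Im z"
        with zb r show thesis
          by (intro that[of "Complex (Re z) (Im q)"])
            (auto simp: mem_box_0_complex in_cbox_complex_iff dist_norm cmod_def)
      qed
      have "norm (h j z *\<^sub>R g z) \<le> (C * Suc j) * \<eta>"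
        using h(2)[of z j] small[OF _ w] True by (auto simp: norm_scaleR intro!: mult_mono order_trans[OF abs_ge_zero h(2)])
      then have "norm (h j z *\<^sub>R g z) \<le> M" by (simp add: M_def)
      also have "M * 1 \<le> b z"
        unfolding b_def using in1 by (intro mult_left_mono M) (auto split: split_indicator)
      finally show ?thesis by simp
    qed
    have [measurable]: "h j \<in> borel_measurable borel" "g \<in> borel_measurable borel"
      using h(1) g(1) by (auto intro: borel_measurable_continuous_onI)
    have "integrable lborel (\<lambda>z. h j z *\<^sub>R g z)"
      by (rule Bochner_Integration.integrable_bound[OF bint(1)]) (use bound bnn in \<open>auto simp: abs_of_nonneg\<close>)
    then have "norm (LINT z|lborel. h j z *\<^sub>R g z) \<le> (LINT z|lborel. b z)"
      by (rule Bochner_Integration.integral_norm_bound_integral[OF _ bint(1) bound])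
    also have "\<dots> = C * \<eta> * (real (Suc j) * r) * (2 * (Im q + Re q))"
      unfolding bint(2) M_def by (simp add: algebra_simps)
    also have "real (Suc j) * r = 2" by (simp add: r_def del: of_nat_Suc)
    also have "C * \<eta> * 2 * (2 * (Im q + Re q)) \<le> K * \<eta>"
      unfolding K_def using q \<eta> by (auto simp: algebra_simps intro!: add_mono)
    also have "\<dots> < e" using K e by (simp add: \<eta>_def)
    finally show "norm ((LINT z|lborel. h j z *\<^sub>R g z) - 0) < e" by simp
  qed
qed

lemma frechet_derivative_separated:
  assumes "(a has_real_derivative a') (at (Re z))" "(b has_real_derivative b') (at (Im z))"
  shows "frechet_derivative (\<lambda>z. a (Re z) * b (Im z)) (at z) v
     = Re v * (a' * b (Im z)) + Im v * (a (Re z) * b')"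
  using frechet_derivative_at[OF separated_has_derivative[OF assms]] by metis

text \<open>Testing with the smooth product times a cutoff and passing to the limit removes the requirement
of compact support in the rectangle: the derivative of the cutoff contributes a strip integral that
tends to zero.\<close>

lemma weak_partial_extends_by_0:
  fixes g G :: "complex \<Rightarrow> complex"
  assumes q: "0 < Re q" "0 < Im q"
    and g: "continuous_on UNIV g" "\<And>z. z \<notin> box 0 q \<Longrightarrow> g z = 0"
    and G: "integrable lborel G" "\<And>z. z \<notin> box 0 q \<Longrightarrow> G z = 0"
    and weak: "\<And>u. test_function (box 0 q) u \<Longrightarrow>
        (LINT z|lborel. frechet_derivative u (at z) v *\<^sub>R g z) = - (LINT z|lborel. u z *\<^sub>R G z)"
    and a: "\<And>m. smooth1 m a" "\<And>x. (a has_real_derivative a' x) (at x)" "continuous_on UNIV a'"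
    and b: "\<And>m. smooth1 m b" "\<And>x. (b has_real_derivative b' x) (at x)" "continuous_on UNIV b'"
  shows "(LINT z|lborel. (Re v * (a' (Re z) * b (Im z)) + Im v * (a (Re z) * b' (Im z))) *\<^sub>R g z)
     = - (LINT z|lborel. (a (Re z) * b (Im z)) *\<^sub>R G z)" (is "(LINT z|lborel. ?du z *\<^sub>R g z) = - (LINT z|lborel. ?u z *\<^sub>R G z)")
proof -
  obtain S D :: "nat \<Rightarrow> real \<Rightarrow> real" and CS :: real where S: "\<And>j m. smooth1 m (S j)" "\<And>j x. (S j has_real_derivative D j x) (at x)"
    "\<And>j. continuous_on UNIV (D j)" "\<And>j x. 0 \<le> S j x" "\<And>j x. S j x \<le> 1"
    "\<And>j x. x \<notin> {1 / Suc j..Re q - 1 / Suc j} \<Longrightarrow> S j x = 0"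
    "\<And>x. 0 < x \<Longrightarrow> x < Re q \<Longrightarrow> (\<lambda>j. S j x) \<longlonglongrightarrow> 1"
    "\<And>j x. \<bar>D j x\<bar> \<le> CS * Suc j" "\<And>j x. 2 / Suc j \<le> x \<Longrightarrow> x \<le> Re q - 2 / Suc j \<Longrightarrow> D j x = 0"
    by (rule cutoff_sequence[of "Re q"]) blast
  obtain T E :: "nat \<Rightarrow> real \<Rightarrow> real" and CT :: real where T: "\<And>j m. smooth1 m (T j)" "\<And>j x. (T j has_real_derivative E j x) (at x)"
    "\<And>j. continuous_on UNIV (E j)" "\<And>j x. 0 \<le> T j x" "\<And>j x. T j x \<le> 1"
    "\<And>j x. x \<notin> {1 / Suc j..Im q - 1 / Suc j} \<Longrightarrow> T j x = 0"
    "\<And>x. 0 < x \<Longrightarrow> x < Im q \<Longrightarrow> (\<lambda>j. T j x) \<longlonglongrightarrow> 1"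
    "\<And>j x. \<bar>E j x\<bar> \<le> CT * Suc j" "\<And>j x. 2 / Suc j \<le> x \<Longrightarrow> x \<le> Im q - 2 / Suc j \<Longrightarrow> E j x = 0"
    by (rule cutoff_sequence[of "Im q"]) blast
  define \<psi> where "\<psi> = (\<lambda>j z. S j (Re z) * T j (Im z))"
  define h where "h = (\<lambda>j z. Re v * (a (Re z) * D j (Re z) * (b (Im z) * T j (Im z)))
      + Im v * (a (Re z) * S j (Re z) * (b (Im z) * E j (Im z))))"
  have c1: "continuous_on A (\<lambda>z. f (Re z))" "continuous_on A (\<lambda>z. f (Im z))" 
    if "continuous_on UNIV f" for f :: "real \<Rightarrow> real" and A
    using that by (auto intro!: continuous_on_compose2[of UNIV f] continuous_intros)
  have ca: "continuous_on UNIV a" "continuous_on UNIV b" "continuous_on UNIV (S j)" "continuous_on UNIV (T j)" for j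
    using smooth1_continuous a(1)[of 0] b(1)[of 0] S(1)[of 0 j] T(1)[of 0 j] by auto
  have g0: "g z = 0" if "z \<notin> cbox 0 q" for z
    using that g(2)[of z] box_subset_cbox[of 0 q] by auto
  have tf: "test_function (box 0 q) (\<lambda>z. (a (Re z) * S j (Re z)) * (b (Im z) * T j (Im z)))" for j
  proof (rule test_function_separated[where p="Complex (1 / Suc j) (1 / Suc j)" and q="Complex (Re q - 1 / Suc j) (Im q - 1 / Suc j)"])
    show "cbox (Complex (1 / real (Suc j)) (1 / real (Suc j))) (Complex (Re q - 1 / real (Suc j)) (Im q - 1 / real (Suc j))) \<subseteq> box 0 q"
    proof
      fix x assume x: "x \<in> cbox (Complex (1 / real (Suc j)) (1 / real (Suc j))) (Complex (Re q - 1 / real (Suc j)) (Im q - 1 / real (Suc j)))"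
      obtain r where r: "r = 1 / real (Suc j)" "0 < r" by simp
      from x r(2) show "x \<in> box 0 q"
        unfolding mem_box_0_complex in_cbox_complex_iff r(1)[symmetric] by auto
    qed
  qed (use S(6) T(6) in \<open>auto intro!: smooth1_mult a b S T\<close>)
  have eq: "(LINT z|lborel. (\<psi> j z * ?du z) *\<^sub>R g z) + (LINT z|lborel. h j z *\<^sub>R g z) = - (LINT z|lborel. \<psi> j z *\<^sub>R (?u z *\<^sub>R G z))" for j
  proof -
    have fd: "frechet_derivative (\<lambda>z. (a (Re z) * S j (Re z)) * (b (Im z) * T j (Im z))) (at z) v = \<psi> j z * ?du z + h j z" for z
    proof -
      have "((\<lambda>x. a x * S j x) has_real_derivative a' x * S j x + D j x * a x) (at x)"
        "((\<lambda>x. b x * T j x) has_real_derivative b' x * T j x + E j x * b x) (at x)" for x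
        using DERIV_mult[OF a(2) S(2)] DERIV_mult[OF b(2) T(2)] by auto
      from frechet_derivative_separated[OF this] show ?thesis
        by (simp add: \<psi>_def h_def algebra_simps)
    qed
    have i: "integrable lborel (\<lambda>z. (\<psi> j z * ?du z) *\<^sub>R g z)" "integrable lborel (\<lambda>z. h j z *\<^sub>R g z)"
      unfolding \<psi>_def h_def
      by (intro integrable_continuous_vanishing[where S="cbox 0 q"] continuous_intros c1 ca S T a b g(1); simp add: g0)+
    have "- (LINT z|lborel. \<psi> j z *\<^sub>R (?u z *\<^sub>R G z)) = - (LINT z|lborel. ((a (Re z) * S j (Re z)) * (b (Im z) * T j (Im z))) *\<^sub>R G z)"
      by (simp add: \<psi>_def mult_ac)
    also have "\<dots> = (LINT z|lborel. (\<psi> j z * ?du z + h j z) *\<^sub>R g z)"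
      by (subst weak[OF tf, symmetric]) (simp only: fd)
    also have "\<dots> = (LINT z|lborel. (\<psi> j z * ?du z) *\<^sub>R g z) + (LINT z|lborel. h j z *\<^sub>R g z)"
      unfolding scaleR_add_left by (rule Bochner_Integration.integral_add[OF i])
    finally show ?thesis by simp
  qed
  have \<psi>01: "0 \<le> \<psi> j z" "\<psi> j z \<le> 1" for j z using S T by (auto simp: \<psi>_def intro!: mult_le_one)
  have \<psi>m[measurable]: "\<psi> j \<in> borel_measurable borel" for j
    unfolding \<psi>_def by (intro borel_measurable_continuous_onI continuous_intros c1 ca)
  have \<psi>lim: "(\<lambda>j. \<psi> j z *\<^sub>R F z) \<longlonglongrightarrow> F z" if "\<And>z. z \<notin> box 0 q \<Longrightarrow> F z = 0" for z and F :: "complex \<Rightarrow> complex"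
  proof (cases "z \<in> box 0 q")
    case True
    then have "(\<lambda>j. S j (Re z)) \<longlonglongrightarrow> 1" "(\<lambda>j. T j (Im z)) \<longlonglongrightarrow> 1" by (auto simp: mem_box_0_complex intro: S T)
    from tendsto_scaleR[OF tendsto_mult[OF this] tendsto_const[of "F z"]] show ?thesis by (simp add: \<psi>_def)
  qed (use that in simp)
  have lim: "(\<lambda>j. LINT z|lborel. \<psi> j z *\<^sub>R F z) \<longlonglongrightarrow> (LINT z|lborel. F z)"
    if F: "integrable lborel F" "\<And>z. z \<notin> box 0 q \<Longrightarrow> F z = 0" for F :: "complex \<Rightarrow> complex"
  proof (rule integral_dominated_convergence[where w="\<lambda>z. norm (F z)"])
    have [measurable]: "F \<in> borel_measurable borel" using F(1) by auto
    show "F \<in> borel_measurable lborel" "(\<lambda>z. \<psi> j z *\<^sub>R F z) \<in> borel_measurable lborel" for j by auto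
    show "AE z in lborel. norm (\<psi> j z *\<^sub>R F z) \<le> norm (F z)" for j
      using \<psi>01 by (intro AE_I2) (auto intro!: mult_left_le_one_le simp: abs_of_nonneg)
    show "AE z in lborel. (\<lambda>j. \<psi> j z *\<^sub>R F z) \<longlonglongrightarrow> F z" by (intro AE_I2 \<psi>lim F(2))
  qed (use F in auto)
  have cdu: "continuous_on UNIV ?du" "continuous_on UNIV ?u"
    by (intro continuous_intros c1 ca a b)+
  have "bounded (?u ` cbox 0 q)" 
    by (intro compact_imp_bounded compact_continuous_image continuous_on_subset[OF cdu(2)]) auto
  then obtain B where B: "\<And>z. z \<in> cbox 0 q \<Longrightarrow> \<bar>?u z\<bar> \<le> B" by (auto simp: bounded_iff)
  have iG: "integrable lborel (\<lambda>z. ?u z *\<^sub>R G z)"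
  proof (rule Bochner_Integration.integrable_bound)
    show "integrable lborel (\<lambda>z. B *\<^sub>R G z)" using G(1) by auto
    have [measurable]: "G \<in> borel_measurable borel" using G(1) by auto
    have [measurable]: "?u \<in> borel_measurable borel" using cdu(2) by (rule borel_measurable_continuous_onI)
    show "(\<lambda>z. ?u z *\<^sub>R G z) \<in> borel_measurable lborel" by simp
    show "AE z in lborel. norm (?u z *\<^sub>R G z) \<le> norm (B *\<^sub>R G z)"
    proof (intro AE_I2)
      fix z :: complex
      show "norm (?u z *\<^sub>R G z) \<le> norm (B *\<^sub>R G z)"
      proof (cases "z \<in> box 0 q")
        case True
        then have "z \<in> cbox 0 q" using box_subset_cbox by auto
        from B[OF this] show ?thesis by (simp only: norm_scaleR) (intro mult_right_mono, auto)
      qed (use G in auto)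
    qed
  qed
  have R: "(\<lambda>j. - (LINT z|lborel. \<psi> j z *\<^sub>R (?u z *\<^sub>R G z))) \<longlonglongrightarrow> - (LINT z|lborel. ?u z *\<^sub>R G z)"
    by (intro tendsto_minus lim iG) (use G in auto)
  have "integrable lborel (\<lambda>z. ?du z *\<^sub>R g z)"
    using g(2) box_subset_cbox[of 0 q] by (intro integrable_continuous_vanishing[where S="cbox 0 q"] continuous_intros cdu g(1)) auto
  from lim[OF this] have L: "(\<lambda>j. LINT z|lborel. (\<psi> j z * ?du z) *\<^sub>R g z) \<longlonglongrightarrow> (LINT z|lborel. ?du z *\<^sub>R g z)"
    using g(2) by simp
  have H: "(\<lambda>j. LINT z|lborel. h j z *\<^sub>R g z) \<longlonglongrightarrow> 0"
  proof (rule boundary_strip_integral_tendsto_0[where g=g and q=q and h=h and C="\<bar>Re v\<bar> * B * CS + \<bar>Im v\<bar> * B * CT"])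
    show "h j \<in> borel_measurable borel" for j unfolding h_def
      by (intro borel_measurable_continuous_onI continuous_intros c1 ca S T)
    have "0 \<le> CS" "0 \<le> CT" using S(8)[of 0 0] T(8)[of 0 0] by auto
    fix j z assume "z \<in> box 0 q"
    then have "z \<in> cbox 0 q" using box_subset_cbox by auto
    from B[OF this] have B': "\<bar>?u z\<bar> \<le> B" .
    have "\<bar>h j z\<bar> \<le> \<bar>Re v * (?u z * (D j (Re z) * T j (Im z)))\<bar> + \<bar>Im v * (?u z * (S j (Re z) * E j (Im z)))\<bar>"
      unfolding h_def by (rule order_trans[OF abs_triangle_ineq]) (simp add: mult_ac)
    also have "\<dots> \<le> \<bar>Re v\<bar> * (B * ((CS * Suc j) * 1)) + \<bar>Im v\<bar> * (B * (1 * (CT * Suc j)))"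
      unfolding abs_mult[of "Re v"] abs_mult[of "Im v"] abs_mult[of "?u z"] abs_mult[of "D j (Re z)"] abs_mult[of "S j (Re z)"]
      using B' S(4,5)[of j "Re z"] T(4,5)[of j "Im z"] S(8)[of j "Re z"] T(8)[of j "Im z"] \<open>0 \<le> CS\<close> \<open>0 \<le> CT\<close>
      by (intro add_mono mult_left_mono mult_mono) (auto intro: order_trans[OF abs_ge_zero B'])
    finally show "\<bar>h j z\<bar> \<le> (\<bar>Re v\<bar> * B * CS + \<bar>Im v\<bar> * B * CT) * Suc j" by (simp add: algebra_simps)
  next
    fix j z assume "2 / Suc j \<le> Re z" "Re z \<le> Re q - 2 / Suc j" "2 / Suc j \<le> Im z" "Im z \<le> Im q - 2 / Suc j"
    then show "h j z = 0" using S(9) T(9) by (simp add: h_def)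
  qed (use q g in auto)
  from tendsto_add[OF L H] R show ?thesis
    unfolding eq by (simp add: LIMSEQ_unique)
qed


section \<open>Approximation by continuously differentiable functions\<close>

lemma mollifier_kernels:
  obtains \<beta> \<beta>' :: "nat \<Rightarrow> real \<Rightarrow> real" where
    "\<And>j m. smooth1 m (\<beta> j)" "\<And>j x. (\<beta> j has_real_derivative \<beta>' j x) (at x)"
    "\<And>j. continuous_on UNIV (\<beta>' j)" "\<And>j x. 0 \<le> \<beta> j x"
    "\<And>j x. x \<notin> {0..1 / Suc j} \<Longrightarrow> \<beta> j x = 0"
    "\<And>j. (\<integral>\<^sup>+x. ennreal (\<beta> j x) \<partial>lborel) = 1"
proof -
  obtain b s :: "real \<Rightarrow> real" where
    b: "\<And>m. smooth1 m b" and sd: "\<And>x. (s has_real_derivative b x) (at x)"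
    and bnn: "\<And>x. 0 \<le> b x" and b0: "\<And>x. x \<le> 0 \<Longrightarrow> b x = 0" "\<And>x. 1 \<le> x \<Longrightarrow> b x = 0"
    and s0: "\<And>x. x \<le> 0 \<Longrightarrow> s x = 0" and s1: "\<And>x. 1 \<le> x \<Longrightarrow> s x = 1" 
    by (rule smooth_bump_and_step) blast
  define \<beta> where "\<beta> = (\<lambda>j x. real (Suc j) * b (real (Suc j) * x + 0))"
  have \<beta>sm: "smooth1 m (\<beta> j)" for m j unfolding \<beta>_def by (intro smooth1_mult smooth1_const smooth1_affine b)
  have "\<forall>j. \<exists>c. (\<forall>x. (\<beta> j has_real_derivative c x) (at x)) \<and> smooth1 0 c"
    using \<beta>sm[of "Suc 0"] unfolding smooth1.simps(2) by blast
  then obtain \<beta>' where \<beta>': "\<And>j x. (\<beta> j has_real_derivative \<beta>' j x) (at x)" "\<And>j. continuous_on UNIV (\<beta>' j)"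
    by (metis smooth1.simps(1))
  show ?thesis
  proof (rule that[OF \<beta>sm \<beta>'])
    fix j :: nat and x :: real
    let ?N = "real (Suc j)"
    have N: "?N > 0" by simp
    show "0 \<le> \<beta> j x" using bnn by (simp add: \<beta>_def)
    show 0: "\<beta> j x = 0" if "x \<notin> {0..1 / ?N}" for x
    proof -
      have "?N * x \<le> 0 \<or> 1 \<le> ?N * x" using that N by (auto simp: field_simps mult_le_0_iff simp del: of_nat_Suc)
      then show ?thesis using b0 by (auto simp: \<beta>_def simp del: of_nat_Suc)
    qed
    have "((\<lambda>x. s (?N * x)) has_real_derivative \<beta> j x) (at x)" for x
    proof -
      have "((\<lambda>x. ?N * x) has_real_derivative ?N) (at x)" by (auto intro!: derivative_eq_intros)
      from DERIV_chain2[OF sd this] show ?thesis by (simp add: \<beta>_def mult.commute)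
    qed
    then have "(\<integral>\<^sup>+x. ennreal (\<beta> j x) * indicator {0..1 / ?N} x \<partial>lborel) = ennreal (s (?N * (1 / ?N)) - s (?N * 0))"
      using bnn smooth1_continuous[OF \<beta>sm[of 0 j]]
      by (intro nn_integral_FTC_Icc) (auto simp: \<beta>_def intro: borel_measurable_continuous_onI has_field_derivative_at_within)
    also have "(\<integral>\<^sup>+x. ennreal (\<beta> j x) * indicator {0..1 / ?N} x \<partial>lborel) = (\<integral>\<^sup>+x. ennreal (\<beta> j x) \<partial>lborel)"
      using 0 by (intro nn_integral_cong) (auto split: split_indicator)
    finally show "(\<integral>\<^sup>+x. ennreal (\<beta> j x) \<partial>lborel) = 1" using s0 s1 by simp
  qed
qed

lemma mollification_has_derivative:
  fixes g :: "complex \<Rightarrow> complex" and \<beta> \<beta>' :: "real \<Rightarrow> real"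
  assumes g: "continuous_on UNIV g" "\<And>z. z \<notin> cbox p q \<Longrightarrow> g z = 0"
    and \<beta>: "\<And>x. (\<beta> has_real_derivative \<beta>' x) (at x)" "continuous_on UNIV \<beta>'"
  defines "P \<equiv> \<lambda>z. LINT w|lborel. (\<beta>' (Re (z - w)) * \<beta> (Im (z - w))) *\<^sub>R g w"
    and "R \<equiv> \<lambda>z. LINT w|lborel. (\<beta> (Re (z - w)) * \<beta>' (Im (z - w))) *\<^sub>R g w"
  shows "((\<lambda>z. LINT w|lborel. (\<beta> (Re (z - w)) * \<beta> (Im (z - w))) *\<^sub>R g w) has_derivative
     (\<lambda>h. Re h *\<^sub>R P z + Im h *\<^sub>R R z)) (at z)"
    and "continuous_on UNIV P" and "continuous_on UNIV R"
proof -
  have \<beta>c: "continuous_on UNIV \<beta>" using \<beta>(1) DERIV_isCont by (auto simp: continuous_on_eq_continuous_at)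
  have c1: "continuous_on A (\<lambda>x. f (h x))" if "continuous_on UNIV f" "continuous_on A h"
    for f :: "real \<Rightarrow> real" and A and h :: "'x::topological_space \<Rightarrow> real"
    using that by (auto intro!: continuous_on_compose2[of UNIV f])
  note cs = c1[OF \<beta>c] c1[OF \<beta>(2)]
  have cg: "continuous_on A (\<lambda>x. g (h x))" if "continuous_on A h" for A and h :: "'x::topological_space \<Rightarrow> complex"
    using that g(1) by (auto intro!: continuous_on_compose2[of UNIV g])
  have conv: "(LINT w|lborel. k w *\<^sub>R g w) = integral (cbox p q) (\<lambda>w. k w *\<^sub>R g w)"
    if "continuous_on UNIV k" for k :: "complex \<Rightarrow> real"
  proof -
    have "integrable lborel (\<lambda>w. k w *\<^sub>R g w)"
      using g(2) by (intro integrable_continuous_vanishing[where S="cbox p q"] continuous_intros that g(1)) auto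
    then have "(LINT w|lborel. k w *\<^sub>R g w) = integral UNIV (\<lambda>w. k w *\<^sub>R g w)" by (rule integral_lborel[symmetric])
    also have "\<dots> = integral UNIV (\<lambda>w. if w \<in> cbox p q then k w *\<^sub>R g w else 0)"
      using g(2) by (intro arg_cong[where f="integral UNIV"]) auto
    also have "\<dots> = integral (cbox p q) (\<lambda>w. k w *\<^sub>R g w)" by (rule integral_restrict_UNIV)
    finally show ?thesis .
  qed
  have P: "P = (\<lambda>z. integral (cbox p q) (\<lambda>w. (\<beta>' (Re (z - w)) * \<beta> (Im (z - w))) *\<^sub>R g w))"
    unfolding P_def by (intro ext conv continuous_intros cs)
  have R: "R = (\<lambda>z. integral (cbox p q) (\<lambda>w. (\<beta> (Re (z - w)) * \<beta>' (Im (z - w))) *\<^sub>R g w))"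
    unfolding R_def by (intro ext conv continuous_intros cs)
  show "continuous_on UNIV P" "continuous_on UNIV R"
    unfolding P R by (intro integral_continuous_on_param; unfold case_prod_unfold; intro continuous_intros cs cg)+
  define D :: "complex \<Rightarrow> complex \<Rightarrow> complex \<Rightarrow>\<^sub>L complex" where "D = (\<lambda>z w. blinfun_scaleR_left (g w) o\<^sub>L
     ((\<beta>' (Re (z - w)) * \<beta> (Im (z - w))) *\<^sub>R Blinfun Re + (\<beta> (Re (z - w)) * \<beta>' (Im (z - w))) *\<^sub>R Blinfun Im))"
  have Dapp: "blinfun_apply (D z w) h = Re h *\<^sub>R ((\<beta>' (Re (z - w)) * \<beta> (Im (z - w))) *\<^sub>R g w) + Im h *\<^sub>R ((\<beta> (Re (z - w)) * \<beta>' (Im (z - w))) *\<^sub>R g w)"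
    for z w h
    by (simp add: D_def plus_blinfun.rep_eq scaleR_blinfun.rep_eq bounded_linear_Blinfun_apply bounded_linear_Re bounded_linear_Im
        scaleR_add_left mult.commute del: scaleR_conv_of_real)
  have Dc: "continuous_on A (\<lambda>x. D (u x) (v x))" if "continuous_on A u" "continuous_on A v" for A and u v :: "'x::topological_space \<Rightarrow> complex"
    unfolding D_def by (intro continuous_intros cs that bounded_linear.continuous_on[OF bounded_linear_blinfun_scaleR_left] cg)
  have "((\<lambda>z. integral (cbox p q) (\<lambda>w. (\<beta> (Re (z - w)) * \<beta> (Im (z - w))) *\<^sub>R g w)) has_derivative
      blinfun_apply (integral (cbox p q) (D z))) (at z within UNIV)"
  proof (rule leibniz_rule)
    show "((\<lambda>z. (\<beta> (Re (z - w)) * \<beta> (Im (z - w))) *\<^sub>R g w) has_derivative blinfun_apply (D z w)) (at z within UNIV)" for z w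
    proof -
      have "((\<lambda>z. \<beta> (Re z) * \<beta> (Im z)) has_derivative 
        (\<lambda>v. Re v * (\<beta>' (Re (z - w)) * \<beta> (Im (z - w))) + Im v * (\<beta> (Re (z - w)) * \<beta>' (Im (z - w))))) (at (z - w))"
        by (intro separated_has_derivative \<beta>)
      note D1 = this
      have "((\<lambda>z. z - w) has_derivative (\<lambda>h. h)) (at z)" by (auto intro!: derivative_eq_intros)
      from has_derivative_compose[OF this D1] have "((\<lambda>z. \<beta> (Re (z - w)) * \<beta> (Im (z - w))) has_derivative 
        (\<lambda>v. Re v * (\<beta>' (Re (z - w)) * \<beta> (Im (z - w))) + Im v * (\<beta> (Re (z - w)) * \<beta>' (Im (z - w))))) (at z)"
        by (simp only:)
      then have "((\<lambda>z. (\<beta> (Re (z - w)) * \<beta> (Im (z - w))) *\<^sub>R g w) has_derivative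
        (\<lambda>v. (Re v * (\<beta>' (Re (z - w)) * \<beta> (Im (z - w))) + Im v * (\<beta> (Re (z - w)) * \<beta>' (Im (z - w)))) *\<^sub>R g w)) (at z)"
        by (rule has_derivative_scaleR_left)
      then show ?thesis by (rule has_derivative_eq_rhs) (simp add: Dapp fun_eq_iff scaleR_add_left)
    qed
    show "(\<lambda>w. (\<beta> (Re (z - w)) * \<beta> (Im (z - w))) *\<^sub>R g w) integrable_on cbox p q" for z
      by (intro integrable_continuous continuous_intros cs cg)
    show "continuous_on (UNIV \<times> cbox p q) (\<lambda>(x, t). D x t)"
      unfolding case_prod_unfold by (intro Dc continuous_intros)
  qed auto
  moreover have "blinfun_apply (integral (cbox p q) (D z)) = (\<lambda>h. Re h *\<^sub>R P z + Im h *\<^sub>R R z)"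
  proof
    fix h
    have "blinfun_apply (integral (cbox p q) (D z)) h = integral (cbox p q) (\<lambda>w. blinfun_apply (D z w) h)"
      by (intro blinfun_apply_integral integrable_continuous Dc continuous_intros)
    also have "\<dots> = Re h *\<^sub>R P z + Im h *\<^sub>R R z"
      unfolding Dapp P R
      by (subst Henstock_Kurzweil_Integration.integral_add; (intro integrable_continuous continuous_intros cs cg)?)
        (simp only: integral_cmul)
    finally show "blinfun_apply (integral (cbox p q) (D z)) h = Re h *\<^sub>R P z + Im h *\<^sub>R R z" .
  qed
  moreover have "(\<lambda>z. LINT w|lborel. (\<beta> (Re (z - w)) * \<beta> (Im (z - w))) *\<^sub>R g w) =
      (\<lambda>z. integral (cbox p q) (\<lambda>w. (\<beta> (Re (z - w)) * \<beta> (Im (z - w))) *\<^sub>R g w))"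
    by (intro ext conv continuous_intros cs)
  ultimately show "((\<lambda>z. LINT w|lborel. (\<beta> (Re (z - w)) * \<beta> (Im (z - w))) *\<^sub>R g w) has_derivative
     (\<lambda>h. Re h *\<^sub>R P z + Im h *\<^sub>R R z)) (at z)"
    by (simp only:)
qed


text \<open>A continuous function on the plane that vanishes off the open rectangle with corners \<open>0\<close> and
\<open>q\<close>, together with Borel representatives of its weak partial derivatives in the directions \<open>1\<close>
and \<open>\<i>\<close>: a member of \<open>W\<^sub>0\<^sup>1\<^sup>,\<^sup>1\<close>, extended by zero.\<close>

definition W10_on_box :: "complex \<Rightarrow> (complex \<Rightarrow> complex) \<Rightarrow> (complex \<Rightarrow> complex) \<Rightarrow> (complex \<Rightarrow> complex) \<Rightarrow> bool" where
  "W10_on_box q g G1 G2 \<longleftrightarrow> 0 < Re q \<and> 0 < Im q \<and>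
     continuous_on UNIV g \<and> (\<forall>z. z \<notin> box 0 q \<longrightarrow> g z = 0) \<and>
     integrable lborel G1 \<and> (\<forall>z. z \<notin> box 0 q \<longrightarrow> G1 z = 0) \<and>
     integrable lborel G2 \<and> (\<forall>z. z \<notin> box 0 q \<longrightarrow> G2 z = 0) \<and>
     (\<forall>u. test_function (box 0 q) u \<longrightarrow>
        (LINT z|lborel. frechet_derivative u (at z) 1 *\<^sub>R g z) = - (LINT z|lborel. u z *\<^sub>R G1 z)) \<and>
     (\<forall>u. test_function (box 0 q) u \<longrightarrow>
        (LINT z|lborel. frechet_derivative u (at z) \<i> *\<^sub>R g z) = - (LINT z|lborel. u z *\<^sub>R G2 z))"

text \<open>Mollification commutes with weak differentiation, since a shifted kernel is an admissible test
function once the support condition has been removed. The kernels live on the positive quadrant,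
which is why the supports grow only towards the upper right.\<close>

theorem C1_approximation_of_W10:
  fixes g G1 G2 :: "complex \<Rightarrow> complex"
  assumes W: "W10_on_box q g G1 G2"
  obtains h P1 P2 :: "nat \<Rightarrow> complex \<Rightarrow> complex" where
    "\<And>j z. (h j has_derivative (\<lambda>v. Re v *\<^sub>R P1 j z + Im v *\<^sub>R P2 j z)) (at z)"
    "\<And>j. continuous_on UNIV (P1 j)" "\<And>j. continuous_on UNIV (P2 j)"
    "\<And>j z. z \<notin> cbox 0 (q + 1 + \<i>) \<Longrightarrow> h j z = 0"
    "\<And>z. (\<lambda>j. h j z) \<longlonglongrightarrow> g z"
    "\<And>M j z. (\<And>w. norm (g w) \<le> M) \<Longrightarrow> norm (h j z) \<le> M"
    "(\<lambda>j. \<integral>\<^sup>+z. norm (P1 j z - G1 z) \<partial>lborel) \<longlonglongrightarrow> 0"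
    "(\<lambda>j. \<integral>\<^sup>+z. norm (P2 j z - G2 z) \<partial>lborel) \<longlonglongrightarrow> 0"
proof -
  have q: "0 < Re q" "0 < Im q"
    and g: "continuous_on UNIV g" "\<And>z. z \<notin> box 0 q \<Longrightarrow> g z = 0"
    and G1: "integrable lborel G1" "\<And>z. z \<notin> box 0 q \<Longrightarrow> G1 z = 0"
    and G2: "integrable lborel G2" "\<And>z. z \<notin> box 0 q \<Longrightarrow> G2 z = 0"
    and weak1: "\<And>u. test_function (box 0 q) u \<Longrightarrow>
        (LINT z|lborel. frechet_derivative u (at z) 1 *\<^sub>R g z) = - (LINT z|lborel. u z *\<^sub>R G1 z)"
    and weak2: "\<And>u. test_function (box 0 q) u \<Longrightarrow>
        (LINT z|lborel. frechet_derivative u (at z) \<i> *\<^sub>R g z) = - (LINT z|lborel. u z *\<^sub>R G2 z)"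
    using W by (auto simp: W10_on_box_def)
  obtain \<beta> \<beta>' :: "nat \<Rightarrow> real \<Rightarrow> real" where
    \<beta>: "\<And>j m. smooth1 m (\<beta> j)" "\<And>j x. (\<beta> j has_real_derivative \<beta>' j x) (at x)"
    "\<And>j. continuous_on UNIV (\<beta>' j)" "\<And>j x. 0 \<le> \<beta> j x"
    and \<beta>0: "\<And>j x. x \<notin> {0..1 / Suc j} \<Longrightarrow> \<beta> j x = 0"
    and \<beta>1: "\<And>j. (\<integral>\<^sup>+x. ennreal (\<beta> j x) \<partial>lborel) = 1"
    by (rule mollifier_kernels) blast
  define \<kappa> where "\<kappa> = (\<lambda>j w. \<beta> j (Re w) * \<beta> j (Im w))"
  define h where "h = (\<lambda>j z. LINT w|lborel. \<kappa> j (z - w) *\<^sub>R g w)"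
  define P1 where "P1 = (\<lambda>j z. LINT w|lborel. (\<beta>' j (Re (z - w)) * \<beta> j (Im (z - w))) *\<^sub>R g w)"
  define P2 where "P2 = (\<lambda>j z. LINT w|lborel. (\<beta> j (Re (z - w)) * \<beta>' j (Im (z - w))) *\<^sub>R g w)"
  have g0: "g z = 0" if "z \<notin> cbox 0 q" for z
    using that g(2)[of z] box_subset_cbox[of 0 q] by auto
  have der: "(h j has_derivative (\<lambda>v. Re v *\<^sub>R P1 j z + Im v *\<^sub>R P2 j z)) (at z)"
    and Pc: "continuous_on UNIV (P1 j)" "continuous_on UNIV (P2 j)" for j z
    using mollification_has_derivative[OF g(1) g0 \<beta>(2,3)] unfolding h_def P1_def P2_def \<kappa>_def by auto
  have \<beta>c: "continuous_on UNIV (\<beta> j)" for j using smooth1_continuous[OF \<beta>(1)[of 0]] .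
  have \<kappa>c: "continuous_on UNIV (\<kappa> j)" for j
    unfolding \<kappa>_def by (intro continuous_intros continuous_on_compose2[OF \<beta>c]) auto
  have \<kappa>m[measurable]: "\<kappa> j \<in> borel_measurable borel" for j
    using \<kappa>c by (rule borel_measurable_continuous_onI)
  have \<kappa>nn: "0 \<le> \<kappa> j w" for j w using \<beta>(4) by (simp add: \<kappa>_def)
  have \<kappa>box: "\<kappa> j w = 0" if "w \<notin> cbox 0 (Complex (1 / Suc j) (1 / Suc j))" for j w
    using that \<beta>0[of "Re w" j] \<beta>0[of "Im w" j] by (auto simp: \<kappa>_def in_cbox_complex_iff)
  have \<kappa>supp: "\<kappa> j w = 0" if "d \<le> norm w" "2 / Suc j < d" for j w d
  proof (rule \<kappa>box, rule notI)
    assume "w \<in> cbox 0 (Complex (1 / real (Suc j)) (1 / real (Suc j)))"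
    then have "\<bar>Re w\<bar> \<le> 1 / real (Suc j)" "\<bar>Im w\<bar> \<le> 1 / real (Suc j)" by (auto simp: in_cbox_complex_iff)
    then have "norm w \<le> 2 / real (Suc j)" using cmod_le[of w] by simp
    with that show False by simp
  qed
  have \<kappa>bdd: "\<exists>B. \<forall>w. \<kappa> j w \<le> B" for j
  proof -
    have "bounded (\<kappa> j ` cbox 0 (Complex (1 / Suc j) (1 / Suc j)))"
      by (intro compact_imp_bounded compact_continuous_image continuous_on_subset[OF \<kappa>c]) auto
    then obtain B where B: "0 < B" "\<And>w. w \<in> cbox 0 (Complex (1 / Suc j) (1 / Suc j)) \<Longrightarrow> \<bar>\<kappa> j w\<bar> \<le> B"
      by (auto simp: bounded_pos)
    have "\<kappa> j w \<le> B" for w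
      using B \<kappa>box[of w j] by (cases "w \<in> cbox 0 (Complex (1 / Suc j) (1 / Suc j))") fastforce+
    then show ?thesis by blast
  qed
  have \<kappa>1: "(\<integral>\<^sup>+w. ennreal (\<kappa> j w) \<partial>lborel) = 1" for j
  proof -
    have [measurable]: "\<beta> j \<in> borel_measurable borel" using \<beta>c by (rule borel_measurable_continuous_onI)
    have "(\<integral>\<^sup>+w. ennreal (\<kappa> j w) \<partial>lborel) = (\<integral>\<^sup>+y. \<integral>\<^sup>+x. ennreal (\<beta> j x) * ennreal (\<beta> j y) \<partial>lborel \<partial>lborel)"
      by (subst nn_integral_complex(1)) (auto simp: \<kappa>_def ennreal_mult \<beta>(4))
    also have "\<dots> = 1" by (simp add: nn_integral_multc \<beta>1)
    finally show ?thesis .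
  qed
  have \<kappa>int: "integrable lborel (\<kappa> j)" "(LINT w|lborel. \<kappa> j w) = 1" for j
  proof -
    show "integrable lborel (\<kappa> j)" using \<kappa>nn \<kappa>1 by (intro integrableI_nonneg) auto
    show "(LINT w|lborel. \<kappa> j w) = 1" using \<kappa>nn \<kappa>1 by (subst integral_eq_nn_integral) auto
  qed
  have P: "P1 j z = (LINT w|lborel. \<kappa> j (z - w) *\<^sub>R G1 w)" "P2 j z = (LINT w|lborel. \<kappa> j (z - w) *\<^sub>R G2 w)" for j z
  proof -
    let ?a = "\<lambda>x. \<beta> j (-1 * x + Re z)" and ?b = "\<lambda>y. \<beta> j (-1 * y + Im z)"
    let ?a' = "\<lambda>x. - \<beta>' j (-1 * x + Re z)" and ?b' = "\<lambda>y. - \<beta>' j (-1 * y + Im z)"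
    have d: "((\<lambda>x. \<beta> j (-1 * x + c)) has_real_derivative - \<beta>' j (-1 * x + c)) (at x)" for c x
    proof -
      have "((\<lambda>x. -1 * x + c) has_real_derivative -1) (at x)" by (auto intro!: derivative_eq_intros)
      from DERIV_chain2[OF \<beta>(2) this] show ?thesis by simp
    qed
    have c: "continuous_on UNIV (\<lambda>x. - \<beta>' j (-1 * x + c))" for c
      by (intro continuous_intros continuous_on_compose2[OF \<beta>(3)]) auto
    show "P1 j z = (LINT w|lborel. \<kappa> j (z - w) *\<^sub>R G1 w)"
    proof -
      have "(LINT w|lborel. (Re 1 * (?a' (Re w) * ?b (Im w)) + Im 1 * (?a (Re w) * ?b' (Im w))) *\<^sub>R g w)
         = - (LINT w|lborel. (?a (Re w) * ?b (Im w)) *\<^sub>R G1 w)"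
        by (rule weak_partial_extends_by_0[where g=g and G=G1 and v=1])
          ((rule q g(1) G1(1) smooth1_affine \<beta>(1) d c) | (erule g(2) G1(2) weak1))+
      then show ?thesis by (simp add: P1_def \<kappa>_def)
    qed
    show "P2 j z = (LINT w|lborel. \<kappa> j (z - w) *\<^sub>R G2 w)"
    proof -
      have "(LINT w|lborel. (Re \<i> * (?a' (Re w) * ?b (Im w)) + Im \<i> * (?a (Re w) * ?b' (Im w))) *\<^sub>R g w)
         = - (LINT w|lborel. (?a (Re w) * ?b (Im w)) *\<^sub>R G2 w)"
        by (rule weak_partial_extends_by_0[where g=g and G=G2 and v=\<i>])
          ((rule q g(1) G2(1) smooth1_affine \<beta>(1) d c) | (erule g(2) G2(2) weak2))+
      then show ?thesis by (simp add: P2_def \<kappa>_def)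
    qed
  qed
  have L1: "(\<lambda>j. \<integral>\<^sup>+z. norm ((LINT w|lborel. \<kappa> j (z - w) *\<^sub>R G w) - G z) \<partial>lborel) \<longlonglongrightarrow> 0"
    if G: "integrable lborel G" for G :: "complex \<Rightarrow> complex"
  proof (rule tendsto_zero_ennreal)
    fix e :: real assume "0 < e"
    then have e2: "0 < e / 2" by simp
    obtain d where d: "0 < d" "\<And>w. norm w < d \<Longrightarrow> (\<integral>\<^sup>+z. norm (G (z + w) - G z) \<partial>lborel) \<le> ennreal (e / 2)"
      using L1_translation_uniform[OF G e2] by blast
    have "\<forall>\<^sub>F j in sequentially. 2 / real (Suc j) < d" using d(1) by (rule eventually_2_over_Suc_less)
    then show "\<forall>\<^sub>F j in sequentially. (\<integral>\<^sup>+z. norm ((LINT w|lborel. \<kappa> j (z - w) *\<^sub>R G w) - G z) \<partial>lborel) < ennreal e"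
    proof eventually_elim
      case (elim j)
      obtain B where B: "\<And>w. \<kappa> j w \<le> B" using \<kappa>bdd[of j] by auto
      have "(\<integral>\<^sup>+z. norm ((LINT w|lborel. \<kappa> j (z - w) *\<^sub>R G w) - G z) \<partial>lborel) \<le> ennreal (e / 2)"
        by (rule L1_mollify[OF G \<kappa>c \<kappa>nn B \<kappa>1 \<kappa>supp d(2)]) (use elim in auto)
      also have "\<dots> < ennreal e" using \<open>0 < e\<close> by (simp add: ennreal_lessI)
      finally show ?case .
    qed
  qed
  have h0: "h j z = 0" if z: "z \<notin> cbox 0 (q + 1 + \<i>)" for j z
  proof -
    have "\<kappa> j (z - w) *\<^sub>R g w = 0" for w
    proof (cases "w \<in> cbox 0 q")
      case True
      obtain r where r: "r = 1 / real (Suc j)" "r \<le> 1" by simp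
      then have "z - w \<notin> cbox 0 (Complex (1 / real (Suc j)) (1 / real (Suc j)))"
        using z True unfolding in_cbox_complex_iff r(1)[symmetric] by auto
      from \<kappa>box[OF this] show ?thesis by simp
    qed (simp add: g0)
    then show ?thesis by (simp only: h_def Bochner_Integration.integral_zero)
  qed
  have k: "integrable lborel (\<lambda>w. \<kappa> j (z - w))" "(LINT w|lborel. \<kappa> j (z - w)) = 1" for j z
  proof -
    show "integrable lborel (\<lambda>w. \<kappa> j (z - w))"
      using \<kappa>int(1)[of j] by (subst (asm) lborel_reflect_shift[of z]) (simp add: integrable_distr_eq)
    show "(LINT w|lborel. \<kappa> j (z - w)) = 1"
      using \<kappa>int(2)[of j] by (subst (asm) lborel_reflect_shift[of z]) (simp add: integral_distr)
  qed
  have i: "integrable lborel (\<lambda>w. \<kappa> j (z - w) *\<^sub>R g w)" for j z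
    using g0 by (intro integrable_continuous_vanishing[where S="cbox 0 q"] continuous_intros
      continuous_on_compose2[OF \<kappa>c] g(1)) auto
  have sup: "norm (h j z) \<le> M" if M: "\<And>w. norm (g w) \<le> M" for M j z
  proof -
    have "norm (h j z) \<le> (LINT w|lborel. \<kappa> j (z - w) * M)"
      unfolding h_def
      by (rule Bochner_Integration.integral_norm_bound_integral[OF i])
        (use k \<kappa>nn M in \<open>auto intro: mult_left_mono\<close>)
    then show ?thesis using k by simp
  qed
  have hlim: "(\<lambda>j. h j z) \<longlonglongrightarrow> g z" for z
  proof (rule LIMSEQ_I)
    fix e :: real assume e: "0 < e"
    have "isCont g z" using g(1) by (simp add: continuous_on_eq_continuous_at)
    then obtain d where d: "0 < d" "\<And>w. dist w z < d \<Longrightarrow> dist (g w) (g z) < e / 2"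
      using e unfolding continuous_at_eps_delta by (metis half_gt_zero)
    obtain J where J: "\<And>j. j \<ge> J \<Longrightarrow> 2 / real (Suc j) < d"
      using eventually_2_over_Suc_less[OF d(1)] by (auto simp: eventually_sequentially)
    show "\<exists>J. \<forall>j\<ge>J. norm (h j z - g z) < e"
    proof (intro exI[of _ J] allI impI)
      fix j assume "j \<ge> J"
      have "h j z - g z = (LINT w|lborel. \<kappa> j (z - w) *\<^sub>R g w) - (LINT w|lborel. \<kappa> j (z - w) *\<^sub>R g z)"
        using k by (simp add: h_def)
      also have "\<dots> = (LINT w|lborel. \<kappa> j (z - w) *\<^sub>R (g w - g z))"
        using i k by (subst Bochner_Integration.integral_diff[symmetric]) (auto simp: scaleR_diff_right)
      finally have eq: "h j z - g z = (LINT w|lborel. \<kappa> j (z - w) *\<^sub>R (g w - g z))" .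
      have "norm (h j z - g z) \<le> (LINT w|lborel. \<kappa> j (z - w) * (e / 2))"
        unfolding eq
      proof (rule Bochner_Integration.integral_norm_bound_integral)
        show "integrable lborel (\<lambda>w. \<kappa> j (z - w) *\<^sub>R (g w - g z))" using i k by (auto simp: scaleR_diff_right)
        show "integrable lborel (\<lambda>w. \<kappa> j (z - w) * (e / 2))" using k by auto
        fix w
        show "norm (\<kappa> j (z - w) *\<^sub>R (g w - g z)) \<le> \<kappa> j (z - w) * (e / 2)"
        proof (cases "dist w z < d")
          case True
          then have "norm (g w - g z) \<le> e / 2" using d(2)[of w] by (simp add: dist_norm)
          from mult_left_mono[OF this \<kappa>nn] show ?thesis by (simp only: norm_scaleR abs_of_nonneg[OF \<kappa>nn])
        next
          case False
          then show ?thesis using \<kappa>supp[of d "z - w" j] J[OF \<open>j \<ge> J\<close>] by (auto simp: dist_norm norm_minus_commute)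
        qed
      qed
      also have "\<dots> = e / 2" using k by simp
      finally show "norm (h j z - g z) < e" using e by simp
    qed
  qed
  show ?thesis
    by (rule that[OF der Pc h0 hlim sup]) (use L1[OF G1(1)] L1[OF G2(1)] P in simp_all)
qed

section \<open>Differentiability within large sets\<close>

lemma norm_increment_le_nn_integral:
  fixes H p :: "real \<Rightarrow> 'b::euclidean_space"
  assumes d: "\<And>x. (H has_vector_derivative p x) (at x)" and c: "continuous_on UNIV p"
  shows "ennreal (norm (H (x + t) - H x)) \<le> (\<integral>\<^sup>+s. ennreal (norm (p s)) * indicator (cball x \<bar>t\<bar>) s \<partial>lborel)"
proof -
  have [measurable]: "p \<in> borel_measurable borel" using c by (rule borel_measurable_continuous_onI)
  have *: "ennreal (norm (H b - H a)) \<le> (\<integral>\<^sup>+s. ennreal (norm (p s)) * indicator (cball x \<bar>t\<bar>) s \<partial>lborel)"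
    if ab: "a \<le> b" "{a..b} \<subseteq> cball x \<bar>t\<bar>" for a b
  proof -
    have i: "integrable lborel (\<lambda>x. indicator {a..b} x *\<^sub>R p x)"
      using c by (intro borel_integrable_compact) (auto intro: continuous_on_subset)
    have "H b - H a = (LINT x|lborel. indicator {a..b} x *\<^sub>R p x)"
      by (rule integral_FTC_atLeastAtMost[OF ab(1) has_vector_derivative_at_within[OF d] continuous_on_subset[OF c], symmetric]) simp
    then have "ennreal (norm (H b - H a)) \<le> (\<integral>\<^sup>+s. ennreal (norm (indicator {a..b} s *\<^sub>R p s)) \<partial>lborel)"
      using integral_norm_bound_ennreal[OF i] by simp
    also have "\<dots> \<le> (\<integral>\<^sup>+s. ennreal (norm (p s)) * indicator (cball x \<bar>t\<bar>) s \<partial>lborel)"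
      using ab(2) by (intro nn_integral_mono) (auto split: split_indicator)
    finally show ?thesis .
  qed
  show ?thesis
  proof (cases "0 \<le> t")
    case True
    then show ?thesis by (intro *) (auto simp: dist_real_def)
  next
    case False
    then have "ennreal (norm (H x - H (x + t))) \<le> (\<integral>\<^sup>+s. ennreal (norm (p s)) * indicator (cball x \<bar>t\<bar>) s \<partial>lborel)"
      by (intro *) (auto simp: dist_real_def)
    then show ?thesis by (simp add: norm_minus_commute)
  qed
qed

text \<open>The superlevel set of the maximal difference quotient along the line in direction \<open>v\<close>. Being
defined by increments of \<open>H\<close> rather than by integrals of a derivative, it is evidently open.\<close>

definition steep :: "'a::real_normed_vector \<Rightarrow> real \<Rightarrow> ('a \<Rightarrow> 'b::real_normed_vector) \<Rightarrow> 'a set" where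
  "steep v c H = {z. \<exists>t. c * \<bar>t\<bar> < norm (H (z + t *\<^sub>R v) - H z)}"

lemma open_steep:
  assumes "continuous_on UNIV H" shows "open (steep v c H)"
proof -
  have "open {z. c * \<bar>t\<bar> < norm (H (z + t *\<^sub>R v) - H z)}" for t
    by (intro open_Collect_less continuous_intros continuous_on_compose2[OF assms]) auto
  moreover have "steep v c H = (\<Union>t. {z. c * \<bar>t\<bar> < norm (H (z + t *\<^sub>R v) - H z)})"
    by (auto simp: steep_def)
  ultimately show ?thesis by auto
qed

text \<open>Around every point of the set there is an interval over which the integral of \<open>norm p\<close> exceeds
\<open>c\<close> times the radius. The Vitali covering lemma selects disjoint intervals whose fivefold
enlargements cover the set; an interval of radius \<open>5 r\<close> has length \<open>10 r\<close>, hence the constant.\<close>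

lemma emeasure_steep_real:
  fixes H p :: "real \<Rightarrow> 'b::euclidean_space"
  assumes d: "\<And>x. (H has_vector_derivative p x) (at x)" and pc: "continuous_on UNIV p" and c: "0 < c"
  shows "emeasure lborel (steep 1 c H) \<le> ennreal (10 / c) * (\<integral>\<^sup>+x. norm (p x) \<partial>lborel)"
proof (cases "(\<integral>\<^sup>+x. norm (p x) \<partial>lborel) = \<infinity>")
  case True
  then show ?thesis using c by (simp add: ennreal_mult_top)
next
  case False
  let ?U = "steep 1 c H" and ?f = "\<lambda>x. ennreal (norm (p x))"
  have [measurable]: "p \<in> borel_measurable borel" using pc by (rule borel_measurable_continuous_onI)
  have Hc: "continuous_on UNIV H"
    using d by (auto intro!: continuous_at_imp_continuous_on has_vector_derivative_continuous)
  have [measurable]: "?U \<in> sets borel" using open_steep[OF Hc] by auto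
  obtain I where I: "(\<integral>\<^sup>+x. ?f x \<partial>lborel) = ennreal I" "0 \<le> I"
    using False by (cases "\<integral>\<^sup>+x. ?f x \<partial>lborel") auto
  have "\<forall>x\<in>?U. \<exists>r>0. ennreal (c * r) \<le> (\<integral>\<^sup>+s. ?f s * indicator (cball x r) s \<partial>lborel)"
  proof
    fix x assume "x \<in> ?U"
    then obtain t where t: "c * \<bar>t\<bar> < norm (H (x + t) - H x)" by (auto simp: steep_def)
    then have "t \<noteq> 0" by auto
    moreover have "ennreal (c * \<bar>t\<bar>) \<le> (\<integral>\<^sup>+s. ?f s * indicator (cball x \<bar>t\<bar>) s \<partial>lborel)"
      using t by (intro order_trans[OF ennreal_leI norm_increment_le_nn_integral[OF d pc]]) simp
    ultimately show "\<exists>r>0. ennreal (c * r) \<le> (\<integral>\<^sup>+s. ?f s * indicator (cball x r) s \<partial>lborel)"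
      by (intro exI[of _ "\<bar>t\<bar>"]) auto
  qed
  then obtain r where r: "\<And>x. x \<in> ?U \<Longrightarrow> 0 < r x"
    "\<And>x. x \<in> ?U \<Longrightarrow> ennreal (c * r x) \<le> (\<integral>\<^sup>+s. ?f s * indicator (cball x (r x)) s \<partial>lborel)" by metis
  have rI: "r x \<le> I / c" if "x \<in> ?U" for x
  proof -
    have "ennreal (c * r x) \<le> (\<integral>\<^sup>+s. ?f s \<partial>lborel)"
      by (rule order_trans[OF r(2)[OF that]]) (auto intro!: nn_integral_mono split: split_indicator)
    then show ?thesis using I c by (simp add: field_simps)
  qed
  obtain C where C: "countable C" "C \<subseteq> ?U"
    "pairwise (\<lambda>i j. disjnt (cball i (r i)) (cball j (r j))) C" "?U \<subseteq> (\<Union>i\<in>C. cball i (5 * r i))"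
  proof (rule Vitali_covering_lemma_cballs[where S="?U" and K="?U" and a="\<lambda>x. x" and r=r and B="I / c"])
    show "?U \<subseteq> (\<Union>i\<in>?U. cball i (r i))" using r(1) by (force intro: less_imp_le)
    show "0 < r i \<and> r i \<le> I / c" if "i \<in> ?U" for i using r(1) rI that by auto
  qed auto
  define f where "f = to_nat_on C"
  have f: "inj_on f C" using C(1) by (simp add: f_def inj_on_to_nat_on)
  define B where "B = (\<lambda>k. \<Union>x\<in>{x\<in>C. f x = k}. cball x (5 * r x))"
  define D where "D = (\<lambda>k. \<Union>x\<in>{x\<in>C. f x = k}. cball x (r x))"
  define \<nu> where "\<nu> = density lborel ?f"
  have single: "{x\<in>C. f x = k} = {} \<or> (\<exists>x\<in>C. {x\<in>C. f x = k} = {x})" for k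
  proof (cases "\<exists>x\<in>C. f x = k")
    case True
    then obtain x where "x \<in> C" "f x = k" by blast
    then have "{x\<in>C. f x = k} = {x}" using f by (auto simp: inj_on_def)
    with \<open>x \<in> C\<close> show ?thesis by blast
  qed auto
  have [measurable]: "B k \<in> sets borel" "D k \<in> sets borel" for k
    using single[of k] unfolding B_def D_def
    by (elim disjE bexE; simp only: UN_insert UN_empty Un_empty_right sets.empty_sets borel_closed[OF closed_cball])+
  have le: "emeasure lborel (B k) \<le> ennreal (10 / c) * emeasure \<nu> (D k)" for k
    using single[of k]
  proof (elim disjE bexE)
    fix x assume x: "x \<in> C" and eq: "{x\<in>C. f x = k} = {x}"
    have "x \<in> ?U" using x C(2) by auto
    have "B k = {x - 5 * r x..x + 5 * r x}" unfolding B_def eq by (auto simp: dist_real_def)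
    then have "emeasure lborel (B k) = ennreal (10 * r x)" using r(1)[OF \<open>x \<in> ?U\<close>] by simp
    also have "\<dots> = ennreal (10 / c) * ennreal (c * r x)" using c r(1)[OF \<open>x \<in> ?U\<close>]
      by (simp flip: ennreal_mult')
    also have "\<dots> \<le> ennreal (10 / c) * emeasure \<nu> (D k)"
      using r(2)[OF \<open>x \<in> ?U\<close>] unfolding D_def eq by (intro mult_left_mono) (auto simp: \<nu>_def emeasure_density)
    finally show ?thesis .
  qed (simp only: B_def UN_empty emeasure_empty zero_le)
  have "disjoint_family D"
  proof -
    have "D i \<inter> D j = {}" if "i \<noteq> j" for i j
    proof -
      have "cball x (r x) \<inter> cball y (r y) = {}" if "x \<in> C" "y \<in> C" "x \<noteq> y" for x y
        using C(3) that unfolding pairwise_def disjnt_def by blast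
      then show ?thesis using \<open>i \<noteq> j\<close> unfolding D_def by fastforce
    qed
    then show ?thesis by (auto simp: disjoint_family_on_def)
  qed
  have "emeasure lborel ?U \<le> emeasure lborel (\<Union>k. B k)"
  proof (rule emeasure_mono)
    have "(\<Union>k. B k) = (\<Union>i\<in>C. cball i (5 * r i))" by (auto simp: B_def)
    with C(4) show "?U \<subseteq> (\<Union>k. B k)" by (simp only:)
  qed measurable
  also have "\<dots> \<le> (\<Sum>k. emeasure lborel (B k))" by (intro emeasure_subadditive_countably) auto
  also have "\<dots> \<le> (\<Sum>k. ennreal (10 / c) * emeasure \<nu> (D k))" by (intro suminf_le le) auto
  also have "\<dots> = ennreal (10 / c) * (\<Sum>k. emeasure \<nu> (D k))" by simp
  also have "(\<Sum>k. emeasure \<nu> (D k)) = emeasure \<nu> (\<Union>k. D k)"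
    using \<open>disjoint_family D\<close> by (intro suminf_emeasure) (auto simp: \<nu>_def)
  also have "emeasure \<nu> (\<Union>k. D k) \<le> emeasure \<nu> (space \<nu>)" by (rule emeasure_space)
  also have "emeasure \<nu> (space \<nu>) = (\<integral>\<^sup>+x. ?f x \<partial>lborel)" by (simp add: \<nu>_def emeasure_density)
  finally show ?thesis by (simp add: mult_left_mono)
qed

text \<open>The one-dimensional estimate on each line of the given direction, integrated over all lines.\<close>

lemma emeasure_steep_complex:
  fixes H P1 P2 :: "complex \<Rightarrow> complex"
  assumes d: "\<And>z. (H has_derivative (\<lambda>v. Re v *\<^sub>R P1 z + Im v *\<^sub>R P2 z)) (at z)"
    and P: "continuous_on UNIV P1" "continuous_on UNIV P2" and c: "0 < c"
  shows "emeasure lborel (steep 1 c H) \<le> ennreal (10 / c) * (\<integral>\<^sup>+z. norm (P1 z) \<partial>lborel)"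
    and "emeasure lborel (steep \<i> c H) \<le> ennreal (10 / c) * (\<integral>\<^sup>+z. norm (P2 z) \<partial>lborel)"
proof -
  have [measurable]: "P1 \<in> borel_measurable borel" "P2 \<in> borel_measurable borel"
    using P by (auto intro: borel_measurable_continuous_onI)
  have Hc: "continuous_on UNIV H"
    using d by (auto intro!: continuous_at_imp_continuous_on has_derivative_continuous)
  have [measurable]: "steep v c H \<in> sets borel" for v using open_steep[OF Hc] by auto
  have dx: "((\<lambda>x. H (Complex x y)) has_vector_derivative P1 (Complex x y)) (at x)" for x y
  proof -
    have "((\<lambda>x. Complex x y) has_derivative (\<lambda>t. of_real t)) (at x)"
      unfolding Complex_eq by (auto intro!: derivative_eq_intros)
    from has_derivative_compose[OF this d] show ?thesis by (simp add: has_vector_derivative_def)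
  qed
  have dy: "((\<lambda>y. H (Complex x y)) has_vector_derivative P2 (Complex x y)) (at y)" for x y
  proof -
    have "((\<lambda>y. Complex x y) has_derivative (\<lambda>t. \<i> * of_real t)) (at y)"
      unfolding Complex_eq by (auto intro!: derivative_eq_intros)
    from has_derivative_compose[OF this d] show ?thesis by (simp add: has_vector_derivative_def)
  qed
  have cx: "continuous_on UNIV (\<lambda>x. P1 (Complex x y))" "continuous_on UNIV (\<lambda>y. P2 (Complex x y))" for x y
    unfolding Complex_eq by (intro continuous_on_compose2[OF P(1)] continuous_on_compose2[OF P(2)] continuous_intros; simp)+
  have sx: "Complex x y \<in> steep 1 c H \<longleftrightarrow> x \<in> steep 1 c (\<lambda>x. H (Complex x y))"
    and sy: "Complex x y \<in> steep \<i> c H \<longleftrightarrow> y \<in> steep 1 c (\<lambda>y. H (Complex x y))" for x y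
    by (auto simp: steep_def Complex_eq algebra_simps scaleR_conv_of_real)
  have m: "steep 1 c (\<lambda>x. H (Complex x y)) \<in> sets borel" "steep 1 c (\<lambda>y. H (Complex x y)) \<in> sets borel" for x y
    using dx dy by (auto intro!: borel_open open_steep continuous_at_imp_continuous_on has_vector_derivative_continuous)
  have "emeasure lborel (steep 1 c H) = (\<integral>\<^sup>+z. indicator (steep 1 c H) z \<partial>lborel)" by simp
  also have "\<dots> = (\<integral>\<^sup>+y. \<integral>\<^sup>+x. indicator (steep 1 c H) (Complex x y) \<partial>lborel \<partial>lborel)"
    by (rule nn_integral_complex(1)) auto
  also have "\<dots> = (\<integral>\<^sup>+y. emeasure lborel (steep 1 c (\<lambda>x. H (Complex x y))) \<partial>lborel)"
  proof (intro nn_integral_cong)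
    fix y
    have "(\<integral>\<^sup>+x. indicator (steep 1 c H) (Complex x y) \<partial>lborel) = (\<integral>\<^sup>+x. indicator (steep 1 c (\<lambda>x. H (Complex x y))) x \<partial>lborel)"
      by (intro nn_integral_cong) (simp add: indicator_def sx)
    then show "(\<integral>\<^sup>+x. indicator (steep 1 c H) (Complex x y) \<partial>lborel) = emeasure lborel (steep 1 c (\<lambda>x. H (Complex x y)))"
      using m by simp
  qed
  also have "\<dots> \<le> (\<integral>\<^sup>+y. ennreal (10 / c) * (\<integral>\<^sup>+x. norm (P1 (Complex x y)) \<partial>lborel) \<partial>lborel)"
    by (intro nn_integral_mono emeasure_steep_real dx cx c)
  also have "\<dots> = (\<integral>\<^sup>+y. \<integral>\<^sup>+x. ennreal (10 / c) * norm (P1 (Complex x y)) \<partial>lborel \<partial>lborel)"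
    using cx(1) by (intro nn_integral_cong nn_integral_cmult[symmetric]) (auto intro!: borel_measurable_continuous_onI continuous_intros)
  also have "\<dots> = (\<integral>\<^sup>+z. ennreal (10 / c) * norm (P1 z) \<partial>lborel)"
    by (rule nn_integral_complex(1)[symmetric]) auto
  finally show "emeasure lborel (steep 1 c H) \<le> ennreal (10 / c) * (\<integral>\<^sup>+z. norm (P1 z) \<partial>lborel)"
    by (simp add: nn_integral_cmult)
  have "emeasure lborel (steep \<i> c H) = (\<integral>\<^sup>+z. indicator (steep \<i> c H) z \<partial>lborel)" by simp
  also have "\<dots> = (\<integral>\<^sup>+x. \<integral>\<^sup>+y. indicator (steep \<i> c H) (Complex x y) \<partial>lborel \<partial>lborel)"
    by (rule nn_integral_complex(2)) auto
  also have "\<dots> = (\<integral>\<^sup>+x. emeasure lborel (steep 1 c (\<lambda>y. H (Complex x y))) \<partial>lborel)"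
  proof (intro nn_integral_cong)
    fix x
    have "(\<integral>\<^sup>+y. indicator (steep \<i> c H) (Complex x y) \<partial>lborel) = (\<integral>\<^sup>+y. indicator (steep 1 c (\<lambda>y. H (Complex x y))) y \<partial>lborel)"
      by (intro nn_integral_cong) (simp add: indicator_def sy)
    then show "(\<integral>\<^sup>+y. indicator (steep \<i> c H) (Complex x y) \<partial>lborel) = emeasure lborel (steep 1 c (\<lambda>y. H (Complex x y)))"
      using m by simp
  qed
  also have "\<dots> \<le> (\<integral>\<^sup>+x. ennreal (10 / c) * (\<integral>\<^sup>+y. norm (P2 (Complex x y)) \<partial>lborel) \<partial>lborel)"
    by (intro nn_integral_mono emeasure_steep_real dy cx c)
  also have "\<dots> = (\<integral>\<^sup>+x. \<integral>\<^sup>+y. ennreal (10 / c) * norm (P2 (Complex x y)) \<partial>lborel \<partial>lborel)"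
    using cx(2) by (intro nn_integral_cong nn_integral_cmult[symmetric]) (auto intro!: borel_measurable_continuous_onI continuous_intros)
  also have "\<dots> = (\<integral>\<^sup>+z. ennreal (10 / c) * norm (P2 z) \<partial>lborel)"
    by (rule nn_integral_complex(2)[symmetric]) auto
  finally show "emeasure lborel (steep \<i> c H) \<le> ennreal (10 / c) * (\<integral>\<^sup>+z. norm (P2 z) \<partial>lborel)"
    by (simp add: nn_integral_cmult)
qed


text \<open>The approximations are thinned out so that their derivatives converge at rate \<open>4\<^sup>-\<^sup>j\<close>. The set
where a difference quotient of consecutive differences exceeds \<open>2\<^sup>-\<^sup>j\<close> then has measure of order
\<open>2\<^sup>-\<^sup>j\<close>, and by the Borel-Cantelli lemma almost every point lies in only finitely many of them. Off
these sets the difference of \<open>g\<close> and an approximation has small slope, so differentiability is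
inherited from the approximations.\<close>

theorem exhaustion_by_sets_of_differentiability:
  fixes g G1 G2 :: "complex \<Rightarrow> complex" and h P1 P2 :: "nat \<Rightarrow> complex \<Rightarrow> complex"
  assumes d: "\<And>j z. (h j has_derivative (\<lambda>v. Re v *\<^sub>R P1 j z + Im v *\<^sub>R P2 j z)) (at z)"
    and P: "\<And>j. continuous_on UNIV (P1 j)" "\<And>j. continuous_on UNIV (P2 j)"
    and lim: "\<And>z. (\<lambda>j. h j z) \<longlonglongrightarrow> g z"
    and [measurable]: "G1 \<in> borel_measurable borel" "G2 \<in> borel_measurable borel"
    and L1: "(\<lambda>j. \<integral>\<^sup>+z. norm (P1 j z - G1 z) \<partial>lborel) \<longlonglongrightarrow> 0"
    and L2: "(\<lambda>j. \<integral>\<^sup>+z. norm (P2 j z - G2 z) \<partial>lborel) \<longlonglongrightarrow> 0"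
  obtains E :: "nat \<Rightarrow> complex set" where "\<And>m. E m \<in> sets borel" "incseq E" "AE z in lborel. z \<in> (\<Union>m. E m)"
    "\<And>m z. z \<in> E m \<Longrightarrow> (g has_derivative (\<lambda>v. Re v *\<^sub>R G1 z + Im v *\<^sub>R G2 z)) (at z within E m)"
proof -
  have [measurable]: "P1 j \<in> borel_measurable borel" "P2 j \<in> borel_measurable borel" for j
    using P by (auto intro: borel_measurable_continuous_onI)
  have hc: "continuous_on UNIV (h j)" for j
    using d by (auto intro!: continuous_at_imp_continuous_on has_derivative_continuous)
  \<comment> \<open>\<open>n \<ge> j\<close> keeps pointwise convergence along the chosen indices\<close>
  have "\<exists>n\<ge>j. (\<integral>\<^sup>+z. norm (P1 n z - G1 z) \<partial>lborel) < ennreal ((1/4) ^ j) \<and> (\<integral>\<^sup>+z. norm (P2 n z - G2 z) \<partial>lborel) < ennreal ((1/4) ^ j)" for j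
  proof -
    have "0 < ennreal ((1/4) ^ j)" by simp
    then have "\<forall>\<^sub>F n in sequentially. (\<integral>\<^sup>+z. norm (P1 n z - G1 z) \<partial>lborel) < ennreal ((1/4) ^ j)"
      "\<forall>\<^sub>F n in sequentially. (\<integral>\<^sup>+z. norm (P2 n z - G2 z) \<partial>lborel) < ennreal ((1/4) ^ j)"
      using order_tendstoD(2)[OF L1] order_tendstoD(2)[OF L2] by blast+
    then have "\<forall>\<^sub>F n in sequentially. j \<le> n \<and> (\<integral>\<^sup>+z. norm (P1 n z - G1 z) \<partial>lborel) < ennreal ((1/4) ^ j) \<and> (\<integral>\<^sup>+z. norm (P2 n z - G2 z) \<partial>lborel) < ennreal ((1/4) ^ j)"
      using eventually_ge_at_top[of j] by eventually_elim auto
    then show ?thesis by (auto simp: eventually_sequentially)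
  qed
  then obtain s where s: "\<And>j. s j \<ge> j"
    "\<And>j. (\<integral>\<^sup>+z. norm (P1 (s j) z - G1 z) \<partial>lborel) < ennreal ((1/4) ^ j)"
    "\<And>j. (\<integral>\<^sup>+z. norm (P2 (s j) z - G2 z) \<partial>lborel) < ennreal ((1/4) ^ j)" by metis
  have s_lim: "filterlim s sequentially sequentially"
    by (rule filterlim_at_top_mono[OF filterlim_ident]) (use s(1) in simp)
  define K where "K = (\<lambda>j. h (s j))"
  define H where "H = (\<lambda>j z. K j z - K (Suc j) z)"
  have Klim: "(\<lambda>j. K j z) \<longlonglongrightarrow> g z" for z
    unfolding K_def by (rule filterlim_compose[OF lim s_lim])
  have Hd: "(H j has_derivative (\<lambda>v. Re v *\<^sub>R (P1 (s j) z - P1 (s (Suc j)) z) + Im v *\<^sub>R (P2 (s j) z - P2 (s (Suc j)) z))) (at z)" for j z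
    unfolding H_def K_def by (rule has_derivative_eq_rhs[OF has_derivative_diff[OF d d]]) (simp add: algebra_simps)
  \<comment> \<open>the weak type estimate divides the rate \<open>4\<^sup>-\<^sup>j\<close> by the threshold \<open>2\<^sup>-\<^sup>j\<close>\<close>
  define U where "U = (\<lambda>j. steep 1 ((1/2)^j) (H j) \<union> steep \<i> ((1/2)^j) (H j))"
  have Hc: "continuous_on UNIV (H j)" for j
    unfolding H_def K_def by (intro continuous_intros hc)
  have stm[measurable]: "steep v c (H j) \<in> sets borel" for v c j using open_steep[OF Hc] by auto
  have Um[measurable]: "U j \<in> sets borel" for j unfolding U_def by auto
  have Cauchy: "(\<integral>\<^sup>+z. norm (Q (s j) z - Q (s (Suc j)) z) \<partial>lborel) \<le> ennreal (2 * (1/4)^j)"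
    if Q[measurable]: "\<And>j. Q j \<in> borel_measurable borel" "G \<in> borel_measurable borel" and q: "\<And>j. (\<integral>\<^sup>+z. norm (Q (s j) z - G z) \<partial>lborel) < ennreal ((1/4) ^ j)"
    for Q :: "nat \<Rightarrow> complex \<Rightarrow> complex" and G j
  proof -
    have "norm (Q (s j) z - Q (s (Suc j)) z) \<le> norm (Q (s j) z - G z) + norm (Q (s (Suc j)) z - G z)" for z
      by (metis dist_norm dist_triangle2)
    then have "(\<integral>\<^sup>+z. norm (Q (s j) z - Q (s (Suc j)) z) \<partial>lborel) \<le>
      (\<integral>\<^sup>+z. ennreal (norm (Q (s j) z - G z)) + ennreal (norm (Q (s (Suc j)) z - G z)) \<partial>lborel)"
      by (intro nn_integral_mono) (simp add: ennreal_leI flip: ennreal_plus)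
    also have "\<dots> = (\<integral>\<^sup>+z. norm (Q (s j) z - G z) \<partial>lborel) + (\<integral>\<^sup>+z. norm (Q (s (Suc j)) z - G z) \<partial>lborel)"
      by (rule nn_integral_add) auto
    also have "\<dots> \<le> ennreal ((1/4)^j) + ennreal ((1/4)^(Suc j))"
      using q[of j] q[of "Suc j"] by (intro add_mono) auto
    also have "\<dots> = ennreal ((1/4)^j + (1/4)^(Suc j))" by (simp flip: ennreal_plus)
    also have "\<dots> \<le> ennreal (2 * (1/4)^j)" by (intro ennreal_leI) simp
    finally show ?thesis .
  qed
  have Ule: "emeasure lborel (U j) \<le> ennreal (40 * (1/2)^j)" for j
  proof -
    have 20: "ennreal (10 / (1/2)^j) * ennreal (2 * (1/4)^j) = ennreal (20 * (1/2)^j)"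
      by (simp add: power_divide field_simps flip: ennreal_mult' power_mult_distrib)
    have "emeasure lborel (U j) \<le> emeasure lborel (steep 1 ((1/2)^j) (H j)) + emeasure lborel (steep \<i> ((1/2)^j) (H j))"
      unfolding U_def by (intro emeasure_subadditive) auto
    also have "\<dots> \<le> ennreal (10 / (1/2)^j) * (\<integral>\<^sup>+z. norm (P1 (s j) z - P1 (s (Suc j)) z) \<partial>lborel)
        + ennreal (10 / (1/2)^j) * (\<integral>\<^sup>+z. norm (P2 (s j) z - P2 (s (Suc j)) z) \<partial>lborel)"
      by (intro add_mono emeasure_steep_complex[OF Hd] continuous_intros P) auto
    also have "\<dots> \<le> ennreal (10 / (1/2)^j) * ennreal (2 * (1/4)^j) + ennreal (10 / (1/2)^j) * ennreal (2 * (1/4)^j)"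
      by (intro add_mono mult_left_mono Cauchy[where G=G1] Cauchy[where G=G2] s) auto
    also have "\<dots> = ennreal (40 * (1/2)^j)" unfolding 20 by (simp flip: ennreal_plus)
    finally show ?thesis .
  qed
  have AEU: "AE z in lborel. \<forall>\<^sub>F j in sequentially. z \<notin> U j"
  proof -
    have "AE z in lborel. \<forall>\<^sub>F j in sequentially. z \<in> space lborel - U j"
    proof (rule borel_cantelli_AE1)
      show "emeasure lborel (U j) < \<infinity>" for j using Ule[of j] by (simp add: order_le_less_trans)
      show "summable (\<lambda>j. measure lborel (U j))"
      proof (rule summable_comparison_test)
        show "\<exists>N. \<forall>n\<ge>N. norm (measure lborel (U n)) \<le> 40 * (1/2)^n"
          using Ule by (auto simp: measure_def intro!: enn2real_leI)
        show "summable (\<lambda>n. 40 * (1/2::real)^n)" by (intro summable_mult summable_geometric) auto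
      qed
    qed auto
    then show ?thesis by simp
  qed
  have AElim: "AE z in lborel. (\<lambda>j. Q (s j) z) \<longlonglongrightarrow> G z"
    if Q[measurable]: "\<And>j. Q j \<in> borel_measurable borel" "G \<in> borel_measurable borel" and q: "\<And>j. (\<integral>\<^sup>+z. norm (Q (s j) z - G z) \<partial>lborel) < ennreal ((1/4) ^ j)"
    for Q :: "nat \<Rightarrow> complex \<Rightarrow> complex" and G
  proof -
    have "(\<integral>\<^sup>+z. (\<Sum>j. ennreal (norm (Q (s j) z - G z))) \<partial>lborel) = (\<Sum>j. \<integral>\<^sup>+z. norm (Q (s j) z - G z) \<partial>lborel)"
      by (rule nn_integral_suminf) auto
    also have "\<dots> \<le> (\<Sum>j. ennreal ((1/4)^j))" using q by (intro suminf_le) (auto intro: less_imp_le)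
    also have "\<dots> < \<infinity>" by (subst suminf_ennreal2) (auto intro!: summable_geometric)
    finally have "AE z in lborel. (\<Sum>j. ennreal (norm (Q (s j) z - G z))) \<noteq> \<infinity>"
      by (intro nn_integral_PInf_AE) auto
    then show ?thesis
    proof eventually_elim
      case (elim z)
      then have "summable (\<lambda>j. norm (Q (s j) z - G z))"
        by (intro summable_suminf_not_top) auto
      then have "(\<lambda>j. norm (Q (s j) z - G z)) \<longlonglongrightarrow> 0" by (rule summable_LIMSEQ_zero)
      then have "(\<lambda>j. Q (s j) z - G z) \<longlonglongrightarrow> 0" by (rule tendsto_norm_zero_cancel)
      then show ?case by (rule LIM_zero_cancel)
    qed
  qed
  define N where "N = {z. (\<lambda>j. P1 (s j) z) \<longlonglongrightarrow> G1 z \<and> (\<lambda>j. P2 (s j) z) \<longlonglongrightarrow> G2 z}"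
  define E where "E = (\<lambda>m. N - (\<Union>j\<in>{m..}. U j))"
  show ?thesis
  proof (rule that[of E])
    have "N = {z\<in>space borel. (\<lambda>j. norm (P1 (s j) z - G1 z)) \<longlonglongrightarrow> 0} \<inter> {z\<in>space borel. (\<lambda>j. norm (P2 (s j) z - G2 z)) \<longlonglongrightarrow> 0}"
      unfolding N_def by (auto simp: tendsto_norm_zero_iff intro: LIM_zero LIM_zero_cancel)
    moreover have "\<dots> \<in> sets borel" by measurable
    ultimately have [measurable]: "N \<in> sets borel" by simp
    show "E m \<in> sets borel" for m unfolding E_def by auto
    show "incseq E" unfolding E_def by (auto simp: incseq_def)
    show "AE z in lborel. z \<in> (\<Union>m. E m)"
    proof -
      have "AE z in lborel. (\<lambda>j. P1 (s j) z) \<longlonglongrightarrow> G1 z" "AE z in lborel. (\<lambda>j. P2 (s j) z) \<longlonglongrightarrow> G2 z"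
        by (rule AElim; fact | simp)+
      with AEU show ?thesis
      proof eventually_elim
        case (elim z)
        then obtain m where "\<forall>j\<ge>m. z \<notin> U j" by (auto simp: eventually_sequentially)
        with elim have "z \<in> E m" by (auto simp: E_def N_def)
        then show ?case by blast
      qed
    qed
  next
    fix m z assume z: "z \<in> E m"
    have zU: "w \<notin> U j" if "j \<ge> m" "w \<in> E m" for j w using that by (auto simp: E_def)
    have step: "norm (H j (w + t *\<^sub>R v) - H j w) \<le> (1/2)^j * \<bar>t\<bar>"
      if "j \<ge> m" "w \<in> E m" "v = 1 \<or> v = \<i>" for j w t v
      using zU[OF that(1,2)] that(3) by (auto simp: U_def steep_def not_less)
    \<comment> \<open>the bound is a partial geometric sum, which makes the induction close\<close>
    have tele: "norm ((K j (w + t *\<^sub>R v) - K (j + i) (w + t *\<^sub>R v)) - (K j w - K (j + i) w)) \<le> 2 * (1/2)^j * (1 - (1/2)^i) * \<bar>t\<bar>"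
      if "j \<ge> m" "w \<in> E m" "v = 1 \<or> v = \<i>" for i j w t v
    proof (induction i)
      case (Suc i)
      have "(K j (w + t *\<^sub>R v) - K (j + Suc i) (w + t *\<^sub>R v)) - (K j w - K (j + Suc i) w) =
        ((K j (w + t *\<^sub>R v) - K (j + i) (w + t *\<^sub>R v)) - (K j w - K (j + i) w)) + (H (j + i) (w + t *\<^sub>R v) - H (j + i) w)"
        by (simp add: H_def)
      also have "norm \<dots> \<le> 2 * (1/2)^j * (1 - (1/2)^i) * \<bar>t\<bar> + (1/2)^(j+i) * \<bar>t\<bar>"
        using Suc step[of "j + i" w v t] that by (intro order_trans[OF norm_triangle_ineq] add_mono) auto
      also have "\<dots> = 2 * (1/2)^j * (1 - (1/2)^Suc i) * \<bar>t\<bar>" by (simp add: power_add algebra_simps)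
      finally show ?case .
    qed simp
    have lip: "norm ((K j (w + t *\<^sub>R v) - g (w + t *\<^sub>R v)) - (K j w - g w)) \<le> 2 * (1/2)^j * \<bar>t\<bar>"
      if "j \<ge> m" "w \<in> E m" "v = 1 \<or> v = \<i>" for j w t v
    proof (rule LIMSEQ_le_const2)
      show "(\<lambda>i. norm ((K j (w + t *\<^sub>R v) - K (i + j) (w + t *\<^sub>R v)) - (K j w - K (i + j) w)))
        \<longlonglongrightarrow> norm ((K j (w + t *\<^sub>R v) - g (w + t *\<^sub>R v)) - (K j w - g w))"
        by (intro tendsto_intros LIMSEQ_ignore_initial_segment Klim)
      have "norm ((K j (w + t *\<^sub>R v) - K (j + i) (w + t *\<^sub>R v)) - (K j w - K (j + i) w)) \<le> 2 * (1/2)^j * \<bar>t\<bar>" for i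
        by (rule order_trans[OF tele[OF that]]) (intro mult_right_mono, auto)
      then show "\<exists>N. \<forall>i\<ge>N. norm ((K j (w + t *\<^sub>R v) - K (i + j) (w + t *\<^sub>R v)) - (K j w - K (i + j) w)) \<le> 2 * (1/2)^j * \<bar>t\<bar>"
        by (simp add: add.commute)
    qed
    have corner: "norm ((K j w - g w) - (K j z - g z)) \<le> 4 * (1/2)^j * norm (w - z)" if "j \<ge> m" "w \<in> E m" for j w
    proof -
      \<comment> \<open>the corner is reached horizontally from \<open>z\<close> and vertically from \<open>w\<close>, the two points at which increments are controlled\<close>
      define c where "c = Complex (Re w) (Im z)"
      have c1: "c = z + (Re w - Re z) *\<^sub>R 1" and c2: "c = w + (Im z - Im w) *\<^sub>R \<i>"
        by (auto simp: c_def complex_eq_iff)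
      have "norm ((K j c - g c) - (K j z - g z)) \<le> 2 * (1/2)^j * \<bar>Re w - Re z\<bar>"
        using lip[OF that(1) z, of 1 "Re w - Re z"] unfolding c1[symmetric] by simp
      also have "\<dots> \<le> 2 * (1/2)^j * norm (w - z)"
        using abs_Re_le_cmod[of "w - z"] by (intro mult_left_mono) auto
      finally have 1: "norm ((K j c - g c) - (K j z - g z)) \<le> 2 * (1/2)^j * norm (w - z)" .
      have "norm ((K j c - g c) - (K j w - g w)) \<le> 2 * (1/2)^j * \<bar>Im z - Im w\<bar>"
        using lip[OF that(1,2), of \<i> "Im z - Im w"] unfolding c2[symmetric] by simp
      also have "\<dots> \<le> 2 * (1/2)^j * norm (w - z)"
        using abs_Im_le_cmod[of "w - z"] by (intro mult_left_mono) auto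
      finally have 2: "norm ((K j c - g c) - (K j w - g w)) \<le> 2 * (1/2)^j * norm (w - z)" .
      have "norm ((K j w - g w) - (K j z - g z)) \<le> norm ((K j c - g c) - (K j z - g z)) + norm ((K j c - g c) - (K j w - g w))"
        by (metis dist_norm dist_triangle3 add.commute dist_commute)
      with 1 2 show ?thesis by simp
    qed
    show "(g has_derivative (\<lambda>v. Re v *\<^sub>R G1 z + Im v *\<^sub>R G2 z)) (at z within E m)"
      unfolding has_derivative_within_alt
    proof (intro conjI allI impI)
      show "bounded_linear (\<lambda>v. Re v *\<^sub>R G1 z + Im v *\<^sub>R G2 z)"
        by (intro bounded_linear_add bounded_linear_scaleR_left[THEN bounded_linear_compose] bounded_linear_Re bounded_linear_Im)
      fix e :: real assume e: "0 < e"
      have "(\<lambda>j. norm (P1 (s j) z - G1 z)) \<longlonglongrightarrow> 0" "(\<lambda>j. norm (P2 (s j) z - G2 z)) \<longlonglongrightarrow> 0" "(\<lambda>j. (1/2::real)^j) \<longlonglongrightarrow> 0"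
        using z by (auto simp: E_def N_def intro!: tendsto_norm_zero LIM_zero LIMSEQ_power_zero)
      then have "\<forall>\<^sub>F j in sequentially. norm (P1 (s j) z - G1 z) < e / 8" "\<forall>\<^sub>F j in sequentially. norm (P2 (s j) z - G2 z) < e / 8"
         "\<forall>\<^sub>F j in sequentially. (1/2::real)^j < e / 16"
        using e by (auto intro!: order_tendstoD(2) simp del: less_divide_eq_numeral1 divide_less_eq_numeral1)
      then have "\<forall>\<^sub>F j in sequentially. m \<le> j \<and> norm (P1 (s j) z - G1 z) < e / 8 \<and> norm (P2 (s j) z - G2 z) < e / 8 \<and> (1/2::real)^j < e / 16"
        using eventually_ge_at_top[of m] by eventually_elim auto
      then obtain j where j: "m \<le> j" "norm (P1 (s j) z - G1 z) < e / 8" "norm (P2 (s j) z - G2 z) < e / 8" "(1/2::real)^j < e / 16"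
        by (auto simp: eventually_sequentially)
      have "0 < e / 4" using e by simp
      with d[of "s j" z] obtain r where r: "0 < r" "\<And>w. norm (w - z) < r \<Longrightarrow>
         norm (K j w - K j z - (Re (w - z) *\<^sub>R P1 (s j) z + Im (w - z) *\<^sub>R P2 (s j) z)) \<le> e / 4 * norm (w - z)"
        unfolding has_derivative_at_alt K_def by metis
      show "\<exists>r>0. \<forall>w\<in>E m. norm (w - z) < r \<longrightarrow> norm (g w - g z - (Re (w - z) *\<^sub>R G1 z + Im (w - z) *\<^sub>R G2 z)) \<le> e * norm (w - z)"
      proof (intro exI[of _ r] conjI ballI impI r(1))
        fix w assume w: "w \<in> E m" "norm (w - z) < r"
        define A where "A = (K j w - g w) - (K j z - g z)"
        define B where "B = K j w - K j z - (Re (w - z) *\<^sub>R P1 (s j) z + Im (w - z) *\<^sub>R P2 (s j) z)"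
        define C where "C = Re (w - z) *\<^sub>R (P1 (s j) z - G1 z)"
        define D where "D = Im (w - z) *\<^sub>R (P2 (s j) z - G2 z)"
        have "norm A \<le> 4 * (1/2)^j * norm (w - z)" unfolding A_def by (rule corner[OF j(1) w(1)])
        also have "\<dots> \<le> 4 * (e / 16) * norm (w - z)" using j(4) by (intro mult_right_mono) auto
        finally have A: "norm A \<le> e / 4 * norm (w - z)" by simp
        have B: "norm B \<le> e / 4 * norm (w - z)" unfolding B_def by (rule r(2)[OF w(2)])
        have "norm C \<le> norm (w - z) * (e / 8)" unfolding C_def norm_scaleR
          using j(2) abs_Re_le_cmod[of "w - z"] by (intro mult_mono) auto
        moreover have "norm D \<le> norm (w - z) * (e / 8)" unfolding D_def norm_scaleR
          using j(3) abs_Im_le_cmod[of "w - z"] by (intro mult_mono) auto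
        moreover have "norm (B - A + (C + D)) \<le> norm B + norm A + (norm C + norm D)"
          by (meson add_mono norm_triangle_ineq norm_triangle_ineq4 order_trans)
        moreover have "0 \<le> e * norm (w - z)" using e by simp
        ultimately have "norm (B - A + (C + D)) \<le> e * norm (w - z)"
          using A B by (simp add: mult.commute)
        moreover have "g w - g z - (Re (w - z) *\<^sub>R G1 z + Im (w - z) *\<^sub>R G2 z) = B - A + (C + D)"
          by (simp add: A_def B_def C_def D_def algebra_simps)
        ultimately show "norm (g w - g z - (Re (w - z) *\<^sub>R G1 z + Im (w - z) *\<^sub>R G2 z)) \<le> e * norm (w - z)"
          by (simp only:)
      qed
    qed
  qed
qed

section \<open>The area of an injective image\<close>

text \<open>The change of variables theorem concerns the type of real vectors; these two maps identify it
with the complex plane, including Lebesgue measure.\<close>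

definition to_vec2 :: "complex \<Rightarrow> real^2" where
  "to_vec2 z = vector [Re z, Im z]"

definition of_vec2 :: "real^2 \<Rightarrow> complex" where
  "of_vec2 x = Complex (x $ 1) (x $ 2)"

lemma of_to_vec2 [simp]: "of_vec2 (to_vec2 z) = z" "to_vec2 (of_vec2 x) = x"
  by (auto simp: to_vec2_def of_vec2_def vec_eq_iff forall_2)

lemma to_vec2_nth [simp]: "to_vec2 z $ 1 = Re z" "to_vec2 z $ 2 = Im z"
  by (auto simp: to_vec2_def)

lemma linear_to_vec2: "linear to_vec2" and linear_of_vec2: "linear of_vec2"
  by (auto intro!: linearI simp: to_vec2_def of_vec2_def vec_eq_iff forall_2 complex_eq_iff)

lemma measurable_vec2 [measurable]: "to_vec2 \<in> borel \<rightarrow>\<^sub>M borel" "of_vec2 \<in> borel \<rightarrow>\<^sub>M borel"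
  by (auto intro!: borel_measurable_continuous_onI linear_continuous_on
      simp: linear_linear linear_to_vec2 linear_of_vec2)

lemma lborel_vec2: "(lborel :: (real^2) measure) = distr lborel borel to_vec2"
proof (rule lborel_eqI)
  fix l u :: "real^2" assume lu: "\<And>b. b \<in> Basis \<Longrightarrow> l \<bullet> b \<le> u \<bullet> b"
  have B: "(Basis :: (real^2) set) = {axis 1 1, axis 2 1}"
    by (auto simp: Basis_vec_def UNIV_2)
  have n: "axis 1 1 \<noteq> (axis 2 1 :: real^2)" by (simp add: axis_eq_axis)
  have le: "l $ 1 \<le> u $ 1" "l $ 2 \<le> u $ 2"
    using lu[of "axis 1 1"] lu[of "axis 2 1"] unfolding B by (auto simp: inner_axis)
  have "emeasure (distr lborel borel to_vec2) (box l u) = emeasure lborel (to_vec2 -` box l u \<inter> space lborel)"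
    by (rule emeasure_distr) auto
  also have "to_vec2 -` box l u \<inter> space lborel = box (of_vec2 l) (of_vec2 u)"
    by (auto simp: mem_box_cart forall_2 in_box_complex_iff of_vec2_def)
  also have "emeasure lborel (box (of_vec2 l) (of_vec2 u)) = ennreal (\<Prod>b\<in>Basis. (of_vec2 u - of_vec2 l) \<bullet> b)"
    using le by (intro emeasure_lborel_box) (auto simp: Basis_complex_def of_vec2_def)
  also have "(\<Prod>b\<in>Basis. (of_vec2 u - of_vec2 l) \<bullet> b) = (\<Prod>b\<in>Basis. (u - l) \<bullet> b)"
    using n unfolding B complex_Basis_prod by (simp add: of_vec2_def inner_axis)
  finally show "emeasure (distr lborel borel to_vec2) (box l u) = ennreal (\<Prod>b\<in>Basis. (u - l) \<bullet> b)" .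
qed simp

text \<open>The area of the image is measured after transport to real vectors, which spares identifying the
two Lebesgue measures on images that are merely Lebesgue measurable.\<close>

lemma area_formula_within:
  fixes f a b :: "complex \<Rightarrow> complex"
  assumes S: "S \<in> sets borel"
    and der: "\<And>z. z \<in> S \<Longrightarrow> (f has_derivative (\<lambda>v. Re v *\<^sub>R a z + Im v *\<^sub>R b z)) (at z within S)"
    and [measurable]: "a \<in> borel_measurable borel" "b \<in> borel_measurable borel"
    and inj: "inj_on f S" and bdd: "bounded (f ` S)"
  shows "(\<integral>\<^sup>+z. ennreal \<bar>Im (cnj (a z) * b z)\<bar> * indicator S z \<partial>lborel) = ennreal (measure lebesgue (to_vec2 ` f ` S))"
    and "to_vec2 ` f ` S \<in> lmeasurable"
proof -
  define F where "F = to_vec2 \<circ> f \<circ> of_vec2"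
  define F' where "F' = (\<lambda>x. to_vec2 \<circ> (\<lambda>v. Re v *\<^sub>R a (of_vec2 x) + Im v *\<^sub>R b (of_vec2 x)) \<circ> of_vec2)"
  let ?S = "to_vec2 ` S"
  have Seq: "?S = of_vec2 -` S \<inter> space borel" by (auto simp: image_iff) (metis of_to_vec2(2))
  have Sb: "?S \<in> sets borel" unfolding Seq using S by (intro measurable_sets[OF measurable_vec2(2)]) auto
  note [measurable] = Sb
  have jm: "(\<lambda>z. ennreal \<bar>Im (cnj (a z) * b z)\<bar>) \<in> borel_measurable borel"
    by (simp add: borel_measurable_complex_iff[THEN iffD1])
  have SL: "?S \<in> sets lebesgue" using Sb by simp
  have FS: "F ` ?S = to_vec2 ` f ` S" by (auto simp: F_def image_iff)
  have bl: "bounded_linear to_vec2" "bounded_linear of_vec2"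
    using linear_to_vec2 linear_of_vec2 by (auto simp: linear_conv_bounded_linear)
  have derF: "(F has_derivative F' x) (at x within ?S)" if "x \<in> ?S" for x
  proof -
    have z: "of_vec2 x \<in> S" using that by auto
    have im: "of_vec2 ` ?S = S" by (simp add: image_image)
    have "(f has_derivative (\<lambda>v. Re v *\<^sub>R a (of_vec2 x) + Im v *\<^sub>R b (of_vec2 x))) (at (of_vec2 x) within of_vec2 ` ?S)"
      unfolding im by (rule der[OF z])
    from diff_chain_within[OF bounded_linear_imp_has_derivative[OF bl(2)] this]
    have "(f \<circ> of_vec2 has_derivative (\<lambda>v. Re v *\<^sub>R a (of_vec2 x) + Im v *\<^sub>R b (of_vec2 x)) \<circ> of_vec2) (at x within ?S)" .
    from diff_chain_within[OF this bounded_linear_imp_has_derivative[OF bl(1)]]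
    show ?thesis unfolding F_def F'_def by (simp add: comp_assoc)
  qed
  have injF: "inj_on F ?S"
  proof (rule inj_onI)
    fix x y assume xy: "x \<in> ?S" "y \<in> ?S" "F x = F y"
    then have "of_vec2 (F x) = of_vec2 (F y)" by simp
    then have fe: "f (of_vec2 x) = f (of_vec2 y)" by (simp add: F_def)
    have "of_vec2 x \<in> S" "of_vec2 y \<in> S" using xy(1,2) by auto
    with fe inj have "of_vec2 x = of_vec2 y" by (simp add: inj_onD)
    then show "x = y" by (metis of_to_vec2(2))
  qed
  have det: "\<bar>det (matrix (F' x))\<bar> = \<bar>Im (cnj (a (of_vec2 x)) * b (of_vec2 x))\<bar>" for x
  proof -
    have e: "of_vec2 (axis 1 1) = 1" "of_vec2 (axis 2 1) = \<i>"
      by (auto simp: of_vec2_def axis_def complex_eq_iff)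
    show ?thesis by (simp add: det_2 matrix_def F'_def e algebra_simps)
  qed
  have "F differentiable_on ?S" using derF by (auto simp: differentiable_on_def differentiable_def)
  then have "F ` ?S \<in> sets lebesgue" by (intro differentiable_image_in_sets_lebesgue SL) auto
  moreover have "bounded (F ` ?S)" unfolding FS using bdd bl(1) by (rule bounded_linear_image)
  ultimately have lm: "F ` ?S \<in> lmeasurable" by (intro bounded_set_imp_lmeasurable)
  then show "to_vec2 ` f ` S \<in> lmeasurable" unfolding FS .
  have "((\<lambda>x. \<bar>det (matrix (F' x))\<bar>) has_integral measure lebesgue (F ` ?S)) ?S"
    using has_measure_differentiable_image[OF SL derF injF, of "measure lebesgue (F ` ?S)"] lm by simp
  from nn_integral_has_integral_lebesgue'[OF _ this]
  have "ennreal (measure lebesgue (F ` ?S)) = (\<integral>\<^sup>+x. ennreal \<bar>Im (cnj (a (of_vec2 x)) * b (of_vec2 x))\<bar> * indicator ?S x \<partial>lborel)"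
    by (simp add: det)
  also have "\<dots> = (\<integral>\<^sup>+z. ennreal \<bar>Im (cnj (a z) * b z)\<bar> * indicator ?S (to_vec2 z) \<partial>lborel)"
    unfolding lborel_vec2 using measurable_compose[OF measurable_vec2(2) jm]
    by (subst nn_integral_distr) (auto simp del: times_complex.sel)
  also have "\<dots> = (\<integral>\<^sup>+z. ennreal \<bar>Im (cnj (a z) * b z)\<bar> * indicator S z \<partial>lborel)"
  proof (intro nn_integral_cong)
    fix z
    have "to_vec2 z \<in> ?S \<longleftrightarrow> z \<in> S" by (metis (mono_tags) image_iff of_to_vec2(1))
    then show "ennreal \<bar>Im (cnj (a z) * b z)\<bar> * indicator ?S (to_vec2 z) = ennreal \<bar>Im (cnj (a z) * b z)\<bar> * indicator S z"
      by (simp only: indicator_def)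
  qed
  finally show "(\<integral>\<^sup>+z. ennreal \<bar>Im (cnj (a z) * b z)\<bar> * indicator S z \<partial>lborel) = ennreal (measure lebesgue (to_vec2 ` f ` S))"
    unfolding FS by simp
qed

text \<open>By invariance of domain the image of the interior is open, so that its frontier lies in the image
of the frontier of \<open>Q\<close>, hence in \<open>P\<close>. The complement of \<open>P\<close> is connected and unbounded; if it met
the bounded image, it would have to cross this frontier.\<close>

lemma injective_image_subset_of_convex:
  fixes f :: "'a::euclidean_space \<Rightarrow> 'a"
  assumes dim: "2 \<le> DIM('a)" and Q: "compact Q" and f: "continuous_on Q f" "inj_on f Q"
    and P: "compact P" "convex P" and bd: "f ` frontier Q \<subseteq> P"
  shows "f ` Q \<subseteq> P"
proof -
  define U where "U = f ` interior Q"
  have "open U" unfolding U_def using f interior_subset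
    by (intro invariance_of_domain) (auto intro: continuous_on_subset inj_on_subset)
  have cl: "closed Q" using Q by (rule compact_imp_closed)
  have cf: "compact (f ` Q)" using Q f(1) by (intro compact_continuous_image)
  have UQ: "U \<subseteq> f ` Q" unfolding U_def using interior_subset by blast
  have "frontier U = closure U - U" using \<open>open U\<close> by (simp add: frontier_def interior_open)
  also have "\<dots> \<subseteq> f ` Q - f ` interior Q"
    using closure_minimal[OF UQ compact_imp_closed[OF cf]] by (auto simp: U_def)
  also have "\<dots> \<subseteq> f ` frontier Q" using cl by (auto simp: frontier_def)
  finally have fr: "frontier U \<subseteq> P" using bd by blast
  have "U \<subseteq> P"
  proof (rule ccontr)
    assume "\<not> U \<subseteq> P"
    have "connected (- P)"
      by (rule connected_complement_bounded_convex[OF compact_imp_bounded[OF P(1)] P(2) dim])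
    moreover have "- P \<inter> U \<noteq> {}" using \<open>\<not> U \<subseteq> P\<close> by blast
    moreover have "- P - U \<noteq> {}"
    proof
      assume "- P - U = {}"
      then have "UNIV \<subseteq> P \<union> f ` Q" using UQ by blast
      moreover have "bounded (P \<union> f ` Q)" using P(1) cf by (simp add: compact_imp_bounded)
      ultimately show False using bounded_subset not_bounded_UNIV by blast
    qed
    ultimately have "- P \<inter> frontier U \<noteq> {}" by (rule connected_Int_frontier)
    with fr show False by blast
  qed
  then show ?thesis using bd cl by (force simp: U_def frontier_def)
qed

section \<open>Functions vanishing on the boundary of a rectangle\<close>

text \<open>The constant function \<open>1\<close> is an admissible test function after extension by zero.\<close>

lemma W10_integral_partials:
  assumes "W10_on_box q g G1 G2"
  shows "(LINT z|lborel. G1 z) = 0" "(LINT z|lborel. G2 z) = 0"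
proof -
  have 1: "((\<lambda>_. 1) has_real_derivative 0) (at x)" for x :: real by simp
  have 2: "continuous_on UNIV (\<lambda>_::real. 0::real)" by simp
  have "(LINT z|lborel. (Re 1 * (0 * 1) + Im 1 * (1 * 0)) *\<^sub>R g z) = - (LINT z|lborel. (1 * 1) *\<^sub>R G1 z)"
    by (rule weak_partial_extends_by_0[where a="\<lambda>_. 1" and a'="\<lambda>_. 0" and b="\<lambda>_. 1" and b'="\<lambda>_. 0" and q=q])
      (use assms 1 2 smooth1_const in \<open>auto simp: W10_on_box_def simp del: smooth1.simps\<close>)
  then show "(LINT z|lborel. G1 z) = 0" by simp
  have "(LINT z|lborel. (Re \<i> * (0 * 1) + Im \<i> * (1 * 0)) *\<^sub>R g z) = - (LINT z|lborel. (1 * 1) *\<^sub>R G2 z)"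
    by (rule weak_partial_extends_by_0[where a="\<lambda>_. 1" and a'="\<lambda>_. 0" and b="\<lambda>_. 1" and b'="\<lambda>_. 0" and q=q])
      (use assms 1 2 smooth1_const in \<open>auto simp: W10_on_box_def simp del: smooth1.simps\<close>)
  then show "(LINT z|lborel. G2 z) = 0" by simp
qed

text \<open>Uniqueness of weak derivatives: approximations of the zero function vanish by the contraction
property of mollification, and their derivatives converge in \<open>L\<^sup>1\<close> to the given ones.\<close>

lemma W10_zero_partials:
  assumes W: "W10_on_box q g G1 G2" and g: "\<And>z. g z = 0"
  shows "AE z in lborel. G1 z = 0" "AE z in lborel. G2 z = 0"
proof -
  obtain h P1 P2 :: "nat \<Rightarrow> complex \<Rightarrow> complex" where
    d: "\<And>j z. (h j has_derivative (\<lambda>v. Re v *\<^sub>R P1 j z + Im v *\<^sub>R P2 j z)) (at z)"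
    and sup: "\<And>M j z. (\<And>w. norm (g w) \<le> M) \<Longrightarrow> norm (h j z) \<le> M"
    and L: "(\<lambda>j. \<integral>\<^sup>+z. norm (P1 j z - G1 z) \<partial>lborel) \<longlonglongrightarrow> 0" "(\<lambda>j. \<integral>\<^sup>+z. norm (P2 j z - G2 z) \<partial>lborel) \<longlonglongrightarrow> 0"
    by (rule C1_approximation_of_W10[OF W]) blast
  have "h j z = 0" for j z using sup[of 0 j z] g by simp
  then have "h j = (\<lambda>_. 0)" for j by auto
  then have "(\<lambda>v. Re v *\<^sub>R P1 j z + Im v *\<^sub>R P2 j z) = (\<lambda>_. 0)" for j z
    using d[of j z] has_derivative_unique[OF _ has_derivative_const] by fastforce
  then have eq: "Re v *\<^sub>R P1 j z + Im v *\<^sub>R P2 j z = 0" for v j z by metis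
  have "P1 j z = 0" "P2 j z = 0" for j z
    using eq[of 1 j z] eq[of \<i> j z] by auto
  then have "(\<integral>\<^sup>+z. norm (G1 z) \<partial>lborel) = 0" "(\<integral>\<^sup>+z. norm (G2 z) \<partial>lborel) = 0"
    using L by (auto simp: LIMSEQ_const_iff)
  moreover have "G1 \<in> borel_measurable borel" "G2 \<in> borel_measurable borel" using W by (auto simp: W10_on_box_def)
  ultimately show "AE z in lborel. G1 z = 0" "AE z in lborel. G2 z = 0"
    by (auto simp: nn_integral_0_iff_AE)
qed

text \<open>Moving from \<open>z\<close> by the length \<open>Re q + Im q + 1\<close>, which exceeds the diameter of the rectangle,
leads to a zero of \<open>h\<close>; the increment is integrated over \<open>z\<close> by translation invariance.\<close>

lemma C1_poincare:
  fixes h P1 P2 :: "complex \<Rightarrow> complex"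
  assumes q: "0 < Re q" "0 < Im q"
    and d: "\<And>z. (h has_derivative (\<lambda>v. Re v *\<^sub>R P1 z + Im v *\<^sub>R P2 z)) (at z)"
    and P: "continuous_on UNIV P1" "continuous_on UNIV P2"
    and h0: "\<And>z. z \<notin> cbox 0 q \<Longrightarrow> h z = 0" and v: "norm v = 1"
  shows "(\<integral>\<^sup>+z. norm (h z) \<partial>lborel) \<le> ennreal (2 * (Re q + Im q + 1)) * (\<integral>\<^sup>+z. norm (Re v *\<^sub>R P1 z + Im v *\<^sub>R P2 z) \<partial>lborel)"
proof -
  define R where "R = Re q + Im q + 1"
  have R: "0 < R" using q by (simp add: R_def)
  have cball: "cball 0 R = {-R..R}" by (auto simp: dist_real_def)
  define D where "D = (\<lambda>z. Re v *\<^sub>R P1 z + Im v *\<^sub>R P2 z)"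
  have Dc: "continuous_on UNIV D" unfolding D_def by (intro continuous_intros P)
  then have [measurable]: "D \<in> borel_measurable borel" by (rule borel_measurable_continuous_onI)
  have pt: "ennreal (norm (h z)) \<le> (\<integral>\<^sup>+s. ennreal (norm (D (z + s *\<^sub>R v))) * indicator {-R..R} s \<partial>lborel)" for z
  proof (cases "z \<in> cbox 0 q")
    case True
    have dv: "((\<lambda>s. h (z + s *\<^sub>R v)) has_vector_derivative D (z + s *\<^sub>R v)) (at s)" for s
    proof -
      have "((\<lambda>s. z + s *\<^sub>R v) has_derivative (\<lambda>t. t *\<^sub>R v)) (at s)" by (auto intro!: derivative_eq_intros)
      from has_derivative_compose[OF this d] show ?thesis
        by (simp add: has_vector_derivative_def D_def algebra_simps)
    qed
    have cv: "continuous_on UNIV (\<lambda>s. D (z + s *\<^sub>R v))"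
      by (intro continuous_on_compose2[OF Dc] continuous_intros) auto
    \<comment> \<open>points of the rectangle differ by at most \<open>Re q + Im q\<close> in norm\<close>
    have "z + R *\<^sub>R v \<notin> cbox 0 q"
    proof
      assume "z + R *\<^sub>R v \<in> cbox 0 q"
      with True have "\<bar>Re (R *\<^sub>R v)\<bar> \<le> Re q" "\<bar>Im (R *\<^sub>R v)\<bar> \<le> Im q" by (auto simp: in_cbox_complex_iff)
      then have "norm (R *\<^sub>R v) \<le> Re q + Im q" using cmod_le[of "R *\<^sub>R v"] by linarith
      then show False using v R by (simp add: R_def)
    qed
    then have "h (z + R *\<^sub>R v) = 0" by (rule h0)
    then show ?thesis
      using norm_increment_le_nn_integral[OF dv cv, of 0 R] R cball by simp
  qed (simp add: h0)
  have "(\<integral>\<^sup>+z. norm (h z) \<partial>lborel) \<le> (\<integral>\<^sup>+z. \<integral>\<^sup>+s. ennreal (norm (D (z + s *\<^sub>R v))) * indicator {-R..R} s \<partial>lborel \<partial>lborel)"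
    by (intro nn_integral_mono pt)
  also have "\<dots> = (\<integral>\<^sup>+s. \<integral>\<^sup>+z. ennreal (norm (D (z + s *\<^sub>R v))) * indicator {-R..R} s \<partial>lborel \<partial>lborel)"
    by (rule lborel_pair.Fubini'[symmetric]) (simp add: case_prod_unfold)
  also have "\<dots> = (\<integral>\<^sup>+s. (\<integral>\<^sup>+z. norm (D z) \<partial>lborel) * indicator {-R..R} s \<partial>lborel)"
    by (intro nn_integral_cong) (simp add: nn_integral_multc nn_integral_lborel_shift[of "\<lambda>z. ennreal (norm (D z))"])
  also have "\<dots> = (\<integral>\<^sup>+z. norm (D z) \<partial>lborel) * emeasure lborel {-R..R}"
    by (subst nn_integral_cmult) auto
  also have "emeasure lborel {-R..R} = ennreal (2 * R)" using R by simp
  finally show ?thesis by (simp add: D_def R_def mult.commute)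
qed

lemma W10_poincare:
  assumes W: "W10_on_box q g G1 G2" and v: "norm v = 1"
  shows "(\<integral>\<^sup>+z. norm (g z) \<partial>lborel) \<le> ennreal (2 * (Re q + Im q + 3)) * (\<integral>\<^sup>+z. norm (Re v *\<^sub>R G1 z + Im v *\<^sub>R G2 z) \<partial>lborel)"
proof -
  have q: "0 < Re q" "0 < Im q" and gc: "continuous_on UNIV g" 
    and [measurable]: "G1 \<in> borel_measurable borel" "G2 \<in> borel_measurable borel"
    using W by (auto simp: W10_on_box_def)
  have [measurable]: "g \<in> borel_measurable borel" using gc by (rule borel_measurable_continuous_onI)
  obtain h P1 P2 :: "nat \<Rightarrow> complex \<Rightarrow> complex" where
    d: "\<And>j z. (h j has_derivative (\<lambda>v. Re v *\<^sub>R P1 j z + Im v *\<^sub>R P2 j z)) (at z)"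
    and P: "\<And>j. continuous_on UNIV (P1 j)" "\<And>j. continuous_on UNIV (P2 j)"
    and h0: "\<And>j z. z \<notin> cbox 0 (q + 1 + \<i>) \<Longrightarrow> h j z = 0"
    and lim: "\<And>z. (\<lambda>j. h j z) \<longlonglongrightarrow> g z"
    and L: "(\<lambda>j. \<integral>\<^sup>+z. norm (P1 j z - G1 z) \<partial>lborel) \<longlonglongrightarrow> 0" "(\<lambda>j. \<integral>\<^sup>+z. norm (P2 j z - G2 z) \<partial>lborel) \<longlonglongrightarrow> 0"
    by (rule C1_approximation_of_W10[OF W]) blast
  have [measurable]: "P1 j \<in> borel_measurable borel" "P2 j \<in> borel_measurable borel" for j
    using P by (auto intro: borel_measurable_continuous_onI)
  have hm[measurable]: "h j \<in> borel_measurable borel" for j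
    using d by (auto intro!: borel_measurable_continuous_onI continuous_at_imp_continuous_on has_derivative_continuous)
  define C where "C = 2 * (Re q + Im q + 3)"
  let ?I = "\<integral>\<^sup>+z. norm (Re v *\<^sub>R G1 z + Im v *\<^sub>R G2 z) \<partial>lborel"
  let ?e1 = "\<lambda>j. \<integral>\<^sup>+z. norm (P1 j z - G1 z) \<partial>lborel" and ?e2 = "\<lambda>j. \<integral>\<^sup>+z. norm (P2 j z - G2 z) \<partial>lborel"
  have rv: "\<bar>Re v\<bar> \<le> 1" "\<bar>Im v\<bar> \<le> 1" using abs_Re_le_cmod[of v] abs_Im_le_cmod[of v] v by auto
  have le: "(\<integral>\<^sup>+z. norm (h j z) \<partial>lborel) \<le> ennreal C * (?I + (?e1 j + ?e2 j))" for j
  proof -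
    have "(\<integral>\<^sup>+z. norm (h j z) \<partial>lborel) \<le> ennreal C * (\<integral>\<^sup>+z. norm (Re v *\<^sub>R P1 j z + Im v *\<^sub>R P2 j z) \<partial>lborel)"
    proof -
      \<comment> \<open>the approximations live on a rectangle that is larger by \<open>1\<close> in both directions\<close>
      have C: "C = 2 * (Re (q + 1 + \<i>) + Im (q + 1 + \<i>) + 1)" by (simp add: C_def)
      show ?thesis unfolding C using C1_poincare[where q="q + 1 + \<i>", OF _ _ d P h0 v] q by simp
    qed
    also have "(\<integral>\<^sup>+z. norm (Re v *\<^sub>R P1 j z + Im v *\<^sub>R P2 j z) \<partial>lborel) \<le>
       (\<integral>\<^sup>+z. ennreal (norm (Re v *\<^sub>R G1 z + Im v *\<^sub>R G2 z)) + (ennreal (norm (P1 j z - G1 z)) + ennreal (norm (P2 j z - G2 z))) \<partial>lborel)"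
    proof (intro nn_integral_mono)
      fix z
      have "Re v *\<^sub>R P1 j z + Im v *\<^sub>R P2 j z = (Re v *\<^sub>R G1 z + Im v *\<^sub>R G2 z) + (Re v *\<^sub>R (P1 j z - G1 z) + Im v *\<^sub>R (P2 j z - G2 z))"
        by (simp add: algebra_simps)
      also have "norm \<dots> \<le> norm (Re v *\<^sub>R G1 z + Im v *\<^sub>R G2 z) + (norm (Re v *\<^sub>R (P1 j z - G1 z)) + norm (Im v *\<^sub>R (P2 j z - G2 z)))"
        by (intro order_trans[OF norm_triangle_ineq] add_mono norm_triangle_ineq order_refl)
      also have "\<dots> \<le> norm (Re v *\<^sub>R G1 z + Im v *\<^sub>R G2 z) + (1 * norm (P1 j z - G1 z) + 1 * norm (P2 j z - G2 z))"
        unfolding norm_scaleR using rv by (intro add_mono mult_right_mono order_refl) auto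
      finally show "ennreal (norm (Re v *\<^sub>R P1 j z + Im v *\<^sub>R P2 j z)) \<le>
        ennreal (norm (Re v *\<^sub>R G1 z + Im v *\<^sub>R G2 z)) + (ennreal (norm (P1 j z - G1 z)) + ennreal (norm (P2 j z - G2 z)))"
        by (simp add: ennreal_leI flip: ennreal_plus)
    qed
    also have "\<dots> = ?I + (?e1 j + ?e2 j)" by (simp add: nn_integral_add)
    finally show ?thesis by (simp add: mult_left_mono)
  qed
  have "(\<integral>\<^sup>+z. norm (g z) \<partial>lborel) = (\<integral>\<^sup>+z. liminf (\<lambda>j. ennreal (norm (h j z))) \<partial>lborel)"
    by (intro nn_integral_cong lim_imp_Liminf[symmetric] tendsto_ennrealI tendsto_norm lim) auto
  also have "\<dots> \<le> liminf (\<lambda>j. \<integral>\<^sup>+z. norm (h j z) \<partial>lborel)" by (rule nn_integral_liminf) auto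
  also have "\<dots> \<le> liminf (\<lambda>j. ennreal C * (?I + (?e1 j + ?e2 j)))"
    by (intro Liminf_mono always_eventually allI le)
  also have "\<dots> = ennreal C * ?I"
  proof (rule lim_imp_Liminf)
    have "(\<lambda>j. ?I + (?e1 j + ?e2 j)) \<longlonglongrightarrow> ?I + (0 + 0)" by (intro tendsto_add tendsto_const L)
    then show "(\<lambda>j. ennreal C * (?I + (?e1 j + ?e2 j))) \<longlonglongrightarrow> ennreal C * ?I"
      by (intro ennreal_tendsto_cmult) auto
  qed auto
  finally show ?thesis by (simp add: C_def)
qed

section \<open>Maps with the boundary values of the stretch\<close>

lemma Q1_eq_cbox: "Q1 l = cbox 0 (Complex l 1)"
  by (auto simp: Q1_def in_cbox_complex_iff)

lemma interior_Q1: "interior (Q1 l) = box 0 (Complex l 1)"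
  by (simp add: Q1_eq_cbox interior_cbox)

lemma borel_representative:
  fixes p :: "complex \<Rightarrow> complex"
  assumes \<Omega>: "\<Omega> \<in> sets borel" and p: "integrable (lebesgue_on \<Omega>) p"
  obtains G where "integrable lborel G" "\<And>z. z \<notin> \<Omega> \<Longrightarrow> G z = 0" "AE z in lborel. z \<in> \<Omega> \<longrightarrow> p z = G z"
proof -
  have int: "integrable lebesgue (\<lambda>z. indicator \<Omega> z *\<^sub>R p z)"
    using p \<Omega> by (subst (asm) integrable_restrict_space) auto
  then have m: "(\<lambda>z. indicator \<Omega> z *\<^sub>R p z) \<in> borel_measurable lebesgue" by auto
  obtain r where r: "r \<in> borel_measurable lborel" "AE z in lborel. Re (indicator \<Omega> z *\<^sub>R p z) = r z"
    using completion_ex_borel_measurable_real[OF measurable_compose[OF m borel_measurable_Re]] by auto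
  obtain i where i: "i \<in> borel_measurable lborel" "AE z in lborel. Im (indicator \<Omega> z *\<^sub>R p z) = i z"
    using completion_ex_borel_measurable_real[OF measurable_compose[OF m borel_measurable_Im]] by auto
  define G where "G = (\<lambda>z. indicator \<Omega> z *\<^sub>R Complex (r z) (i z))"
  have [measurable]: "r \<in> borel_measurable borel" "i \<in> borel_measurable borel" using r i by auto
  have Gm: "G \<in> borel_measurable borel" unfolding G_def using \<Omega> 
    by (subst borel_measurable_complex_iff) simp
  have ae: "AE z in lborel. indicator \<Omega> z *\<^sub>R p z = G z"
    using r(2) i(2) by eventually_elim (auto simp: G_def complex_eq_iff split: split_indicator)
  have "integrable lebesgue G"
    using int ae Gm by (subst integrable_cong_AE[where g="\<lambda>z. indicator \<Omega> z *\<^sub>R p z"]) (auto intro: measurable_completion AE_completion)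
  then have "integrable lborel G" using Gm by (simp add: integrable_completion)
  then show ?thesis
  proof (rule that)
    show "AE z in lborel. z \<in> \<Omega> \<longrightarrow> p z = G z" using ae by eventually_elim (auto simp: indicator_def)
  qed (simp add: G_def)
qed

text \<open>Weak derivatives are only Lebesgue measurable on the open rectangle, while products and
convolutions in the plane require Borel functions; this lemma and the previous one pass between the
two.\<close>

lemma LINT_lebesgue_on_eq_lborel:
  fixes F F' :: "complex \<Rightarrow> 'b::{banach, second_countable_topology}"
  assumes \<Omega>: "\<Omega> \<in> sets borel" and F: "F \<in> borel_measurable (lebesgue_on \<Omega>)"
    and F': "F' \<in> borel_measurable borel" "\<And>z. z \<notin> \<Omega> \<Longrightarrow> F' z = 0"
    and ae: "AE z in lborel. z \<in> \<Omega> \<longrightarrow> F z = F' z"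
  shows "(LINT z|lebesgue_on \<Omega>. F z) = (LINT z|lborel. F' z)"
    and "integrable (lebesgue_on \<Omega>) F \<longleftrightarrow> integrable lborel F'"
proof -
  have m: "(\<lambda>z. indicator \<Omega> z *\<^sub>R F z) \<in> borel_measurable lebesgue"
    using F \<Omega> by (subst (asm) borel_measurable_restrict_space_iff) auto
  have ae': "AE z in lebesgue. indicator \<Omega> z *\<^sub>R F z = F' z"
    using AE_completion[OF ae] by eventually_elim (use F'(2) in \<open>auto split: split_indicator\<close>)
  have "(LINT z|lebesgue_on \<Omega>. F z) = (LINT z|lebesgue. indicator \<Omega> z *\<^sub>R F z)"
    using \<Omega> by (subst integral_restrict_space) auto
  also have "\<dots> = (LINT z|lebesgue. F' z)"
    using m F'(1) ae' by (intro integral_cong_AE) (auto intro: measurable_completion)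
  also have "\<dots> = (LINT z|lborel. F' z)" using F'(1) by (simp add: integral_completion)
  finally show "(LINT z|lebesgue_on \<Omega>. F z) = (LINT z|lborel. F' z)" .
  have "integrable (lebesgue_on \<Omega>) F \<longleftrightarrow> integrable lebesgue (\<lambda>z. indicator \<Omega> z *\<^sub>R F z)"
    using \<Omega> by (subst integrable_restrict_space) auto
  also have "\<dots> \<longleftrightarrow> integrable lebesgue F'"
    using m F'(1) ae' by (intro integrable_cong_AE) (auto intro: measurable_completion)
  also have "\<dots> \<longleftrightarrow> integrable lborel F'" using F'(1) by (simp add: integrable_completion)
  finally show "integrable (lebesgue_on \<Omega>) F \<longleftrightarrow> integrable lborel F'" .
qed

text \<open>By translation invariance the integral of each difference quotient vanishes, and difference
quotients converge boundedly.\<close>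

lemma integral_directional_derivative_eq_0:
  fixes w :: "complex \<Rightarrow> complex"
  assumes d: "\<And>z. (w has_derivative w' z) (at z)" and c: "continuous_on UNIV (\<lambda>z. w' z v)"
    and S: "compact S" "\<And>z. z \<notin> S \<Longrightarrow> w z = 0" "\<And>z. z \<notin> S \<Longrightarrow> w' z v = 0"
  shows "(LINT z|lborel. w' z v) = 0"
proof -
  have wc: "continuous_on UNIV w"
    using d by (auto intro!: continuous_at_imp_continuous_on has_derivative_continuous)
  have wi: "integrable lborel w" by (rule integrable_continuous_vanishing[OF wc S(1,2)])
  have [measurable]: "w \<in> borel_measurable borel" using wi by auto
  have cm[measurable]: "(\<lambda>z. w' z v) \<in> borel_measurable borel" using c by (rule borel_measurable_continuous_onI)
  obtain T where T: "S \<subseteq> cball 0 T" "0 < T"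
    using compact_imp_bounded[OF S(1)] by (auto simp: bounded_pos subset_iff)
  obtain L where L: "0 \<le> L" "\<And>z. norm (w' z v) \<le> L"
  proof -
    have "bounded ((\<lambda>z. w' z v) ` S)" using S(1) c
      by (intro compact_imp_bounded compact_continuous_image) (auto intro: continuous_on_subset)
    then obtain L where L: "0 < L" "\<And>z. z \<in> S \<Longrightarrow> norm (w' z v) \<le> L" by (auto simp: bounded_pos)
    show thesis
    proof (rule that[of L])
      show "norm (w' z v) \<le> L" for z using L S(3)[of z] by (cases "z \<in> S") auto
    qed (use L in simp)
  qed
  define t where "t = (\<lambda>n. inverse (real (Suc n)))"
  have t: "0 < t n" "t n \<le> 1" for n by (auto simp: t_def inverse_le_1_iff)
  have t0: "t \<longlonglongrightarrow> 0" unfolding t_def by (rule LIMSEQ_inverse_real_of_nat)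
  define q where "q = (\<lambda>n z. (w (z + t n *\<^sub>R v) - w z) /\<^sub>R t n)"
  have dv: "((\<lambda>s. w (z + s *\<^sub>R v)) has_vector_derivative w' (z + s *\<^sub>R v) v) (at s)" for z s
  proof -
    have "((\<lambda>s. z + s *\<^sub>R v) has_derivative (\<lambda>t. t *\<^sub>R v)) (at s)" by (auto intro!: derivative_eq_intros)
    from has_derivative_compose[OF this d]
    have "((\<lambda>s. w (z + s *\<^sub>R v)) has_derivative (\<lambda>t. w' (z + s *\<^sub>R v) (t *\<^sub>R v))) (at s)" .
    moreover have "w' y (t *\<^sub>R v) = t *\<^sub>R w' y v" for y t
      using has_derivative_bounded_linear[OF d[of y]] by (simp add: linear_simps)
    ultimately show ?thesis by (simp add: has_vector_derivative_def)
  qed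
  have lip: "norm (w (z + s *\<^sub>R v) - w z) \<le> L * (2 * \<bar>s\<bar>)" for z s
  proof -
    have "ennreal (norm (w (z + (0 + s) *\<^sub>R v) - w (z + 0 *\<^sub>R v))) \<le>
       (\<integral>\<^sup>+r. ennreal (norm (w' (z + r *\<^sub>R v) v)) * indicator (cball 0 \<bar>s\<bar>) r \<partial>lborel)"
      by (rule norm_increment_le_nn_integral[OF dv])
        (intro continuous_on_compose2[OF c] continuous_intros, auto)
    also have "\<dots> \<le> (\<integral>\<^sup>+(r::real). ennreal L * indicator (cball 0 \<bar>s\<bar>) r \<partial>lborel)"
    proof (rule nn_integral_mono)
      fix r
      show "ennreal (norm (w' (z + r *\<^sub>R v) v)) * indicator (cball 0 \<bar>s\<bar>) r \<le> ennreal L * indicator (cball 0 \<bar>s\<bar>) r"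
        by (rule mult_right_mono) (auto intro: ennreal_leI L(2))
    qed
    also have "\<dots> = ennreal L * emeasure lborel {- \<bar>s\<bar>..\<bar>s\<bar>}"
    proof -
      have e: "cball 0 \<bar>s\<bar> = {- \<bar>s\<bar>..\<bar>s\<bar>}" by (auto simp: dist_real_def)
      show ?thesis unfolding e by (subst nn_integral_cmult_indicator) auto
    qed
    also have "\<dots> = ennreal (L * (2 * \<bar>s\<bar>))" using L by (simp add: ennreal_mult)
    finally show ?thesis using L by (simp add: mult_nonneg_nonneg)
  qed
  have "(\<lambda>n. LINT z|lborel. q n z) \<longlonglongrightarrow> (LINT z|lborel. w' z v)"
  proof (rule integral_dominated_convergence[where w="\<lambda>z. 2 * L * indicator (cball 0 (T + norm v)) z"])
    show "q n \<in> borel_measurable lborel" for n unfolding q_def by simp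
    show "integrable lborel (\<lambda>z. 2 * L * indicator (cball (0::complex) (T + norm v)) z)"
      using emeasure_lborel_cball_finite[of "0::complex" "T + norm v"]
      by (intro integrable_mult_right integrable_real_indicator) auto
    show "AE z in lborel. (\<lambda>n. q n z) \<longlonglongrightarrow> w' z v"
    proof (intro AE_I2)
      fix z
      have "((\<lambda>s. w (z + s *\<^sub>R v)) has_vector_derivative w' z v) (at 0)" using dv[of z 0] by simp
      then have "((\<lambda>s. norm (w (z + s *\<^sub>R v) - w z - s *\<^sub>R w' z v) / norm s) \<longlongrightarrow> 0) (at 0)"
        by (simp add: has_vector_derivative_def has_derivative_iff_norm)
      then have "((\<lambda>s. norm ((w (z + s *\<^sub>R v) - w z) /\<^sub>R s - w' z v)) \<longlongrightarrow> 0) (at 0)"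
      proof (rule Lim_transform_eventually)
        have "norm (w (z + s *\<^sub>R v) - w z - s *\<^sub>R w' z v) / norm s = norm ((w (z + s *\<^sub>R v) - w z) /\<^sub>R s - w' z v)" if "s \<noteq> 0" for s
        proof -
          have "(w (z + s *\<^sub>R v) - w z) /\<^sub>R s - w' z v = inverse s *\<^sub>R (w (z + s *\<^sub>R v) - w z - s *\<^sub>R w' z v)"
            using that by (simp add: scaleR_diff_right)
          then show ?thesis by (simp only: norm_scaleR) (simp add: divide_inverse)
        qed
        then show "\<forall>\<^sub>F s in at 0. norm (w (z + s *\<^sub>R v) - w z - s *\<^sub>R w' z v) / norm s = norm ((w (z + s *\<^sub>R v) - w z) /\<^sub>R s - w' z v)"
          by (simp add: eventually_at_filter)
      qed
      then have "((\<lambda>s. (w (z + s *\<^sub>R v) - w z) /\<^sub>R s - w' z v) \<longlongrightarrow> 0) (at 0)" by (rule tendsto_norm_zero_cancel)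
      then have "((\<lambda>s. (w (z + s *\<^sub>R v) - w z) /\<^sub>R s) \<longlongrightarrow> w' z v) (at 0)" by (rule LIM_zero_cancel)
      then show "(\<lambda>n. q n z) \<longlonglongrightarrow> w' z v"
        unfolding q_def by (rule filterlim_compose) (use t t0 in \<open>auto simp: filterlim_at less_imp_neq[symmetric]\<close>)
    qed
    show "AE z in lborel. norm (q n z) \<le> 2 * L * indicator (cball 0 (T + norm v)) z" for n
    proof (intro AE_I2)
      fix z
      show "norm (q n z) \<le> 2 * L * indicator (cball 0 (T + norm v)) z"
      proof (cases "z \<in> cball 0 (T + norm v)")
        case True
        have "norm (q n z) = norm (w (z + t n *\<^sub>R v) - w z) / t n"
          using t[of n] by (simp add: q_def divide_inverse mult.commute)
        also have "\<dots> \<le> L * (2 * \<bar>t n\<bar>) / t n" using lip[of z "t n"] t[of n] by (intro divide_right_mono) auto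
        finally show ?thesis using True t[of n] by simp
      next
        case False
        have "norm (t n *\<^sub>R v) \<le> 1 * norm v" using t[of n] by (simp add: mult_left_le_one_le)
        then have "norm (z + t n *\<^sub>R v) > T" using False norm_triangle_ineq2[of z "- (t n *\<^sub>R v)"] by simp
        moreover have "norm z > T" using False norm_ge_zero[of v] by (simp del: norm_ge_zero)
        ultimately have "z + t n *\<^sub>R v \<notin> S" "z \<notin> S" using T(1) by auto
        then show ?thesis using S(2) L(1) by (simp add: q_def)
      qed
    qed
  qed auto
  moreover have "(LINT z|lborel. q n z) = 0" for n
  proof -
    have "integrable (distr lborel borel ((+) (t n *\<^sub>R v))) w" "(LINT z|distr lborel borel ((+) (t n *\<^sub>R v)). w z) = (LINT z|lborel. w z)"
      using wi by (simp_all add: lborel_distr_plus)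
    then have "integrable lborel (\<lambda>z. w (z + t n *\<^sub>R v))" "(LINT z|lborel. w (z + t n *\<^sub>R v)) = (LINT z|lborel. w z)"
      by (simp_all add: integrable_distr_eq integral_distr add.commute)
    then show ?thesis using wi by (simp add: q_def)
  qed
  ultimately show ?thesis by (simp add: LIMSEQ_const_iff)
qed


lemma test_function_outside:
  assumes u: "test_function \<Omega> u" and z: "z \<notin> \<Omega>"
  shows "u z = 0" "frechet_derivative u (at z) v = 0"
proof -
  define W where "W = - closure {z. u z \<noteq> 0}"
  have W: "open W" "z \<in> W" using u z by (auto simp: W_def test_function_def)
  have 0: "u x = 0" if "x \<in> W" for x using that closure_subset by (force simp: W_def)
  then show "u z = 0" using W by blast
  have "(u has_derivative (\<lambda>_. 0)) (at z)"
    by (rule has_derivative_transform_within_open[OF has_derivative_const W]) (simp add: 0)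
  from frechet_derivative_at[OF this] show "frechet_derivative u (at z) v = 0" by metis
qed

lemma test_function_derivative:
  assumes u: "test_function \<Omega> u"
  shows "(u has_derivative frechet_derivative u (at z)) (at z)" "continuous_on UNIV (\<lambda>z. frechet_derivative u (at z) v)"
    "continuous_on UNIV u"
proof -
  have "Ck (Suc 0) u" "Ck 0 u" using u by (auto simp: test_function_def simp del: Ck.simps)
  then show "(u has_derivative frechet_derivative u (at z)) (at z)" "continuous_on UNIV (\<lambda>z. frechet_derivative u (at z) v)"
    "continuous_on UNIV u" by (auto simp: frechet_derivative_works)
qed

lemma stretch_linear: "stretch k n z = Re z *\<^sub>R stretch k n 1 + Im z *\<^sub>R stretch k n \<i>"
  by (simp add: stretch_def complex_eq_iff)

lemma stretch_has_derivative: "(stretch k n has_derivative stretch k n) (at z within S)"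
proof -
  have "bounded_linear (\<lambda>z. Re z *\<^sub>R stretch k n 1 + Im z *\<^sub>R stretch k n \<i>)"
    by (intro bounded_linear_add bounded_linear_scaleR_left[THEN bounded_linear_compose] bounded_linear_Re bounded_linear_Im)
  then have "bounded_linear (stretch k n)" by (simp only: stretch_linear[symmetric])
  then show ?thesis by (rule bounded_linear_imp_has_derivative)
qed

lemma continuous_on_stretch: "continuous_on S (stretch k n)"
  by (rule has_derivative_continuous_on[OF stretch_has_derivative])

lemma stretch_weak_derivative:
  assumes u: "test_function \<Omega> u"
  shows "(LINT z|lborel. frechet_derivative u (at z) v *\<^sub>R stretch k n z) = - (LINT z|lborel. u z *\<^sub>R stretch k n v)"
    and "integrable lborel (\<lambda>z. frechet_derivative u (at z) v *\<^sub>R stretch k n z)"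
proof -
  define S where "S = closure {z. u z \<noteq> 0}"
  have S: "compact S" using u by (simp add: S_def test_function_def)
  have "test_function S u" using u by (auto simp: S_def test_function_def)
  note 0 = test_function_outside[OF this]
  note D = test_function_derivative[OF u]
  have "((\<lambda>z. u z *\<^sub>R stretch k n z) has_derivative (\<lambda>h. u z *\<^sub>R stretch k n h + frechet_derivative u (at z) h *\<^sub>R stretch k n z)) (at z)" for z
    by (rule has_derivative_scaleR[OF D(1) stretch_has_derivative])
  then have "(LINT z|lborel. u z *\<^sub>R stretch k n v + frechet_derivative u (at z) v *\<^sub>R stretch k n z) = 0"
    by (rule integral_directional_derivative_eq_0[where S=S])
      (use 0 S in \<open>auto intro!: continuous_intros D continuous_on_stretch\<close>)
  moreover have i: "integrable lborel (\<lambda>z. u z *\<^sub>R stretch k n v)"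
    by (rule integrable_continuous_vanishing[where S=S]) (use 0 S in \<open>auto intro!: continuous_intros D\<close>)
  moreover show i2: "integrable lborel (\<lambda>z. frechet_derivative u (at z) v *\<^sub>R stretch k n z)"
    by (rule integrable_continuous_vanishing[where S=S]) (use 0 S in \<open>auto intro!: continuous_intros D continuous_on_stretch\<close>)
  ultimately show "(LINT z|lborel. frechet_derivative u (at z) v *\<^sub>R stretch k n z) = - (LINT z|lborel. u z *\<^sub>R stretch k n v)"
    by (simp add: add_eq_0_iff)
qed

text \<open>A map with weak partial derivatives and the boundary values of the stretch differs from the
stretch by a member of \<open>W\<^sub>0\<^sup>1\<^sup>,\<^sup>1\<close>, whose partial derivatives are the differences.\<close>

lemma W10_of_boundary_values:
  assumes l: "0 < l" and f: "continuous_on (Q1 l) f" and bd: "\<And>z. z \<in> frontier (Q1 l) \<Longrightarrow> f z = stretch k n z"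
    and p1: "has_weak_partial (interior (Q1 l)) f 1 p1" and p2: "has_weak_partial (interior (Q1 l)) f \<i> p2"
  obtains G1 G2 where "W10_on_box (Complex l 1) (\<lambda>z. if z \<in> Q1 l then f z - stretch k n z else 0) G1 G2"
    "AE z in lborel. z \<in> interior (Q1 l) \<longrightarrow> p1 z = G1 z + stretch k n 1"
    "AE z in lborel. z \<in> interior (Q1 l) \<longrightarrow> p2 z = G2 z + stretch k n \<i>"
proof -
  let ?\<Omega> = "interior (Q1 l)"
  define g where "g = (\<lambda>z. if z \<in> Q1 l then f z - stretch k n z else 0)"
  have cQ: "compact (Q1 l)" by (simp add: Q1_eq_cbox)
  then have clQ: "closed (Q1 l)" by (rule compact_imp_closed)
  have \<Omega>b[measurable]: "?\<Omega> \<in> sets borel" by simp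
  have \<Omega>eq: "?\<Omega> = box 0 (Complex l 1)" by (rule interior_Q1)
  have fin: "emeasure lborel ?\<Omega> < \<infinity>" unfolding \<Omega>eq by (rule emeasure_lborel_box_finite)
  have gc: "continuous_on UNIV g"
  proof -
    have "continuous_on (Q1 l \<union> closure (- Q1 l)) (\<lambda>z. if z \<in> Q1 l then f z - stretch k n z else 0)"
    proof (rule continuous_on_cases[OF clQ closed_closure])
      show "continuous_on (Q1 l) (\<lambda>z. f z - stretch k n z)" by (intro continuous_intros f continuous_on_stretch)
      have "f z - stretch k n z = 0" if "z \<in> Q1 l" "z \<in> closure (- Q1 l)" for z
        using bd[of z] that clQ by (simp add: frontier_closures)
      then show "\<forall>z. z \<in> Q1 l \<and> z \<notin> Q1 l \<or> z \<in> closure (- Q1 l) \<and> z \<in> Q1 l \<longrightarrow> f z - stretch k n z = 0" by auto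
    qed auto
    moreover have "Q1 l \<union> closure (- Q1 l) = UNIV" using closure_subset[of "- Q1 l"] by auto
    ultimately show ?thesis by (simp add: g_def)
  qed
  have g0: "g z = 0" if "z \<notin> ?\<Omega>" for z
    using that bd[of z] clQ by (auto simp: g_def frontier_def)
  have gf: "f z = g z + stretch k n z" if "z \<in> ?\<Omega>" for z
    using that interior_subset by (auto simp: g_def)
  have partial: "\<exists>G. integrable lborel G \<and> (\<forall>z. z \<notin> ?\<Omega> \<longrightarrow> G z = 0) \<and>
      (AE z in lborel. z \<in> ?\<Omega> \<longrightarrow> p z = G z + stretch k n v) \<and>
      (\<forall>u. test_function ?\<Omega> u \<longrightarrow>
        (LINT z|lborel. frechet_derivative u (at z) v *\<^sub>R g z) = - (LINT z|lborel. u z *\<^sub>R G z))"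
    if p: "has_weak_partial ?\<Omega> f v p" for v p
  proof -
    have pint: "integrable (lebesgue_on ?\<Omega>) p" and fint: "integrable (lebesgue_on ?\<Omega>) f"
      using p by (auto simp: has_weak_partial_def)
    obtain P where P: "integrable lborel P" "\<And>z. z \<notin> ?\<Omega> \<Longrightarrow> P z = 0" "AE z in lborel. z \<in> ?\<Omega> \<longrightarrow> p z = P z"
      using borel_representative[OF \<Omega>b pint] by blast
    define G where "G = (\<lambda>z. P z - indicator ?\<Omega> z *\<^sub>R stretch k n v)"
    have Gi: "integrable lborel G"
      unfolding G_def using P(1) fin by (intro Bochner_Integration.integrable_diff integrable_scaleR_left) auto
    have "(LINT z|lborel. frechet_derivative u (at z) v *\<^sub>R g z) = - (LINT z|lborel. u z *\<^sub>R G z)"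
      if u: "test_function ?\<Omega> u" for u
    proof -
      note D = test_function_derivative[OF u] and out = test_function_outside[OF u]
      have [measurable]: "(\<lambda>z. frechet_derivative u (at z) v) \<in> borel_measurable borel" "u \<in> borel_measurable borel"
        "g \<in> borel_measurable borel" "stretch k n \<in> borel_measurable borel" "P \<in> borel_measurable borel"
        using D(2,3) gc continuous_on_stretch[of UNIV k n] P(1) by (auto intro: borel_measurable_continuous_onI)
      have restr: "h \<in> borel_measurable (lebesgue_on ?\<Omega>)" if "h \<in> borel_measurable borel" for h :: "complex \<Rightarrow> real"
        using that by (intro measurable_restrict_space1 measurable_completion) simp
      have [measurable]: "f \<in> borel_measurable (lebesgue_on ?\<Omega>)" "p \<in> borel_measurable (lebesgue_on ?\<Omega>)"
        "u \<in> borel_measurable (lebesgue_on ?\<Omega>)" "(\<lambda>z. frechet_derivative u (at z) v) \<in> borel_measurable (lebesgue_on ?\<Omega>)"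
        using fint pint by (auto intro: restr)
      have gi: "integrable lborel (\<lambda>z. frechet_derivative u (at z) v *\<^sub>R g z)"
        by (rule integrable_continuous_vanishing[OF _ cQ])
          (intro continuous_intros D gc, simp add: g_def)
      have "(LINT z|lebesgue_on ?\<Omega>. frechet_derivative u (at z) v *\<^sub>R f z)
         = (LINT z|lborel. frechet_derivative u (at z) v *\<^sub>R g z + frechet_derivative u (at z) v *\<^sub>R stretch k n z)"
        by (rule LINT_lebesgue_on_eq_lborel(1)[OF \<Omega>b]) (auto simp: out gf scaleR_add_right)
      also have "\<dots> = (LINT z|lborel. frechet_derivative u (at z) v *\<^sub>R g z) - (LINT z|lborel. u z *\<^sub>R stretch k n v)"
        using stretch_weak_derivative[OF u, of v k n] gi by simp
      finally have 1: "(LINT z|lborel. frechet_derivative u (at z) v *\<^sub>R g z) =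
        (LINT z|lebesgue_on ?\<Omega>. frechet_derivative u (at z) v *\<^sub>R f z) + (LINT z|lborel. u z *\<^sub>R stretch k n v)"
        by simp
      have "(LINT z|lebesgue_on ?\<Omega>. u z *\<^sub>R p z) = (LINT z|lborel. u z *\<^sub>R P z)"
        by (rule LINT_lebesgue_on_eq_lborel(1)[OF \<Omega>b])
          (use P(3) in \<open>auto simp: out elim!: eventually_mono\<close>)
      also have "\<dots> = (LINT z|lborel. u z *\<^sub>R G z + u z *\<^sub>R stretch k n v)"
        by (rule Bochner_Integration.integral_cong) (auto simp: G_def out scaleR_diff_right split: split_indicator)
      also have "\<dots> = (LINT z|lborel. u z *\<^sub>R G z) + (LINT z|lborel. u z *\<^sub>R stretch k n v)"
      proof (rule Bochner_Integration.integral_add)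
        show s: "integrable lborel (\<lambda>z. u z *\<^sub>R stretch k n v)"
          by (rule integrable_continuous_vanishing[OF _ cQ])
            (use interior_subset in \<open>auto intro!: continuous_intros D out\<close>)
        have "bounded (u ` Q1 l)" by (intro compact_imp_bounded compact_continuous_image cQ continuous_on_subset[OF D(3)]) auto
        then obtain B where B: "0 < B" "\<And>z. z \<in> Q1 l \<Longrightarrow> \<bar>u z\<bar> \<le> B" by (auto simp: bounded_pos)
        have "\<bar>u z\<bar> \<le> B" for z using B out(1)[of z] interior_subset by (cases "z \<in> ?\<Omega>") auto
        then have uB: "norm (u z *\<^sub>R G z) \<le> norm (B *\<^sub>R G z)" for z
          using B(1) by (auto intro!: mult_right_mono)
        show "integrable lborel (\<lambda>z. u z *\<^sub>R G z)"
        proof (rule Bochner_Integration.integrable_bound)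
          show "integrable lborel (\<lambda>z. B *\<^sub>R G z)" using Gi by (rule integrable_scaleR_right)
          have "G \<in> borel_measurable borel" using Gi by auto
          then show "(\<lambda>z. u z *\<^sub>R G z) \<in> borel_measurable lborel" by simp
        qed (rule AE_I2, rule uB)
      qed
      finally show ?thesis using 1 p u by (simp add: has_weak_partial_def)
    qed
    moreover have "AE z in lborel. z \<in> ?\<Omega> \<longrightarrow> p z = G z + stretch k n v"
      using P(3) by eventually_elim (auto simp: G_def)
    moreover have "G z = 0" if "z \<notin> ?\<Omega>" for z using that P(2) by (simp add: G_def)
    ultimately show ?thesis using Gi by (intro exI[of _ G]) auto
  qed
  obtain G1 where G1: "integrable lborel G1" "\<forall>z. z \<notin> ?\<Omega> \<longrightarrow> G1 z = 0"
      "AE z in lborel. z \<in> ?\<Omega> \<longrightarrow> p1 z = G1 z + stretch k n 1"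
      "\<forall>u. test_function ?\<Omega> u \<longrightarrow>
        (LINT z|lborel. frechet_derivative u (at z) 1 *\<^sub>R g z) = - (LINT z|lborel. u z *\<^sub>R G1 z)"
    using partial[OF p1] by blast
  obtain G2 where G2: "integrable lborel G2" "\<forall>z. z \<notin> ?\<Omega> \<longrightarrow> G2 z = 0"
      "AE z in lborel. z \<in> ?\<Omega> \<longrightarrow> p2 z = G2 z + stretch k n \<i>"
      "\<forall>u. test_function ?\<Omega> u \<longrightarrow>
        (LINT z|lborel. frechet_derivative u (at z) \<i> *\<^sub>R g z) = - (LINT z|lborel. u z *\<^sub>R G2 z)"
    using partial[OF p2] by blast
  have "W10_on_box (Complex l 1) g G1 G2"
    unfolding W10_on_box_def \<Omega>eq[symmetric] using l gc g0 G1 G2 by simp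
  then show ?thesis unfolding g_def by (rule that[OF _ G1(3) G2(3)])
qed

text \<open>On each good set \<open>f\<close> is injective and differentiable, so that the integral of its Jacobian is
the area of an image, which lies in the parallelogram of area \<open>k l\<close>. The good sets exhaust the
rectangle up to a null set.\<close>

lemma jacobian_integral_le_area:
  assumes k: "0 < k" and l: "0 < l" and f: "continuous_on (Q1 l) f" "inj_on f (Q1 l)"
    and bd: "\<And>z. z \<in> frontier (Q1 l) \<Longrightarrow> f z = stretch k n z"
    and W: "W10_on_box (Complex l 1) (\<lambda>z. if z \<in> Q1 l then f z - stretch k n z else 0) G1 G2"
  defines "a \<equiv> \<lambda>z. G1 z + stretch k n 1" and "b \<equiv> \<lambda>z. G2 z + stretch k n \<i>"
  shows "(\<integral>\<^sup>+z. ennreal \<bar>Im (cnj (a z) * b z)\<bar> * indicator (interior (Q1 l)) z \<partial>lborel) \<le> ennreal (k * l)"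
proof -
  let ?\<Omega> = "interior (Q1 l)"
  define g where "g = (\<lambda>z. if z \<in> Q1 l then f z - stretch k n z else 0)"
  have [measurable]: "G1 \<in> borel_measurable borel" "G2 \<in> borel_measurable borel"
    using W by (auto simp: W10_on_box_def)
  have [measurable]: "a \<in> borel_measurable borel" "b \<in> borel_measurable borel" unfolding a_def b_def by auto
  have jm[measurable]: "(\<lambda>z. ennreal \<bar>Im (cnj (a z) * b z)\<bar>) \<in> borel_measurable borel"
    by (simp add: borel_measurable_complex_iff[THEN iffD1])
  have cQ: "compact (Q1 l)" "convex (Q1 l)" by (simp_all add: Q1_eq_cbox)
  obtain h P1 P2 :: "nat \<Rightarrow> complex \<Rightarrow> complex" where
    d: "\<And>j z. (h j has_derivative (\<lambda>v. Re v *\<^sub>R P1 j z + Im v *\<^sub>R P2 j z)) (at z)"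
    and P: "\<And>j. continuous_on UNIV (P1 j)" "\<And>j. continuous_on UNIV (P2 j)"
    and lim: "\<And>z. (\<lambda>j. h j z) \<longlonglongrightarrow> g z"
    and L: "(\<lambda>j. \<integral>\<^sup>+z. norm (P1 j z - G1 z) \<partial>lborel) \<longlonglongrightarrow> 0" "(\<lambda>j. \<integral>\<^sup>+z. norm (P2 j z - G2 z) \<partial>lborel) \<longlonglongrightarrow> 0"
    by (rule C1_approximation_of_W10[OF W[folded g_def]]) blast
  obtain E :: "nat \<Rightarrow> complex set" where E: "\<And>m. E m \<in> sets borel" "incseq E" "AE z in lborel. z \<in> (\<Union>m. E m)"
    and Ed: "\<And>m z. z \<in> E m \<Longrightarrow> (g has_derivative (\<lambda>v. Re v *\<^sub>R G1 z + Im v *\<^sub>R G2 z)) (at z within E m)"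
    by (rule exhaustion_by_sets_of_differentiability[OF d P lim _ _ L]) (measurable, blast)
  define S where "S = (\<lambda>m. E m \<inter> ?\<Omega>)"
  have Sb[measurable]: "S m \<in> sets borel" for m using E(1) by (auto simp: S_def)
  have SQ: "S m \<subseteq> Q1 l" for m using interior_subset by (auto simp: S_def)
  have bl: "compact (stretch k n ` Q1 l)" "convex (stretch k n ` Q1 l)"
  proof -
    show "compact (stretch k n ` Q1 l)" by (intro compact_continuous_image continuous_on_stretch cQ)
    have "linear (stretch k n)" using has_derivative_linear[OF stretch_has_derivative] .
    then show "convex (stretch k n ` Q1 l)" by (rule convex_linear_image[OF _ cQ(2)])
  qed
  have img: "f ` Q1 l \<subseteq> stretch k n ` Q1 l"
  proof (rule injective_image_subset_of_convex[OF _ cQ(1) f bl])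
    show "f ` frontier (Q1 l) \<subseteq> stretch k n ` Q1 l"
      using bd compact_imp_closed[OF cQ(1)] by (auto simp: frontier_def)
  qed simp
  have stretch_area: "ennreal (measure lebesgue (to_vec2 ` stretch k n ` Q1 l)) = ennreal (k * l)"
    and stretch_lm: "to_vec2 ` stretch k n ` Q1 l \<in> lmeasurable"
  proof -
    have d: "(stretch k n has_derivative (\<lambda>v. Re v *\<^sub>R stretch k n 1 + Im v *\<^sub>R stretch k n \<i>)) (at z within Q1 l)" for z
      using stretch_has_derivative by (simp add: stretch_linear[symmetric])
    have inj: "inj_on (stretch k n) (Q1 l)" using k by (auto simp: inj_on_def stretch_def complex_eq_iff)
    have Qb: "Q1 l \<in> sets borel" by (simp add: Q1_eq_cbox)
    note A = area_formula_within[OF Qb d borel_measurable_const borel_measurable_const inj compact_imp_bounded[OF bl(1)]]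
    show "to_vec2 ` stretch k n ` Q1 l \<in> lmeasurable" by (rule A(2))
    have "ennreal (measure lebesgue (to_vec2 ` stretch k n ` Q1 l)) = (\<integral>\<^sup>+z. ennreal \<bar>Im (cnj (stretch k n 1) * stretch k n \<i>)\<bar> * indicator (Q1 l) z \<partial>lborel)"
      by (rule A(1)[symmetric])
    also have "\<dots> = ennreal k * emeasure lborel (Q1 l)"
      using k Qb by (simp add: nn_integral_cmult_indicator stretch_def)
    also have "emeasure lborel (Q1 l) = ennreal l"
    proof -
      have "emeasure lborel (Q1 l) = ennreal (measure lborel (Q1 l))"
        unfolding Q1_eq_cbox using emeasure_lborel_cbox_finite
        by (intro emeasure_eq_ennreal_measure) (auto simp: less_top)
      then show ?thesis using l by (simp add: Q1_eq_cbox measure_cbox_complex)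
    qed
    finally show "ennreal (measure lebesgue (to_vec2 ` stretch k n ` Q1 l)) = ennreal (k * l)"
      using k l by (simp add: ennreal_mult)
  qed
  have le: "(\<integral>\<^sup>+z. ennreal \<bar>Im (cnj (a z) * b z)\<bar> * indicator (S m) z \<partial>lborel) \<le> ennreal (k * l)" for m
  proof -
    have der: "(f has_derivative (\<lambda>v. Re v *\<^sub>R a z + Im v *\<^sub>R b z)) (at z within S m)" if z: "z \<in> S m" for z
    proof -
      have "(g has_derivative (\<lambda>v. Re v *\<^sub>R G1 z + Im v *\<^sub>R G2 z)) (at z within S m)"
        using z by (intro has_derivative_subset[OF Ed]) (auto simp: S_def)
      from has_derivative_add[OF this stretch_has_derivative]
      have "((\<lambda>z. g z + stretch k n z) has_derivative (\<lambda>v. (Re v *\<^sub>R G1 z + Im v *\<^sub>R G2 z) + stretch k n v)) (at z within S m)" .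
      moreover have "(Re v *\<^sub>R G1 z + Im v *\<^sub>R G2 z) + stretch k n v = Re v *\<^sub>R a z + Im v *\<^sub>R b z" for v
        by (subst stretch_linear[of k n v]) (simp add: a_def b_def scaleR_add_right)
      ultimately have "((\<lambda>z. g z + stretch k n z) has_derivative (\<lambda>v. Re v *\<^sub>R a z + Im v *\<^sub>R b z)) (at z within S m)" by simp
      then show ?thesis
        by (rule has_derivative_transform[OF z, rotated]) (use SQ in \<open>auto simp: g_def\<close>)
    qed
    have inj: "inj_on f (S m)" using f(2) SQ by (rule inj_on_subset)
    have sub: "f ` S m \<subseteq> stretch k n ` Q1 l" using img SQ by blast
    have bdd: "bounded (f ` S m)" using compact_imp_bounded[OF bl(1)] sub by (rule bounded_subset)
    have ab: "a \<in> borel_measurable borel" "b \<in> borel_measurable borel" by measurable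
    have A: "(\<integral>\<^sup>+z. ennreal \<bar>Im (cnj (a z) * b z)\<bar> * indicator (S m) z \<partial>lborel) = ennreal (measure lebesgue (to_vec2 ` f ` S m))"
      "to_vec2 ` f ` S m \<in> lmeasurable"
      by (rule area_formula_within[OF Sb _ ab inj bdd]; erule der)+
    have "measure lebesgue (to_vec2 ` f ` S m) \<le> measure lebesgue (to_vec2 ` stretch k n ` Q1 l)"
      by (rule measure_mono_fmeasurable[OF _ _ stretch_lm]) (use sub A(2) in \<open>auto simp: fmeasurableD\<close>)
    then have "ennreal (measure lebesgue (to_vec2 ` f ` S m)) \<le> ennreal (k * l)"
      unfolding stretch_area[symmetric] by (rule ennreal_leI)
    then show ?thesis by (rule ord_eq_le_trans[OF A(1)])
  qed
  define \<nu> where "\<nu> = density lborel (\<lambda>z. ennreal \<bar>Im (cnj (a z) * b z)\<bar>)"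
  have \<nu>: "emeasure \<nu> A = (\<integral>\<^sup>+z. ennreal \<bar>Im (cnj (a z) * b z)\<bar> * indicator A z \<partial>lborel)" if "A \<in> sets borel" for A
    unfolding \<nu>_def using that by (intro emeasure_density) auto
  have "(\<integral>\<^sup>+z. ennreal \<bar>Im (cnj (a z) * b z)\<bar> * indicator ?\<Omega> z \<partial>lborel) =
      (\<integral>\<^sup>+z. ennreal \<bar>Im (cnj (a z) * b z)\<bar> * indicator (\<Union>m. S m) z \<partial>lborel)"
    by (rule nn_integral_cong_AE) (use E(3) in \<open>eventually_elim, auto simp: S_def split: split_indicator\<close>)
  also have "\<dots> = emeasure \<nu> (\<Union>m. S m)" by (rule \<nu>[symmetric]) auto
  also have "\<dots> = (SUP m. emeasure \<nu> (S m))"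
    by (rule SUP_emeasure_incseq[symmetric]) (use E(1,2) in \<open>auto simp: \<nu>_def S_def incseq_def\<close>)
  also have "\<dots> \<le> ennreal (k * l)" by (rule SUP_least) (simp only: \<nu>[OF Sb] le)
  finally show ?thesis .
qed

section \<open>Strictly convex energies\<close>

lemma strictly_convex_on_imp_convex_on:
  assumes "strictly_convex_on S \<phi>" shows "convex_on S \<phi>"
proof (rule convex_onI)
  show "convex S" using assms by (simp add: strictly_convex_on_def)
  fix t x y :: real assume t: "0 < t" "t < 1" "x \<in> S" "y \<in> S"
  show "\<phi> ((1 - t) *\<^sub>R x + t *\<^sub>R y) \<le> (1 - t) * \<phi> x + t * \<phi> y"
  proof (cases "x = y")
    case False
    with t assms show ?thesis by (auto simp: strictly_convex_on_def intro: less_imp_le)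
  qed (simp add: algebra_simps)
qed

lemma subgradient_exists:
  assumes \<phi>: "convex_on {1..} \<phi>" "mono_on {1..} \<phi>" and \<kappa>: "1 \<le> \<kappa>"
  obtains p :: real where "0 \<le> p" "\<And>t. 1 \<le> t \<Longrightarrow> \<phi> \<kappa> + p * (t - \<kappa>) \<le> \<phi> t"
proof (cases "\<kappa> = 1")
  case True
  show ?thesis by (rule that[of 0]) (use \<phi>(2) True in \<open>auto simp: mono_on_def\<close>)
next
  case False
  then have \<kappa>1: "1 < \<kappa>" using \<kappa> by simp
  define p where "p = Inf ((\<lambda>t. (\<phi> \<kappa> - \<phi> t) / (\<kappa> - t)) ` ({\<kappa><..} \<inter> {1..}))"
  have "\<kappa> \<in> interior {1..}" using \<kappa>1 by (simp add: interior_Ici)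
  then have sub: "\<phi> \<kappa> + p * (t - \<kappa>) \<le> \<phi> t" if "1 \<le> t" for t
    using convex_le_Inf_differential[OF \<phi>(1), of \<kappa> t] that by (simp add: p_def)
  have "\<phi> 1 \<le> \<phi> \<kappa>" using \<phi>(2) \<kappa> by (auto simp: mono_on_def)
  with sub[of 1] have "p * (1 - \<kappa>) \<le> 0" by simp
  then have "0 \<le> p" using \<kappa>1 by (simp add: mult_le_0_iff)
  then show ?thesis using sub by (rule that)
qed

text \<open>The excess \<open>\<omega>\<close> over the tangent is convex, vanishes at \<open>\<kappa>\<close> and is positive elsewhere. Along each
ray from \<open>\<kappa>\<close> it therefore grows at least linearly from distance \<open>\<eta>\<close> on, while within distance \<open>\<eta>\<close>
the additional term on the left is not positive.\<close>

lemma strictly_convex_above_tangent: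
  assumes \<phi>: "strictly_convex_on {1..} \<phi>" "mono_on {1..} \<phi>" and \<kappa>: "1 \<le> \<kappa>"
  obtains p :: real where "0 \<le> p"
    "\<And>\<eta>. 0 < \<eta> \<Longrightarrow> \<exists>c>0. \<forall>t\<ge>1. \<phi> \<kappa> + p * (t - \<kappa>) + c * (\<bar>t - \<kappa>\<bar> - \<eta>) \<le> \<phi> t"
proof -
  have cv: "convex_on {1..} \<phi>" by (rule strictly_convex_on_imp_convex_on[OF \<phi>(1)])
  obtain p where p: "0 \<le> p" "\<And>t. 1 \<le> t \<Longrightarrow> \<phi> \<kappa> + p * (t - \<kappa>) \<le> \<phi> t"
    using subgradient_exists[OF cv \<phi>(2) \<kappa>] by blast
  define \<omega> where "\<omega> = (\<lambda>t. \<phi> t - \<phi> \<kappa> - p * (t - \<kappa>))"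
  have \<omega>nn: "0 \<le> \<omega> t" if "1 \<le> t" for t using p(2)[OF that] by (simp add: \<omega>_def)
  have \<omega>pos: "0 < \<omega> t" if "1 \<le> t" "t \<noteq> \<kappa>" for t
  proof -
    have "\<phi> ((1 - 1/2) * t + 1/2 * \<kappa>) < (1 - 1/2) * \<phi> t + 1/2 * \<phi> \<kappa>"
    proof -
      have "\<forall>x\<in>{1..}. \<forall>y\<in>{1..}. \<forall>r. x \<noteq> y \<and> 0 < r \<and> r < 1 \<longrightarrow> \<phi> ((1 - r) * x + r * y) < (1 - r) * \<phi> x + r * \<phi> y"
        using \<phi>(1) by (simp add: strictly_convex_on_def)
      from this[rule_format, of t \<kappa> "1/2"] show ?thesis using that \<kappa> by simp
    qed
    moreover have "\<phi> \<kappa> + p * (((1 - 1/2) * t + 1/2 * \<kappa>) - \<kappa>) \<le> \<phi> ((1 - 1/2) * t + 1/2 * \<kappa>)"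
      using that \<kappa> by (intro p(2)) simp
    ultimately show ?thesis by (simp add: \<omega>_def algebra_simps)
  qed
  have chord: "\<omega> (\<kappa> + r * (t - \<kappa>)) \<le> r * \<omega> t" if "1 \<le> t" "0 \<le> r" "r \<le> 1" for r t
  proof -
    have "\<phi> ((1 - r) *\<^sub>R \<kappa> + r *\<^sub>R t) \<le> (1 - r) * \<phi> \<kappa> + r * \<phi> t"
      using that \<kappa> by (intro convex_onD[OF cv]) auto
    then show ?thesis by (simp add: \<omega>_def algebra_simps)
  qed
  show ?thesis
  proof (rule that[OF p(1)])
    fix \<eta> :: real assume \<eta>: "0 < \<eta>"
    define m where "m = (if 1 \<le> \<kappa> - \<eta> then min (\<omega> (\<kappa> + \<eta>)) (\<omega> (\<kappa> - \<eta>)) else \<omega> (\<kappa> + \<eta>))"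
    have m: "0 < m" using \<omega>pos[of "\<kappa> + \<eta>"] \<omega>pos[of "\<kappa> - \<eta>"] \<eta> \<kappa> by (auto simp: m_def)
    define c where "c = m / \<eta>"
    have c: "0 < c" using m \<eta> by (simp add: c_def)
    have "c * (\<bar>t - \<kappa>\<bar> - \<eta>) \<le> \<omega> t" if t: "1 \<le> t" for t
    proof (cases "\<bar>t - \<kappa>\<bar> \<le> \<eta>")
      case True
      then have "c * (\<bar>t - \<kappa>\<bar> - \<eta>) \<le> 0" using c by (simp add: mult_nonneg_nonpos)
      then show ?thesis using \<omega>nn[OF t] by simp
    next
      case False
      define r where "r = \<eta> / \<bar>t - \<kappa>\<bar>"
      have r: "0 < r" "r \<le> 1" "r * \<bar>t - \<kappa>\<bar> = \<eta>" using False \<eta> by (auto simp: r_def)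
      have "m \<le> \<omega> (\<kappa> + r * (t - \<kappa>))"
      proof (cases "\<kappa> \<le> t")
        case True
        then have "\<kappa> + r * (t - \<kappa>) = \<kappa> + \<eta>" using r(3) by simp
        then show ?thesis by (simp add: m_def)
      next
        case False2: False
        then have e: "\<kappa> + r * (t - \<kappa>) = \<kappa> - \<eta>" using r(3) by (simp add: algebra_simps)
        have "1 \<le> \<kappa> - \<eta>" using False False2 t by simp
        then show ?thesis unfolding e by (simp add: m_def)
      qed
      also have "\<dots> \<le> r * \<omega> t" using r t by (intro chord) auto
      finally have "m * \<bar>t - \<kappa>\<bar> \<le> (r * \<bar>t - \<kappa>\<bar>) * \<omega> t"
        by (metis abs_ge_zero mult.assoc mult.commute mult_right_mono)
      then have "m * \<bar>t - \<kappa>\<bar> \<le> \<eta> * \<omega> t" using r(3) by simp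
      then have "c * \<bar>t - \<kappa>\<bar> \<le> \<omega> t" using \<eta> by (simp add: c_def field_simps)
      moreover have "0 \<le> c * \<eta>" using c \<eta> by simp
      ultimately show ?thesis by (simp add: algebra_simps)
    qed
    then show "\<exists>c>0. \<forall>t\<ge>1. \<phi> \<kappa> + p * (t - \<kappa>) + c * (\<bar>t - \<kappa>\<bar> - \<eta>) \<le> \<phi> t"
      using c by (intro exI[of _ c]) (auto simp: \<omega>_def algebra_simps)
  qed
qed

text \<open>The pointwise lower bound for \<open>\<phi>\<close> is integrated. It grows linearly with positive slope, so that
finiteness of the energy already forces \<open>K\<close> to be integrable.\<close>

lemma convex_energy_controls_L1:
  fixes M :: "'a measure" and K :: "'a \<Rightarrow> real"
  assumes M: "finite_measure M" and K[measurable]: "K \<in> borel_measurable M" "\<And>z. 1 \<le> K z"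
    and p: "0 \<le> p" and c: "0 < c" and \<eta>: "0 < \<eta>" and A: "0 \<le> A"
    and tangent: "\<And>t. 1 \<le> t \<Longrightarrow> A + p * (t - \<kappa>) + c * (\<bar>t - \<kappa>\<bar> - \<eta>) \<le> \<phi> t"
    and \<phi>nn: "\<And>t. 1 \<le> t \<Longrightarrow> 0 \<le> \<phi> t"
    and E: "(\<integral>\<^sup>+z. ennreal (\<phi> (K z)) \<partial>M) \<le> ennreal E" "0 \<le> E"
  shows "integrable M K"
    and "A * measure M (space M) + p * ((LINT z|M. K z) - \<kappa> * measure M (space M))
      + c * ((LINT z|M. \<bar>K z - \<kappa>\<bar>) - \<eta> * measure M (space M)) \<le> E"
proof -
  interpret finite_measure M by (rule M)
  have pt: "ennreal (c * (K z - \<kappa> - \<eta>)) \<le> ennreal (\<phi> (K z))" for z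
  proof (cases "\<kappa> \<le> K z")
    case True
    then have "0 \<le> p * (K z - \<kappa>)" using p by simp
    then show ?thesis using tangent[OF K(2)[of z]] A True by (intro ennreal_leI) (simp add: algebra_simps)
  next
    case False
    then have "c * (K z - \<kappa> - \<eta>) \<le> 0" using c \<eta> by (intro mult_nonneg_nonpos) auto
    then show ?thesis by (simp add: ennreal_neg)
  qed
  have i: "integrable M (\<lambda>z. max 0 (c * (K z - \<kappa> - \<eta>)))"
  proof (rule integrableI_nonneg)
    have "(\<integral>\<^sup>+z. ennreal (max 0 (c * (K z - \<kappa> - \<eta>))) \<partial>M) \<le> (\<integral>\<^sup>+z. ennreal (\<phi> (K z)) \<partial>M)"
      using pt by (intro nn_integral_mono) (simp add: ennreal_max_0 max_def ennreal_neg)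
    also have "\<dots> < \<infinity>" using E(1) by (simp add: order_le_less_trans)
    finally show "(\<integral>\<^sup>+z. ennreal (max 0 (c * (K z - \<kappa> - \<eta>))) \<partial>M) < \<infinity>" .
  qed auto
  show iK: "integrable M K"
  proof (rule Bochner_Integration.integrable_bound)
    show "integrable M (\<lambda>z. \<bar>\<kappa> + \<eta>\<bar> + max 0 (c * (K z - \<kappa> - \<eta>)) / c)" using i by auto
    show "AE z in M. norm (K z) \<le> norm (\<bar>\<kappa> + \<eta>\<bar> + max 0 (c * (K z - \<kappa> - \<eta>)) / c)"
    proof (intro AE_I2)
      fix z
      have "K z - \<kappa> - \<eta> \<le> max 0 (c * (K z - \<kappa> - \<eta>)) / c" using c by (simp add: pos_le_divide_eq mult.commute)
      then show "norm (K z) \<le> norm (\<bar>\<kappa> + \<eta>\<bar> + max 0 (c * (K z - \<kappa> - \<eta>)) / c)"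
        using K(2)[of z] by simp
    qed
  qed auto
  let ?\<psi> = "\<lambda>z. A + p * (K z - \<kappa>) + c * (\<bar>K z - \<kappa>\<bar> - \<eta>)"
  have i\<psi>: "integrable M ?\<psi>" using iK by auto
  have "A * measure M (space M) + p * ((LINT z|M. K z) - \<kappa> * measure M (space M))
      + c * ((LINT z|M. \<bar>K z - \<kappa>\<bar>) - \<eta> * measure M (space M)) = (LINT z|M. ?\<psi> z)"
    using iK by (simp add: mult.commute)
  also have "\<dots> \<le> (LINT z|M. max 0 (?\<psi> z))" using i\<psi> by (intro integral_mono) auto
  also have "\<dots> \<le> E"
  proof -
    have "ennreal (LINT z|M. max 0 (?\<psi> z)) = (\<integral>\<^sup>+z. ennreal (max 0 (?\<psi> z)) \<partial>M)"
      using i\<psi> by (intro nn_integral_eq_integral[symmetric]) auto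
    also have "\<dots> \<le> (\<integral>\<^sup>+z. ennreal (\<phi> (K z)) \<partial>M)"
      using tangent[OF K(2)] \<phi>nn[OF K(2)] by (intro nn_integral_mono ennreal_leI) simp
    also have "\<dots> \<le> ennreal E" by (rule E(1))
    finally show ?thesis using E(2) by simp
  qed
  finally show "A * measure M (space M) + p * ((LINT z|M. K z) - \<kappa> * measure M (space M))
      + c * ((LINT z|M. \<bar>K z - \<kappa>\<bar>) - \<eta> * measure M (space M)) \<le> E" .
qed

section \<open>Stability of the arithmetic-geometric mean estimate\<close>

lemma abs_le_weighted_am_gm:
  fixes x y z :: real
  assumes "x\<^sup>2 \<le> 4 * y * z" "0 \<le> y" "0 \<le> z" shows "\<bar>x\<bar> \<le> y + z"
proof (rule abs_le_square_iff[THEN iffD2, THEN order_trans])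
  have "4 * y * z \<le> (y + z)\<^sup>2" using zero_le_power2[of "y - z"] by (simp add: power2_eq_square algebra_simps)
  with assms show "x\<^sup>2 \<le> (y + z)\<^sup>2" by simp
qed (use assms in simp)

text \<open>The deviation \<open>D - \<Lambda> w\<close> is split into \<open>D - N w\<close>, whose square is at most \<open>2 N (N - D \<bullet> w)\<close>, into
\<open>N - c K\<close>, whose square equals \<open>K (J + c\<^sup>2 K - 2 c N)\<close>, and into \<open>c (K - \<kappa>)\<close>. The square roots are
replaced by weighted sums with a free parameter \<open>\<theta>\<close>, which makes the bound linear in quantities
with known integrals.\<close>

lemma derivative_deviation_pointwise:
  fixes D w :: complex and N K J \<Lambda> c \<kappa> \<theta> :: real
  assumes w: "norm w = 1" and DN: "norm D \<le> N" and NKJ: "N\<^sup>2 = K * J" and K: "0 \<le> K" and J: "0 \<le> J"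
    and c: "0 < c" "c * \<kappa> = \<Lambda>" and \<theta>: "0 < \<theta>"
  shows "N \<le> (c * K + J / c) / 2"
    and "norm (D - \<Lambda> *\<^sub>R w) \<le> \<theta> * N + (N - D \<bullet> w) / (2 * \<theta>) + (\<theta> * K + (J + c\<^sup>2 * K - 2 * c * N) / (4 * \<theta>)) + c * \<bar>K - \<kappa>\<bar>"
proof -
  have N0: "0 \<le> N" using DN norm_ge_zero order_trans by blast
  have "\<bar>N\<bar> \<le> c * K / 2 + J / c / 2"
    using NKJ K J c by (intro abs_le_weighted_am_gm) (auto simp: power2_eq_square)
  then show am: "N \<le> (c * K + J / c) / 2" using N0 by (simp add: add_divide_distrib)
  have X: "0 \<le> N - D \<bullet> w" using Cauchy_Schwarz_ineq2[of D w] w DN by simp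
  have Y: "0 \<le> J + c\<^sup>2 * K - 2 * c * N"
  proof -
    have "2 * c * N \<le> c * (c * K + J / c)" using am c(1) by simp
    also have "\<dots> = c\<^sup>2 * K + J" using c(1) by (simp add: power2_eq_square algebra_simps)
    finally show ?thesis by simp
  qed
  have 1: "norm (D - N *\<^sub>R w) \<le> \<theta> * N + (N - D \<bullet> w) / (2 * \<theta>)"
  proof -
    have "(norm (D - N *\<^sub>R w))\<^sup>2 = (D - N *\<^sub>R w) \<bullet> (D - N *\<^sub>R w)" by (rule power2_norm_eq_inner)
    also have "\<dots> = D \<bullet> D - 2 * N * (D \<bullet> w) + N * N * (w \<bullet> w)"
      by (simp only: inner_diff_left inner_diff_right inner_scaleR_left inner_scaleR_right inner_commute[of w D])
        (simp add: algebra_simps)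
    also have "\<dots> = (norm D)\<^sup>2 - 2 * N * (D \<bullet> w) + N\<^sup>2"
      unfolding power2_norm_eq_inner[symmetric] w by (simp add: power2_eq_square)
    also have "\<dots> \<le> 2 * N * (N - D \<bullet> w)"
      using power_mono[OF DN norm_ge_zero, of 2] by (simp add: power2_eq_square algebra_simps)
    also have "\<dots> = 4 * (\<theta> * N) * ((N - D \<bullet> w) / (2 * \<theta>))" using \<theta> by simp
    finally have "\<bar>norm (D - N *\<^sub>R w)\<bar> \<le> \<theta> * N + (N - D \<bullet> w) / (2 * \<theta>)"
      using \<theta> N0 X by (intro abs_le_weighted_am_gm) auto
    then show ?thesis by simp
  qed
  have 2: "\<bar>N - c * K\<bar> \<le> \<theta> * K + (J + c\<^sup>2 * K - 2 * c * N) / (4 * \<theta>)"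
  proof (rule abs_le_weighted_am_gm)
    have "(N - c * K)\<^sup>2 = K * (J + c\<^sup>2 * K - 2 * c * N)"
      using NKJ by (simp add: power2_eq_square algebra_simps)
    then show "(N - c * K)\<^sup>2 \<le> 4 * (\<theta> * K) * ((J + c\<^sup>2 * K - 2 * c * N) / (4 * \<theta>))" using \<theta> by simp
  qed (use \<theta> K Y in auto)
  have "N - \<Lambda> = (N - c * K) + c * (K - \<kappa>)" using c(2) by (simp add: algebra_simps)
  then have 3: "\<bar>N - \<Lambda>\<bar> \<le> \<bar>N - c * K\<bar> + c * \<bar>K - \<kappa>\<bar>"
    using c(1) abs_triangle_ineq[of "N - c * K" "c * (K - \<kappa>)"] by (simp add: abs_mult)
  have "D - \<Lambda> *\<^sub>R w = (D - N *\<^sub>R w) + (N - \<Lambda>) *\<^sub>R w" by (simp add: algebra_simps)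
  then have "norm (D - \<Lambda> *\<^sub>R w) \<le> norm (D - N *\<^sub>R w) + norm ((N - \<Lambda>) *\<^sub>R w)"
    by (simp only: norm_triangle_ineq)
  also have "norm ((N - \<Lambda>) *\<^sub>R w) = \<bar>N - \<Lambda>\<bar>" using w by simp
  finally have "norm (D - \<Lambda> *\<^sub>R w) \<le> norm (D - N *\<^sub>R w) + \<bar>N - \<Lambda>\<bar>" .
  with 1 2 3 show "norm (D - \<Lambda> *\<^sub>R w) \<le> \<theta> * N + (N - D \<bullet> w) / (2 * \<theta>) + (\<theta> * K + (J + c\<^sup>2 * K - 2 * c * N) / (4 * \<theta>)) + c * \<bar>K - \<kappa>\<bar>"
    by linarith
qed

text \<open>The deficits \<open>N - D \<bullet> w\<close> and \<open>J + c\<^sup>2 K - 2 c N\<close> are nonnegative and have integrals at most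
\<open>c s / 2\<close> and \<open>c\<^sup>2 s\<close>, because the integral of \<open>D\<close> is prescribed, that of \<open>J\<close> is bounded
above, and that of \<open>K\<close> exceeds its least possible value by at most \<open>s\<close>.\<close>

lemma derivative_deviation_L1:
  fixes M :: "'a measure" and D :: "'a \<Rightarrow> complex" and N K J :: "'a \<Rightarrow> real"
  assumes M: "finite_measure M" and iD: "integrable M D" and iN: "integrable M N" and iK: "integrable M K" and iJ: "integrable M J"
    and ae: "AE z in M. norm (D z) \<le> N z \<and> (N z)\<^sup>2 = K z * J z \<and> 0 \<le> K z \<and> 0 \<le> J z"
    and w: "norm w = 1" and \<Lambda>: "0 < \<Lambda>" and k: "0 < k" and \<kappa>: "\<kappa> * k = \<Lambda>\<^sup>2"
    and intD: "(LINT z|M. D z) = (measure M (space M) * \<Lambda>) *\<^sub>R w" and intJ: "(LINT z|M. J z) \<le> k * measure M (space M)"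
  defines "\<mu> \<equiv> measure M (space M)" and "s \<equiv> (LINT z|M. \<bar>K z - \<kappa>\<bar>)" and "c \<equiv> k / \<Lambda>"
  shows "\<kappa> * \<mu> \<le> (LINT z|M. K z)"
    and "0 < \<theta> \<Longrightarrow> (LINT z|M. norm (D z - \<Lambda> *\<^sub>R w)) \<le>
       \<theta> * (\<Lambda> * \<mu> + c * s / 2) + c * s / (4 * \<theta>) + (\<theta> * (\<kappa> * \<mu> + s) + c\<^sup>2 * s / (4 * \<theta>)) + c * s"
proof -
  interpret finite_measure M by (rule M)
  have c: "0 < c" "c * \<kappa> = \<Lambda>" "k / c = \<Lambda>" "c * \<Lambda> = k"
    using k \<Lambda> \<kappa> by (auto simp: c_def field_simps power2_eq_square)
  have pw: "N z \<le> (c * K z + J z / c) / 2 \<and> (0 < \<theta> \<longrightarrow> norm (D z - \<Lambda> *\<^sub>R w) \<le> \<theta> * N z + (N z - D z \<bullet> w) / (2 * \<theta>) + (\<theta> * K z + (J z + c\<^sup>2 * K z - 2 * c * N z) / (4 * \<theta>)) + c * \<bar>K z - \<kappa>\<bar>)"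
    if "norm (D z) \<le> N z \<and> (N z)\<^sup>2 = K z * J z \<and> 0 \<le> K z \<and> 0 \<le> J z" for z \<theta>
    using that derivative_deviation_pointwise[OF w _ _ _ _ c(1,2), of "D z" "N z" "K z" "J z"]
    by (metis zero_less_one)
  have iDw: "integrable M (\<lambda>z. D z \<bullet> w)" "(LINT z|M. D z \<bullet> w) = \<Lambda> * \<mu>"
  proof -
    show "integrable M (\<lambda>z. D z \<bullet> w)" using iD by auto
    have "(LINT z|M. D z \<bullet> w) = (LINT z|M. D z) \<bullet> w" using iD by auto
    also have "\<dots> = \<Lambda> * \<mu>" using w unfolding intD by (simp add: \<mu>_def dot_square_norm)
    finally show "(LINT z|M. D z \<bullet> w) = \<Lambda> * \<mu>" .
  qed
  have "(LINT z|M. D z \<bullet> w) \<le> (LINT z|M. N z)"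
  proof (rule integral_mono_AE[OF iDw(1) iN])
    show "AE z in M. D z \<bullet> w \<le> N z" using ae
    proof eventually_elim
      case (elim z)
      then have "norm (D z) \<le> N z" by blast
      then show ?case using Cauchy_Schwarz_ineq2[of "D z" w] w by simp
    qed
  qed
  then have N1: "\<Lambda> * \<mu> \<le> (LINT z|M. N z)" using iDw by simp
  have "(LINT z|M. N z) \<le> (LINT z|M. (c * K z + J z / c) / 2)"
  proof (rule integral_mono_AE)
    show "AE z in M. N z \<le> (c * K z + J z / c) / 2" using ae by eventually_elim (use pw in blast)
  qed (use iN iK iJ in auto)
  also have "\<dots> = (c * (LINT z|M. K z) + (LINT z|M. J z) / c) / 2" using iK iJ by simp
  also have "\<dots> \<le> (c * (LINT z|M. K z) + \<Lambda> * \<mu>) / 2"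
  proof -
    have "(LINT z|M. J z) / c \<le> k * \<mu> / c" using intJ c(1) by (intro divide_right_mono) (auto simp: \<mu>_def)
    also have "\<dots> = \<Lambda> * \<mu>" using c(3) by (metis times_divide_eq_left)
    finally show ?thesis by (intro divide_right_mono add_left_mono) simp_all
  qed
  finally have N2: "(LINT z|M. N z) \<le> (c * (LINT z|M. K z) + \<Lambda> * \<mu>) / 2" .
  with N1 have "\<Lambda> * \<mu> \<le> c * (LINT z|M. K z)" by simp
  then have "c * (\<kappa> * \<mu>) \<le> c * (LINT z|M. K z)" using c(2) by (metis mult.assoc)
  then show Kl: "\<kappa> * \<mu> \<le> (LINT z|M. K z)" using c(1) by simp
  have iKk: "integrable M (\<lambda>z. \<bar>K z - \<kappa>\<bar>)" using iK by auto
  have Ks: "(LINT z|M. K z) \<le> \<kappa> * \<mu> + s"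
  proof -
    have "(LINT z|M. K z) \<le> (LINT z|M. \<kappa> + \<bar>K z - \<kappa>\<bar>)" using iK by (intro integral_mono) auto
    also have "\<dots> = \<kappa> * \<mu> + s" using iKk by (simp add: \<mu>_def s_def mult.commute)
    finally show ?thesis .
  qed
  have N3: "(LINT z|M. N z) \<le> \<Lambda> * \<mu> + c * s / 2"
  proof -
    have "c * (LINT z|M. K z) \<le> c * (\<kappa> * \<mu> + s)" using Ks c(1) by simp
    also have "\<dots> = \<Lambda> * \<mu> + c * s" using c(2) by (simp add: algebra_simps)
    finally show ?thesis using N2 by simp
  qed
  assume \<theta>: "0 < \<theta>"
  have "(LINT z|M. norm (D z - \<Lambda> *\<^sub>R w)) \<le> (LINT z|M. \<theta> * N z + (N z - D z \<bullet> w) / (2 * \<theta>) + (\<theta> * K z + (J z + c\<^sup>2 * K z - 2 * c * N z) / (4 * \<theta>)) + c * \<bar>K z - \<kappa>\<bar>)"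
  proof (rule integral_mono_AE)
    show "AE z in M. norm (D z - \<Lambda> *\<^sub>R w) \<le> \<theta> * N z + (N z - D z \<bullet> w) / (2 * \<theta>) + (\<theta> * K z + (J z + c\<^sup>2 * K z - 2 * c * N z) / (4 * \<theta>)) + c * \<bar>K z - \<kappa>\<bar>"
      using ae by eventually_elim (use pw \<theta> in blast)
  qed (use iN iK iJ iD in auto)
  also have "\<dots> = \<theta> * (LINT z|M. N z) + ((LINT z|M. N z) - \<Lambda> * \<mu>) / (2 * \<theta>)
     + (\<theta> * (LINT z|M. K z) + ((LINT z|M. J z) + c\<^sup>2 * (LINT z|M. K z) - 2 * c * (LINT z|M. N z)) / (4 * \<theta>)) + c * s"
    using iN iK iJ iDw iKk by (simp add: s_def)
  also have "\<dots> \<le> \<theta> * (\<Lambda> * \<mu> + c * s / 2) + (c * s / 2) / (2 * \<theta>) + (\<theta> * (\<kappa> * \<mu> + s) + (c\<^sup>2 * s) / (4 * \<theta>)) + c * s"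
  proof -
    have "(LINT z|M. J z) + c\<^sup>2 * (LINT z|M. K z) - 2 * c * (LINT z|M. N z) \<le> k * \<mu> + c\<^sup>2 * (\<kappa> * \<mu> + s) - 2 * c * (\<Lambda> * \<mu>)"
      using intJ Ks N1 c(1) by (intro add_mono diff_mono mult_left_mono) (auto simp: \<mu>_def)
    also have "\<dots> = c\<^sup>2 * s"
    proof -
      have "c\<^sup>2 * \<kappa> = k" using c(2,4) by (simp add: power2_eq_square mult.assoc)
      then have 1: "c\<^sup>2 * (\<kappa> * \<mu>) = k * \<mu>" by (metis mult.assoc)
      have 2: "2 * c * (\<Lambda> * \<mu>) = 2 * (k * \<mu>)" using c(4) by (metis mult.assoc)
      show ?thesis unfolding distrib_left 1 2 by simp
    qed
    finally have Y: "(LINT z|M. J z) + c\<^sup>2 * (LINT z|M. K z) - 2 * c * (LINT z|M. N z) \<le> c\<^sup>2 * s" .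
    show ?thesis
      using \<theta> N3 Ks Y c(1) by (intro add_mono mult_left_mono divide_right_mono) auto
  qed
  finally show "(LINT z|M. norm (D z - \<Lambda> *\<^sub>R w)) \<le>
       \<theta> * (\<Lambda> * \<mu> + c * s / 2) + c * s / (4 * \<theta>) + (\<theta> * (\<kappa> * \<mu> + s) + c\<^sup>2 * s / (4 * \<theta>)) + c * s"
    by simp
qed

section \<open>Competitors of the stretch map\<close>

lemma nn_integral_lebesgue_on:
  assumes "\<Omega> \<in> sets lebesgue"
  shows "(\<integral>\<^sup>+z. f z \<partial>lebesgue_on \<Omega>) = (\<integral>\<^sup>+z. f z * indicator \<Omega> z \<partial>lborel)"
  using assms by (simp add: nn_integral_restrict_space nn_integral_completion)

lemma measure_lebesgue_on_interior_Q1: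
  assumes "0 < l"
  shows "finite_measure (lebesgue_on (interior (Q1 l)))" "measure (lebesgue_on (interior (Q1 l))) (space (lebesgue_on (interior (Q1 l)))) = l"
    "emeasure lborel (interior (Q1 l)) = ennreal l"
proof -
  have m: "measure lborel (interior (Q1 l)) = l"
  proof -
    have "measure lborel (box 0 (Complex l 1)) = measure lborel (cbox 0 (Complex l 1))"
      using assms by (simp add: measure_lborel_box_eq measure_lborel_cbox_eq)
    then show ?thesis using assms by (simp add: interior_Q1 measure_cbox_complex)
  qed
  have fin: "emeasure lborel (interior (Q1 l)) < \<infinity>" unfolding interior_Q1 by (rule emeasure_lborel_box_finite)
  then show e: "emeasure lborel (interior (Q1 l)) = ennreal l"
    using m by (metis emeasure_eq_ennreal_measure infinity_ennreal_def less_irrefl)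
  have e': "emeasure (lebesgue_on (interior (Q1 l))) (space (lebesgue_on (interior (Q1 l)))) = ennreal l"
    using e by (simp add: emeasure_restrict_space space_restrict_space)
  show "finite_measure (lebesgue_on (interior (Q1 l)))" using e' by (intro finite_measureI) simp
  show "measure (lebesgue_on (interior (Q1 l))) (space (lebesgue_on (interior (Q1 l)))) = l"
    using e' assms by (simp add: measure_def)
qed

lemma stretch_has_weak_partial:
  assumes l: "0 < l"
  shows "has_weak_partial (interior (Q1 l)) (stretch k n) v (\<lambda>_. stretch k n v)"
proof -
  let ?\<Omega> = "interior (Q1 l)"
  have \<Omega>: "?\<Omega> \<in> sets borel" by simp
  interpret finite_measure "lebesgue_on ?\<Omega>" by (rule measure_lebesgue_on_interior_Q1(1)[OF l])
  have [measurable]: "stretch k n \<in> borel_measurable borel"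
    by (rule borel_measurable_continuous_onI[OF continuous_on_stretch])
  have restr: "h \<in> borel_measurable (lebesgue_on ?\<Omega>)" if "h \<in> borel_measurable borel" for h :: "complex \<Rightarrow> complex"
    using that by (intro measurable_restrict_space1 measurable_completion) simp
  have restr': "h \<in> borel_measurable (lebesgue_on ?\<Omega>)" if "h \<in> borel_measurable borel" for h :: "complex \<Rightarrow> real"
    using that by (intro measurable_restrict_space1 measurable_completion) simp
  have "integrable (lebesgue_on ?\<Omega>) (stretch k n)"
  proof -
    have c: "compact (Q1 l)" by (simp add: Q1_eq_cbox)
    have "bounded (stretch k n ` Q1 l)"
      by (rule compact_imp_bounded[OF compact_continuous_image[OF continuous_on_stretch c]])
    then obtain B where B: "\<And>z. z \<in> Q1 l \<Longrightarrow> norm (stretch k n z) \<le> B" by (auto simp: bounded_iff)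
    show ?thesis
    proof (rule integrable_const_bound[of _ B])
      show "AE z in lebesgue_on ?\<Omega>. norm (stretch k n z) \<le> B"
        by (intro AE_I2 B) (auto simp: space_restrict_space dest: subsetD[OF interior_subset])
    qed (rule restr, measurable)
  qed
  moreover have "(LINT z|lebesgue_on ?\<Omega>. frechet_derivative u (at z) v *\<^sub>R stretch k n z) =
        - (LINT z|lebesgue_on ?\<Omega>. u z *\<^sub>R stretch k n v)" if u: "test_function ?\<Omega> u" for u
  proof -
    note D = test_function_derivative[OF u] and out = test_function_outside[OF u]
    have [measurable]: "(\<lambda>z. frechet_derivative u (at z) v) \<in> borel_measurable borel" "u \<in> borel_measurable borel"
      using D(2,3) by (auto intro: borel_measurable_continuous_onI)
    have "(LINT z|lebesgue_on ?\<Omega>. frechet_derivative u (at z) v *\<^sub>R stretch k n z) = (LINT z|lborel. frechet_derivative u (at z) v *\<^sub>R stretch k n z)"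
      by (rule LINT_lebesgue_on_eq_lborel(1)[OF \<Omega>]) (auto simp: out intro!: restr)
    moreover have "(LINT z|lebesgue_on ?\<Omega>. u z *\<^sub>R stretch k n v) = (LINT z|lborel. u z *\<^sub>R stretch k n v)"
      by (rule LINT_lebesgue_on_eq_lborel(1)[OF \<Omega>]) (auto simp: out intro!: restr)
    ultimately show ?thesis using stretch_weak_derivative(1)[OF u] by simp
  qed
  ultimately show ?thesis by (simp add: has_weak_partial_def)
qed

lemma W11_weak_partial:
  assumes "W11 \<Omega> f"
  shows "has_weak_partial \<Omega> f 1 (weak_partial \<Omega> f 1)" "has_weak_partial \<Omega> f \<i> (weak_partial \<Omega> f \<i>)"
  using assms someI_ex[of "has_weak_partial \<Omega> f 1"] someI_ex[of "has_weak_partial \<Omega> f \<i>"]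
  unfolding W11_def weak_partial_def by blast+

text \<open>The chosen weak derivatives agree almost everywhere with the constant ones, by uniqueness applied
to the difference of the stretch with itself.\<close>

lemma weak_partial_stretch:
  assumes l: "0 < l"
  shows "AE z in lborel. z \<in> interior (Q1 l) \<longrightarrow> weak_partial (interior (Q1 l)) (stretch k n) 1 z = stretch k n 1"
    and "AE z in lborel. z \<in> interior (Q1 l) \<longrightarrow> weak_partial (interior (Q1 l)) (stretch k n) \<i> z = stretch k n \<i>"
proof -
  have "W11 (interior (Q1 l)) (stretch k n)" using stretch_has_weak_partial[OF l] by (auto simp: W11_def)
  note wp = W11_weak_partial[OF this]
  obtain G1 G2 where W: "W10_on_box (Complex l 1) (\<lambda>z. if z \<in> Q1 l then stretch k n z - stretch k n z else 0) G1 G2"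
    and G: "AE z in lborel. z \<in> interior (Q1 l) \<longrightarrow> weak_partial (interior (Q1 l)) (stretch k n) 1 z = G1 z + stretch k n 1"
    "AE z in lborel. z \<in> interior (Q1 l) \<longrightarrow> weak_partial (interior (Q1 l)) (stretch k n) \<i> z = G2 z + stretch k n \<i>"
    by (rule W10_of_boundary_values[OF l continuous_on_stretch _ wp]) blast+
  have "AE z in lborel. G1 z = 0" "AE z in lborel. G2 z = 0" using W10_zero_partials[OF W] by auto
  with G show "AE z in lborel. z \<in> interior (Q1 l) \<longrightarrow> weak_partial (interior (Q1 l)) (stretch k n) 1 z = stretch k n 1"
    and "AE z in lborel. z \<in> interior (Q1 l) \<longrightarrow> weak_partial (interior (Q1 l)) (stretch k n) \<i> z = stretch k n \<i>"
    by (auto elim: eventually_elim2)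
qed

text \<open>The real-linear map with images \<open>p\<close> of \<open>1\<close> and \<open>q\<close> of \<open>\<i>\<close> is \<open>v \<mapsto> a v + b cnj v\<close>, where \<open>a\<close> is
this number and \<open>b\<close> the one defined next.\<close>

definition wirtinger :: "complex \<Rightarrow> complex \<Rightarrow> complex" where "wirtinger p q = (p - \<i> * q) / 2"
definition wirtinger_bar :: "complex \<Rightarrow> complex \<Rightarrow> complex" where "wirtinger_bar p q = (p + \<i> * q) / 2"

definition matrix_distortion :: "complex \<Rightarrow> complex \<Rightarrow> real" where
  "matrix_distortion p q = (if cmod (wirtinger_bar p q) < cmod (wirtinger p q)
     then (cmod (wirtinger p q) + cmod (wirtinger_bar p q)) / (cmod (wirtinger p q) - cmod (wirtinger_bar p q)) else 1)"

lemma linear_distortion_eq: "linear_distortion \<Omega> f z = matrix_distortion (weak_partial \<Omega> f 1 z) (weak_partial \<Omega> f \<i> z)"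
  by (simp add: linear_distortion_def matrix_distortion_def dz_def dzbar_def wirtinger_def wirtinger_bar_def)

lemma matrix_distortion_ge_1: "1 \<le> matrix_distortion p q"
  by (auto simp: matrix_distortion_def field_simps)

lemma jacobian_wirtinger: "(cmod (wirtinger p q))\<^sup>2 - (cmod (wirtinger_bar p q))\<^sup>2 = Im (cnj p * q)"
  unfolding wirtinger_def wirtinger_bar_def cmod_power2
  by (simp add: power2_eq_square field_simps)

lemma jacobian_eq: "jacobian \<Omega> f z = Im (cnj (weak_partial \<Omega> f 1 z) * weak_partial \<Omega> f \<i> z)"
  using jacobian_wirtinger by (simp add: jacobian_def dz_def dzbar_def wirtinger_def wirtinger_bar_def)

lemma directional_derivative_wirtinger:
  "Re v *\<^sub>R p + Im v *\<^sub>R q = wirtinger p q * v + wirtinger_bar p q * cnj v"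
  by (simp add: wirtinger_def wirtinger_bar_def complex_eq_iff field_simps)

lemma norm_directional_derivative_le:
  assumes "norm v = 1"
  shows "norm (Re v *\<^sub>R p + Im v *\<^sub>R q) \<le> cmod (wirtinger p q) + cmod (wirtinger_bar p q)"
  unfolding directional_derivative_wirtinger using assms
  by (intro order_trans[OF norm_triangle_ineq]) (simp add: norm_mult)

text \<open>A unit vector with \<open>v\<^sup>2 = sgn b \<cdot> cnj (sgn a)\<close> makes \<open>a v\<close> and \<open>b cnj v\<close> positively parallel.\<close>

lemma maximal_stretch_direction:
  obtains v where "norm v = 1" "norm (Re v *\<^sub>R p + Im v *\<^sub>R q) = cmod (wirtinger p q) + cmod (wirtinger_bar p q)"
proof -
  define a where "a = wirtinger p q" define b where "b = wirtinger_bar p q"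
  show ?thesis
  proof (cases "a = 0 \<or> b = 0")
    case True
    have "norm (Re 1 *\<^sub>R p + Im 1 *\<^sub>R q) = cmod a + cmod b"
      unfolding directional_derivative_wirtinger a_def[symmetric] b_def[symmetric] using True by auto
    then show ?thesis by (intro that[of 1]) (simp_all add: a_def b_def)
  next
    case False
    define v where "v = csqrt (sgn b * cnj (sgn a))"
    have v2: "v * v = sgn b * cnj (sgn a)" unfolding v_def by (metis power2_csqrt power2_eq_square)
    have sg: "norm (sgn a) = 1" "norm (sgn b) = 1" using False by (auto simp: norm_sgn)
    have "norm v * norm v = 1" unfolding norm_mult[symmetric] v2 using sg by (simp add: norm_mult)
    then have nv: "norm v = 1" by (metis norm_ge_zero real_sqrt_abs2 abs_of_nonneg real_sqrt_one)
    have vv: "v * cnj v = 1" using nv by (simp add: complex_norm_square[symmetric])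
    have "a * v + b * cnj v = v * (a + b * (cnj v * cnj v))" using vv by (simp add: algebra_simps)
    also have "a + b * (cnj v * cnj v) = (cmod a + cmod b) *\<^sub>R sgn a"
    proof -
      have 1: "cnj v * cnj v = cnj (sgn b) * sgn a" using v2 by (metis complex_cnj_cnj complex_cnj_mult)
      have 2: "b * (cnj (sgn b) * sgn a) = cmod b *\<^sub>R sgn a" using False
        by (simp add: sgn_eq complex_norm_square[symmetric] scaleR_conv_of_real power2_eq_square field_simps)
      have 3: "cmod a *\<^sub>R sgn a = a" by (simp add: sgn_eq scaleR_conv_of_real)
      show ?thesis unfolding 1 2 scaleR_add_left 3 ..
    qed
    finally have "a * v + b * cnj v = v * ((cmod a + cmod b) *\<^sub>R sgn a)" .
    then have "norm (a * v + b * cnj v) = cmod a + cmod b" using nv sg by (simp add: norm_mult)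
    then show ?thesis using nv
      by (intro that[of v]) (simp_all add: directional_derivative_wirtinger a_def b_def)
  qed
qed

text \<open>Where the first Wirtinger coefficient does not dominate, the hypothesis makes Jacobian and
differential vanish, so that the conventional value \<open>1\<close> of the distortion is harmless.\<close>

lemma finite_distortion_identity:
  fixes K :: ereal
  assumes "1 \<le> K" "K < \<infinity>" "ereal ((cmod (wirtinger p q) + cmod (wirtinger_bar p q))\<^sup>2) \<le> K * ereal (Im (cnj p * q))"
  shows "0 \<le> Im (cnj p * q)"
    and "(cmod (wirtinger p q) + cmod (wirtinger_bar p q))\<^sup>2 = matrix_distortion p q * Im (cnj p * q)"
proof -
  define a where "a = cmod (wirtinger p q)" define b where "b = cmod (wirtinger_bar p q)"
  have J: "Im (cnj p * q) = a\<^sup>2 - b\<^sup>2" unfolding a_def b_def by (rule jacobian_wirtinger[symmetric])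
  obtain r where r: "K = ereal r" "1 \<le> r" using assms(1,2) by (cases K) auto
  have N: "(a + b)\<^sup>2 \<le> r * (a\<^sup>2 - b\<^sup>2)" using assms(3) unfolding J r(1) a_def[symmetric] b_def[symmetric] by simp
  then have "0 \<le> r * (a\<^sup>2 - b\<^sup>2)" by (meson order_trans zero_le_power2)
  then have nn: "0 \<le> a\<^sup>2 - b\<^sup>2" using r(2) by (simp add: zero_le_mult_iff)
  then show "0 \<le> Im (cnj p * q)" unfolding J .
  have ab: "0 \<le> a" "0 \<le> b" by (auto simp: a_def b_def)
  have "(a + b)\<^sup>2 = (if b < a then (a + b) / (a - b) else 1) * (a\<^sup>2 - b\<^sup>2)"
  proof (cases "b < a")
    case True
    then have "(a + b) / (a - b) * (a\<^sup>2 - b\<^sup>2) = (a + b) / (a - b) * ((a - b) * (a + b))" by (simp add: power2_eq_square algebra_simps)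
    also have "\<dots> = (a + b)\<^sup>2" using True by (simp add: power2_eq_square)
    finally show ?thesis using True by simp
  next
    case False
    then have "a\<^sup>2 \<le> b\<^sup>2" using ab by (intro power_mono) auto
    with nn have "a\<^sup>2 - b\<^sup>2 = 0" by simp
    with N have "(a + b)\<^sup>2 \<le> 0" by simp
    then show ?thesis using False \<open>a\<^sup>2 - b\<^sup>2 = 0\<close> by (simp add: antisym)
  qed
  then show "(cmod (wirtinger p q) + cmod (wirtinger_bar p q))\<^sup>2 = matrix_distortion p q * Im (cnj p * q)"
    unfolding J matrix_distortion_def a_def b_def .
qed


lemma stretch_distortion:
  fixes k n :: real
  assumes k: "0 < k"
  defines "\<kappa> \<equiv> matrix_distortion (stretch k n 1) (stretch k n \<i>)"
    and "\<Lambda> \<equiv> cmod (wirtinger (stretch k n 1) (stretch k n \<i>)) + cmod (wirtinger_bar (stretch k n 1) (stretch k n \<i>))"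
  shows "\<Lambda>\<^sup>2 = \<kappa> * k" "0 < \<Lambda>"
proof -
  have k1: "Im (cnj (stretch k n 1) * stretch k n \<i>) = k" unfolding stretch_def by simp
  have J: "(cmod (wirtinger (stretch k n 1) (stretch k n \<i>)))\<^sup>2 - (cmod (wirtinger_bar (stretch k n 1) (stretch k n \<i>)))\<^sup>2 = k"
    unfolding jacobian_wirtinger by (rule k1)
  show "0 < \<Lambda>"
  proof (rule ccontr)
    assume "\<not> 0 < \<Lambda>"
    then have "cmod (wirtinger (stretch k n 1) (stretch k n \<i>)) = 0" "cmod (wirtinger_bar (stretch k n 1) (stretch k n \<i>)) = 0"
      unfolding \<Lambda>_def by (auto simp: not_less add_nonneg_eq_0_iff dest: antisym[OF _ add_nonneg_nonneg])
    with J k show False by simp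
  qed
  \<comment> \<open>any finite bound for the distortion will do; adding \<open>1\<close> keeps it above \<open>1\<close>\<close>
  have "ereal (\<Lambda>\<^sup>2) \<le> ereal (\<Lambda>\<^sup>2 / k + 1) * ereal k"
    using k by (simp add: field_simps)
  moreover have "1 \<le> ereal (\<Lambda>\<^sup>2 / k + 1)" "ereal (\<Lambda>\<^sup>2 / k + 1) < \<infinity>" using k by auto
  ultimately show "\<Lambda>\<^sup>2 = \<kappa> * k"
    using finite_distortion_identity(2)[of "ereal (\<Lambda>\<^sup>2 / k + 1)" "stretch k n 1" "stretch k n \<i>"]
    unfolding k1 \<Lambda>_def[symmetric] \<kappa>_def[symmetric] by blast
qed

text \<open>The abstract estimates hold for \<open>f\<close> on the open rectangle, with \<open>v\<close> the direction that the stretch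
expands most; the Poincare inequality along \<open>v\<close> contributes the factor \<open>2 (l + 4)\<close>.\<close>

lemma competitor_estimates:
  assumes k: "0 < k" and l: "0 < l" and f: "f \<in> competitors k l n"
    and bdry: "\<forall>z\<in>frontier (Q1 l). f z = stretch k n z"
  defines "M \<equiv> lebesgue_on (interior (Q1 l))" and "K \<equiv> linear_distortion (interior (Q1 l)) f"
    and "\<kappa> \<equiv> matrix_distortion (stretch k n 1) (stretch k n \<i>)"
    and "\<Lambda> \<equiv> cmod (wirtinger (stretch k n 1) (stretch k n \<i>)) + cmod (wirtinger_bar (stretch k n 1) (stretch k n \<i>))"
  assumes iK: "integrable M K"
  defines "s \<equiv> (LINT z|M. \<bar>K z - \<kappa>\<bar>)" and "c \<equiv> k / \<Lambda>"
  shows "\<kappa> * l \<le> (LINT z|M. K z)"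
    and "0 < \<theta> \<Longrightarrow> (LINT z|lebesgue_on (Q1 l). cmod (f z - stretch k n z)) \<le> 2 * (l + 4) *
       (\<theta> * (\<Lambda> * l + c * s / 2) + c * s / (4 * \<theta>) + (\<theta> * (\<kappa> * l + s) + c\<^sup>2 * s / (4 * \<theta>)) + c * s)"
proof -
  have bd: "\<And>z. z \<in> frontier (Q1 l) \<Longrightarrow> f z = stretch k n z" using bdry by blast
  let ?\<Omega> = "interior (Q1 l)"
  have \<Omega>[measurable]: "?\<Omega> \<in> sets borel" by simp
  obtain f' where hom: "homeomorphism (Q1 l) (f ` Q1 l) f f'"
    and fd: "finite_distortion ?\<Omega> f" using f by (auto simp: competitors_def)
  have fc: "continuous_on (Q1 l) f" and inj: "inj_on f (Q1 l)"
    using hom by (auto simp: homeomorphism_def intro!: inj_on_inverseI)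
  have W11: "W11 ?\<Omega> f" and iJ: "integrable M (jacobian ?\<Omega> f)"
    using fd by (auto simp: finite_distortion_def M_def)
  obtain Kf :: "complex \<Rightarrow> ereal" where Kf: "AE z in M. 1 \<le> Kf z \<and> Kf z < \<infinity> \<and>
           ereal ((norm_D ?\<Omega> f z)\<^sup>2) \<le> Kf z * ereal (jacobian ?\<Omega> f z)"
    using fd unfolding finite_distortion_def M_def by blast
  define p1 where "p1 = weak_partial ?\<Omega> f 1" define p2 where "p2 = weak_partial ?\<Omega> f \<i>"
  have wp: "has_weak_partial ?\<Omega> f 1 p1" "has_weak_partial ?\<Omega> f \<i> p2"
    unfolding p1_def p2_def by (rule W11_weak_partial[OF W11])+
  then have ip: "integrable M p1" "integrable M p2" by (auto simp: has_weak_partial_def M_def)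
  then have [measurable]: "p1 \<in> borel_measurable M" "p2 \<in> borel_measurable M" by auto
  obtain G1 G2 where W: "W10_on_box (Complex l 1) (\<lambda>z. if z \<in> Q1 l then f z - stretch k n z else 0) G1 G2"
    and G: "AE z in lborel. z \<in> ?\<Omega> \<longrightarrow> p1 z = G1 z + stretch k n 1" "AE z in lborel. z \<in> ?\<Omega> \<longrightarrow> p2 z = G2 z + stretch k n \<i>"
    by (rule W10_of_boundary_values[OF l fc bd wp]) blast+
  have Gi: "integrable lborel G1" "integrable lborel G2" and G0: "\<And>z. z \<notin> ?\<Omega> \<Longrightarrow> G1 z = 0" "\<And>z. z \<notin> ?\<Omega> \<Longrightarrow> G2 z = 0"
    and gc: "continuous_on UNIV (\<lambda>z. if z \<in> Q1 l then f z - stretch k n z else 0)"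
    using W by (auto simp: W10_on_box_def interior_Q1)
  then have [measurable]: "G1 \<in> borel_measurable borel" "G2 \<in> borel_measurable borel" by auto
  have fm: "finite_measure M" and mM: "measure M (space M) = l" and em: "emeasure lborel ?\<Omega> = ennreal l"
    unfolding M_def by (rule measure_lebesgue_on_interior_Q1[OF l])+
  interpret finite_measure M by (rule fm)
  define J where "J = (\<lambda>z. Im (cnj (p1 z) * p2 z))"
  have Jeq: "jacobian ?\<Omega> f = J" by (auto simp: J_def jacobian_eq p1_def p2_def fun_eq_iff)
  define N where "N = (\<lambda>z. cmod (wirtinger (p1 z) (p2 z)) + cmod (wirtinger_bar (p1 z) (p2 z)))"
  have Neq: "norm_D ?\<Omega> f = N"
    by (auto simp: N_def norm_D_def dz_def dzbar_def wirtinger_def wirtinger_bar_def p1_def p2_def fun_eq_iff)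
  have Keq: "K z = matrix_distortion (p1 z) (p2 z)" for z by (simp add: K_def linear_distortion_eq p1_def p2_def)
  have id: "\<Lambda>\<^sup>2 = \<kappa> * k" and \<Lambda>: "0 < \<Lambda>"
    using stretch_distortion[OF k, of n] by (auto simp: \<Lambda>_def \<kappa>_def)
  obtain v where v: "norm v = 1" "norm (Re v *\<^sub>R stretch k n 1 + Im v *\<^sub>R stretch k n \<i>) = \<Lambda>"
    unfolding \<Lambda>_def by (rule maximal_stretch_direction)
  define w where "w = (Re v *\<^sub>R stretch k n 1 + Im v *\<^sub>R stretch k n \<i>) /\<^sub>R \<Lambda>"
  have w: "norm w = 1" "\<Lambda> *\<^sub>R w = Re v *\<^sub>R stretch k n 1 + Im v *\<^sub>R stretch k n \<i>"
    using v \<Lambda> by (simp_all add: w_def)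
  define D where "D = (\<lambda>z. Re v *\<^sub>R p1 z + Im v *\<^sub>R p2 z)"
  have iD: "integrable M D" unfolding D_def using ip by auto
  have iN: "integrable M N" unfolding N_def wirtinger_def wirtinger_bar_def using ip by auto
  have ae: "AE z in M. norm (D z) \<le> N z \<and> (N z)\<^sup>2 = K z * J z \<and> 0 \<le> K z \<and> 0 \<le> J z"
    using Kf
  proof eventually_elim
    case (elim z)
    then have *: "1 \<le> Kf z" "Kf z < \<infinity>" "ereal ((cmod (wirtinger (p1 z) (p2 z)) + cmod (wirtinger_bar (p1 z) (p2 z)))\<^sup>2) \<le> Kf z * ereal (Im (cnj (p1 z) * p2 z))"
      unfolding Jeq Neq by (auto simp: J_def N_def)
    show ?case
      using finite_distortion_identity[OF *] norm_directional_derivative_le[OF v(1)] matrix_distortion_ge_1[of "p1 z" "p2 z"]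
      unfolding J_def N_def D_def Keq by auto
  qed
  have part: "(LINT z|M. p z) = l *\<^sub>R b" if p: "AE z in lborel. z \<in> ?\<Omega> \<longrightarrow> p z = G z + b" "p \<in> borel_measurable M"
    and G: "integrable lborel G" "\<And>z. z \<notin> ?\<Omega> \<Longrightarrow> G z = 0" "(LINT z|lborel. G z) = 0" for p G :: "complex \<Rightarrow> complex" and b
  proof -
    have [measurable]: "G \<in> borel_measurable borel" using G by auto
    have "(LINT z|M. p z) = (LINT z|lborel. G z + indicator ?\<Omega> z *\<^sub>R b)"
      unfolding M_def by (rule LINT_lebesgue_on_eq_lborel(1)[OF \<Omega>]) (use p G in \<open>auto simp: M_def elim!: eventually_mono\<close>)
    also have "\<dots> = (LINT z|lborel. G z) + measure lborel ?\<Omega> *\<^sub>R b"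
      using G(1) em by (subst Bochner_Integration.integral_add) auto
    finally show ?thesis using G(3) em l by (simp add: measure_def)
  qed
  have intD: "(LINT z|M. D z) = (measure M (space M) * \<Lambda>) *\<^sub>R w"
  proof -
    have "(LINT z|M. D z) = Re v *\<^sub>R (LINT z|M. p1 z) + Im v *\<^sub>R (LINT z|M. p2 z)"
      unfolding D_def using ip by simp
    also have "(LINT z|M. p1 z) = l *\<^sub>R stretch k n 1"
      by (rule part[OF G(1) _ Gi(1) G0(1) W10_integral_partials(1)[OF W]]) auto
    also have "(LINT z|M. p2 z) = l *\<^sub>R stretch k n \<i>"
      by (rule part[OF G(2) _ Gi(2) G0(2) W10_integral_partials(2)[OF W]]) auto
    also have "Re v *\<^sub>R (l *\<^sub>R stretch k n 1) + Im v *\<^sub>R (l *\<^sub>R stretch k n \<i>) = l *\<^sub>R (\<Lambda> *\<^sub>R w)"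
      unfolding w(2) by (simp add: scaleR_add_right mult.commute)
    finally show ?thesis by (simp add: mM)
  qed
  have intJ: "(LINT z|M. J z) \<le> k * measure M (space M)"
  proof -
    define j where "j = (\<lambda>z. indicator ?\<Omega> z * \<bar>Im (cnj (G1 z + stretch k n 1) * (G2 z + stretch k n \<i>))\<bar>)"
    have jm: "j \<in> borel_measurable borel"
      unfolding j_def by (simp add: borel_measurable_complex_iff[THEN iffD1])
    have "AE z in lebesgue_on ?\<Omega>. 0 \<le> J z" using ae unfolding M_def by eventually_elim auto
    then have "AE z in lebesgue. z \<in> ?\<Omega> \<longrightarrow> 0 \<le> J z" by (subst (asm) AE_restrict_space_iff) auto
    then have Jnn: "AE z in lborel. z \<in> ?\<Omega> \<longrightarrow> 0 \<le> J z" by (simp add: AE_completion_iff)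
    have "(LINT z|M. J z) = (LINT z|lborel. j z)" 
      unfolding M_def
    proof (rule LINT_lebesgue_on_eq_lborel(1)[OF \<Omega> _ jm])
      show "J \<in> borel_measurable (lebesgue_on ?\<Omega>)" using iJ by (auto simp: Jeq M_def)
      show "AE z in lborel. z \<in> ?\<Omega> \<longrightarrow> J z = j z"
        using G Jnn
      proof eventually_elim
        case (elim z)
        show ?case
        proof
          assume z: "z \<in> ?\<Omega>"
          then have eq: "p1 z = G1 z + stretch k n 1" "p2 z = G2 z + stretch k n \<i>" and "0 \<le> J z" using elim by auto
          have "j z = \<bar>J z\<bar>" unfolding j_def J_def eq indicator_simps(1)[OF z] mult_1 ..
          with \<open>0 \<le> J z\<close> show "J z = j z" by simp
        qed
      qed
    qed (simp add: j_def)
    also have "\<dots> \<le> k * l"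
    proof -
      have "(\<integral>\<^sup>+z. ennreal (j z) \<partial>lborel) = (\<integral>\<^sup>+z. ennreal \<bar>Im (cnj (G1 z + stretch k n 1) * (G2 z + stretch k n \<i>))\<bar> * indicator ?\<Omega> z \<partial>lborel)"
        unfolding j_def by (intro nn_integral_cong) (auto split: split_indicator)
      also have "\<dots> \<le> ennreal (k * l)" by (rule jacobian_integral_le_area[OF k l fc inj bd W])
      finally have "(\<integral>\<^sup>+z. ennreal (j z) \<partial>lborel) \<le> ennreal (k * l)" .
      moreover have "(LINT z|lborel. j z) = enn2real (\<integral>\<^sup>+z. ennreal (j z) \<partial>lborel)"
        using jm by (intro integral_eq_nn_integral) (auto simp: j_def)
      ultimately show ?thesis using k l by (simp add: enn2real_leI)
    qed
    finally show ?thesis by (simp add: mM)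
  qed
  have iK': "integrable M K" by (rule iK)
  have iJ': "integrable M J" using iJ by (simp add: Jeq)
  note est = derivative_deviation_L1[OF fm iD iN iK' iJ' ae w(1) \<Lambda> k id[symmetric] intD intJ]
  show "\<kappa> * l \<le> (LINT z|M. K z)" using est(1) by (simp add: mM)
  assume \<theta>: "0 < \<theta>"
  have B: "(LINT z|M. norm (D z - \<Lambda> *\<^sub>R w)) \<le> \<theta> * (\<Lambda> * l + c * s / 2) + c * s / (4 * \<theta>) + (\<theta> * (\<kappa> * l + s) + c\<^sup>2 * s / (4 * \<theta>)) + c * s"
    using est(2)[OF \<theta>] by (simp add: mM s_def c_def)
  define g where "g = (\<lambda>z. if z \<in> Q1 l then f z - stretch k n z else 0)"
  define H where "H = (\<lambda>z. Re v *\<^sub>R G1 z + Im v *\<^sub>R G2 z)"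
  have Hi: "integrable lborel H" unfolding H_def using Gi by auto
  have gm: "g \<in> borel_measurable borel" using gc unfolding g_def by (rule borel_measurable_continuous_onI)
  have "(LINT z|lebesgue_on (Q1 l). cmod (f z - stretch k n z)) = (LINT z|lborel. norm (g z))"
  proof (rule LINT_lebesgue_on_eq_lborel(1))
    show "Q1 l \<in> sets borel" by (simp add: Q1_eq_cbox)
    have "(\<lambda>z. norm (g z)) \<in> borel_measurable (lebesgue_on (Q1 l))"
      using gm by (intro measurable_restrict_space1 measurable_completion) simp
    then show "(\<lambda>z. cmod (f z - stretch k n z)) \<in> borel_measurable (lebesgue_on (Q1 l))"
      by (subst measurable_cong[where g="\<lambda>z. norm (g z)"]) (auto simp: g_def space_restrict_space)
  qed (use gm in \<open>auto simp: g_def\<close>)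
  also have "\<dots> = enn2real (\<integral>\<^sup>+z. norm (g z) \<partial>lborel)" using gm by (intro integral_eq_nn_integral) auto
  also have "\<dots> \<le> 2 * (l + 4) * (LINT z|lborel. norm (H z))"
  proof (rule enn2real_leI)
    have "(\<integral>\<^sup>+z. norm (g z) \<partial>lborel) \<le> ennreal (2 * (l + 4)) * (\<integral>\<^sup>+z. norm (H z) \<partial>lborel)"
      using W10_poincare[OF W v(1)] by (simp add: g_def H_def add.assoc)
    also have "(\<integral>\<^sup>+z. norm (H z) \<partial>lborel) = ennreal (LINT z|lborel. norm (H z))"
      using Hi by (intro nn_integral_eq_integral) auto
    finally show "(\<integral>\<^sup>+z. norm (g z) \<partial>lborel) \<le> ennreal (2 * (l + 4) * (LINT z|lborel. norm (H z)))"
      using l by (simp add: ennreal_mult)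
  qed (use l in simp)
  also have "(LINT z|lborel. norm (H z)) = (LINT z|M. norm (D z - \<Lambda> *\<^sub>R w))"
    unfolding M_def
  proof (rule LINT_lebesgue_on_eq_lborel(1)[OF \<Omega>, symmetric])
    show "(\<lambda>z. norm (D z - \<Lambda> *\<^sub>R w)) \<in> borel_measurable (lebesgue_on ?\<Omega>)" using iD by (auto simp: M_def)
    show "AE z in lborel. z \<in> ?\<Omega> \<longrightarrow> norm (D z - \<Lambda> *\<^sub>R w) = norm (H z)"
      using G by eventually_elim (auto simp: D_def H_def w(2) algebra_simps)
  qed (use Hi G0 in \<open>auto simp: H_def\<close>)
  also have "2 * (l + 4) * (LINT z|M. norm (D z - \<Lambda> *\<^sub>R w)) \<le> 2 * (l + 4) *
       (\<theta> * (\<Lambda> * l + c * s / 2) + c * s / (4 * \<theta>) + (\<theta> * (\<kappa> * l + s) + c\<^sup>2 * s / (4 * \<theta>)) + c * s)"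
    using B l by (intro mult_left_mono) auto
  finally show "(LINT z|lebesgue_on (Q1 l). cmod (f z - stretch k n z)) \<le> 2 * (l + 4) *
       (\<theta> * (\<Lambda> * l + c * s / 2) + c * s / (4 * \<theta>) + (\<theta> * (\<kappa> * l + s) + c\<^sup>2 * s / (4 * \<theta>)) + c * s)" .
qed


lemma distortion_energy_interior_le:
  "(\<integral>\<^sup>+z. ennreal (\<phi> (linear_distortion (interior (Q1 l)) f z)) \<partial>lebesgue_on (interior (Q1 l))) \<le> distortion_energy \<phi> l f"
proof -
  have "Q1 l \<in> sets lebesgue" by (simp add: Q1_eq_cbox)
  then show ?thesis
    unfolding distortion_energy_def using interior_subset[of "Q1 l"]
    by (subst (1 2) nn_integral_lebesgue_on) (auto intro!: nn_integral_mono split: split_indicator)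
qed

lemma distortion_energy_stretch:
  assumes l: "0 < l"
  shows "distortion_energy \<phi> l (stretch k n) = ennreal (\<phi> (matrix_distortion (stretch k n 1) (stretch k n \<i>))) * ennreal l"
proof -
  let ?\<kappa> = "matrix_distortion (stretch k n 1) (stretch k n \<i>)"
  have Q: "Q1 l \<in> sets lebesgue" by (simp add: Q1_eq_cbox)
  have "negligible (cbox 0 (Complex l 1) - box 0 (Complex l 1))" by (rule negligible_frontier_interval)
  then have "AE z in lebesgue. z \<notin> cbox 0 (Complex l 1) - box 0 (Complex l 1)"
    unfolding negligible_iff_null_sets by (rule AE_not_in)
  then have fr: "AE z in lborel. z \<in> Q1 l \<longrightarrow> z \<in> interior (Q1 l)"
    unfolding AE_completion_iff interior_Q1 unfolding Q1_eq_cbox by (auto elim: eventually_mono)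
  have "distortion_energy \<phi> l (stretch k n) = (\<integral>\<^sup>+z. ennreal (\<phi> (linear_distortion (interior (Q1 l)) (stretch k n) z)) * indicator (Q1 l) z \<partial>lborel)"
    unfolding distortion_energy_def by (rule nn_integral_lebesgue_on[OF Q])
  also have "\<dots> = (\<integral>\<^sup>+z. ennreal (\<phi> ?\<kappa>) * indicator (interior (Q1 l)) z \<partial>lborel)"
  proof (rule nn_integral_cong_AE)
    show "AE z in lborel. ennreal (\<phi> (linear_distortion (interior (Q1 l)) (stretch k n) z)) * indicator (Q1 l) z = ennreal (\<phi> ?\<kappa>) * indicator (interior (Q1 l)) z"
      using fr weak_partial_stretch[OF l, of k n]
    proof eventually_elim
      case (elim z)
      then show ?case using subsetD[OF interior_subset, of z "Q1 l"]
        by (cases "z \<in> interior (Q1 l)") (auto simp: linear_distortion_eq)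
    qed
  qed
  also have "\<dots> = ennreal (\<phi> ?\<kappa>) * ennreal l"
    using measure_lebesgue_on_interior_Q1(3)[OF l] by (subst nn_integral_cmult_indicator) auto
  finally show ?thesis .
qed

text \<open>The free parameter \<open>\<theta>\<close> is fixed first, so that the terms proportional to it contribute at most
\<open>r / 2\<close>; the remaining terms are proportional to the \<open>L\<^sup>1\<close>-distance of \<open>K\<close> and \<open>\<kappa>\<close>, which is at most \<open>s0\<close>
once the energy excess is small.\<close>

lemma small_energy_excess_imp_close:
  fixes k l n :: real and \<phi> :: "real \<Rightarrow> real"
  assumes k: "k > 0" and l: "l > 0"
    and \<phi>1: "\<phi> \<in> {1..} \<rightarrow> {1..}"
    and \<phi>: "mono_on {1..} \<phi>" "strictly_convex_on {1..} \<phi>"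
    and r: "0 < r"
  shows "\<exists>\<epsilon>\<^sub>1>0. \<forall>\<epsilon>\<in>{0<..<\<epsilon>\<^sub>1}. \<forall>f \<in> competitors k l n.
       (\<forall>z\<in>frontier (Q1 l). f z = stretch k n z) \<longrightarrow>
       distortion_energy \<phi> l f \<le> ennreal (1 + \<epsilon>) * distortion_energy \<phi> l (stretch k n) \<longrightarrow>
       (LINT z|lebesgue_on (Q1 l). cmod (f z - stretch k n z)) \<le> r"
proof -
  define \<kappa> where "\<kappa> = matrix_distortion (stretch k n 1) (stretch k n \<i>)"
  define \<Lambda> where "\<Lambda> = cmod (wirtinger (stretch k n 1) (stretch k n \<i>)) + cmod (wirtinger_bar (stretch k n 1) (stretch k n \<i>))"
  define c where "c = k / \<Lambda>"
  have \<Lambda>: "0 < \<Lambda>" using stretch_distortion(2)[OF k, of n] by (simp add: \<Lambda>_def)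
  have c: "0 < c" using k \<Lambda> by (simp add: c_def)
  have \<kappa>: "1 \<le> \<kappa>" unfolding \<kappa>_def by (rule matrix_distortion_ge_1)
  have \<phi>ge: "1 \<le> \<phi> t" if "1 \<le> t" for t using \<phi>1 that by auto
  obtain p where p: "0 \<le> p"
    "\<And>\<eta>. 0 < \<eta> \<Longrightarrow> \<exists>c>0. \<forall>t\<ge>1. \<phi> \<kappa> + p * (t - \<kappa>) + c * (\<bar>t - \<kappa>\<bar> - \<eta>) \<le> \<phi> t"
    using strictly_convex_above_tangent[OF \<phi>(2,1) \<kappa>] by blast
  \<comment> \<open>for \<open>s \<le> 1\<close> the deviation bound is at most \<open>\<theta> A + s B\<close>, with \<open>B\<close> defined below\<close>
  define A where "A = \<Lambda> * l + c / 2 + \<kappa> * l + 1"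
  have A: "0 < A" using \<Lambda> l c \<kappa> unfolding A_def by (intro add_pos_pos) auto
  define \<theta> where "\<theta> = r / (4 * (l + 4) * A)"
  have \<theta>: "0 < \<theta>" using r l A by (simp add: \<theta>_def)
  define B where "B = c / (4 * \<theta>) + c\<^sup>2 / (4 * \<theta>) + c"
  have B: "0 < B" using c \<theta> unfolding B_def by (intro add_pos_pos) auto
  define s0 where "s0 = min 1 (r / (4 * (l + 4) * B))"
  have s0: "0 < s0" "s0 \<le> 1" "s0 \<le> r / (4 * (l + 4) * B)" using r l B by (auto simp: s0_def)
  \<comment> \<open>half of \<open>s0\<close> is spent on the error \<open>\<eta> = s0 / (2 l)\<close> of the tangent bound, half on the energy excess\<close>
  have "0 < s0 / (2 * l)" using s0 l by simp
  from p(2)[OF this] obtain m where m: "0 < m" "\<And>t. 1 \<le> t \<Longrightarrow> \<phi> \<kappa> + p * (t - \<kappa>) + m * (\<bar>t - \<kappa>\<bar> - s0 / (2 * l)) \<le> \<phi> t" by blast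
  have \<phi>\<kappa>: "1 \<le> \<phi> \<kappa>" using \<phi>ge \<kappa> by blast
  define e1 where "e1 = m * s0 / (2 * \<phi> \<kappa> * l)"
  have e1: "0 < e1" using m s0 \<phi>\<kappa> l by (simp add: e1_def)
  show ?thesis
  proof (intro exI[of _ e1] conjI e1 ballI impI)
    fix \<epsilon> f
    assume \<epsilon>: "\<epsilon> \<in> {0<..<e1}" and f: "f \<in> competitors k l n" and bd: "\<forall>z\<in>frontier (Q1 l). f z = stretch k n z"
      and en: "distortion_energy \<phi> l f \<le> ennreal (1 + \<epsilon>) * distortion_energy \<phi> l (stretch k n)"
    define M where "M = lebesgue_on (interior (Q1 l))"
    define K where "K = linear_distortion (interior (Q1 l)) f"
    define s where "s = (LINT z|M. \<bar>K z - \<kappa>\<bar>)"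
    have fm: "finite_measure M" and mM: "measure M (space M) = l"
      unfolding M_def by (rule measure_lebesgue_on_interior_Q1[OF l])+
    have K1: "1 \<le> K z" for z unfolding K_def linear_distortion_eq by (rule matrix_distortion_ge_1)
    have Km: "K \<in> borel_measurable M"
    proof -
      have "W11 (interior (Q1 l)) f" using f by (auto simp: competitors_def finite_distortion_def)
      from W11_weak_partial[OF this] have [measurable]: "weak_partial (interior (Q1 l)) f 1 \<in> borel_measurable M" "weak_partial (interior (Q1 l)) f \<i> \<in> borel_measurable M"
        by (auto simp: has_weak_partial_def M_def)
      show ?thesis unfolding K_def linear_distortion_def dz_def dzbar_def by measurable
    qed
    have E: "(\<integral>\<^sup>+z. ennreal (\<phi> (K z)) \<partial>M) \<le> ennreal ((1 + \<epsilon>) * \<phi> \<kappa> * l)"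
    proof -
      have "(\<integral>\<^sup>+z. ennreal (\<phi> (K z)) \<partial>M) \<le> distortion_energy \<phi> l f"
        unfolding M_def K_def by (rule distortion_energy_interior_le)
      also have "\<dots> \<le> ennreal (1 + \<epsilon>) * (ennreal (\<phi> \<kappa>) * ennreal l)"
        using en unfolding distortion_energy_stretch[OF l] \<kappa>_def .
      also have "\<dots> = ennreal ((1 + \<epsilon>) * \<phi> \<kappa> * l)"
        using \<epsilon> \<phi>\<kappa> l by (simp add: ennreal_mult mult.assoc)
      finally show ?thesis .
    qed
    have E0: "0 \<le> (1 + \<epsilon>) * \<phi> \<kappa> * l" using \<epsilon> \<phi>\<kappa> l by simp
    have \<phi>0: "0 \<le> \<phi> t" if "1 \<le> t" for t using \<phi>ge[OF that] by simp
    have A0: "0 \<le> \<phi> \<kappa>" using \<phi>\<kappa> by simp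
    have iK: "integrable M K"
      and ineq: "\<phi> \<kappa> * l + p * ((LINT z|M. K z) - \<kappa> * l) + m * (s - s0 / (2 * l) * l) \<le> (1 + \<epsilon>) * \<phi> \<kappa> * l"
      using convex_energy_controls_L1[OF fm Km K1 p(1) m(1) \<open>0 < s0 / (2 * l)\<close> A0 m(2) \<phi>0 E E0]
      by (simp_all add: mM s_def)
    note est = competitor_estimates[OF k l f bd iK[unfolded M_def K_def],
        folded \<kappa>_def \<Lambda>_def, folded c_def M_def K_def, folded s_def]
    have "0 \<le> p * ((LINT z|M. K z) - \<kappa> * l)" using p(1) est(1) by simp
    with ineq have "m * s \<le> m * (s0 / 2) + \<epsilon> * \<phi> \<kappa> * l" using l by (simp add: algebra_simps)
    also have "\<epsilon> * \<phi> \<kappa> * l \<le> e1 * \<phi> \<kappa> * l" using \<epsilon> \<phi>\<kappa> l by (intro mult_right_mono) auto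
    also have "e1 * \<phi> \<kappa> * l = m * (s0 / 2)" using \<phi>\<kappa> l by (simp add: e1_def)
    finally have "m * s \<le> m * s0" by (simp add: algebra_simps)
    then have ss0: "s \<le> s0" using m(1) by simp
    have snn: "0 \<le> s" unfolding s_def by simp
    have "\<theta> * (\<Lambda> * l + c * s / 2) + c * s / (4 * \<theta>) + (\<theta> * (\<kappa> * l + s) + c\<^sup>2 * s / (4 * \<theta>)) + c * s
       = \<theta> * (\<Lambda> * l + c * s / 2 + \<kappa> * l + s) + s * B"
      unfolding B_def by (simp add: algebra_simps add_divide_distrib)
    also have "\<dots> \<le> \<theta> * A + s0 * B"
      unfolding A_def using \<theta> ss0 s0(2) c B \<Lambda> \<kappa> by (intro add_mono mult_left_mono mult_right_mono) auto
    finally have bound: "\<theta> * (\<Lambda> * l + c * s / 2) + c * s / (4 * \<theta>) + (\<theta> * (\<kappa> * l + s) + c\<^sup>2 * s / (4 * \<theta>)) + c * s \<le> \<theta> * A + s0 * B" .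
    have "(LINT z|lebesgue_on (Q1 l). cmod (f z - stretch k n z)) \<le> 2 * (l + 4) * (\<theta> * A + s0 * B)"
      using bound l by (intro order_trans[OF est(2)[OF \<theta>]] mult_left_mono) auto
    also have "\<dots> = 2 * (l + 4) * A * \<theta> + 2 * (l + 4) * B * s0" by (simp add: algebra_simps)
    also have "\<dots> \<le> 2 * (l + 4) * A * \<theta> + 2 * (l + 4) * B * (r / (4 * (l + 4) * B))"
      using s0(3) l B by (intro add_left_mono mult_left_mono) auto
    also have "\<dots> = r"
    proof -
      have half: "2 * (l + 4) * x * (r / (4 * (l + 4) * x)) = r / 2" if "0 < x" for x
        using that l by (simp add: divide_simps)
      show ?thesis unfolding \<theta>_def half[OF A] half[OF B] by simp
    qed
    finally show "(LINT z|lebesgue_on (Q1 l). cmod (f z - stretch k n z)) \<le> r" .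
  qed
qed

theorem theorem4p1:
  fixes k l n :: real and \<phi> :: "real \<Rightarrow> real"
  assumes "k > 0" and "l > 0"
    and "\<phi> \<in> {1..} \<rightarrow> {1..}"
    and "mono_on {1..} \<phi>"
    and "strictly_convex_on {1..} \<phi>"
    and "\<phi> 1 = 1"
    and "Liminf at_top (\<lambda>t. ereal (\<phi> t / t\<^sup>2)) > 0"
  shows "\<exists>\<epsilon>\<^sub>0 > 0. \<exists>\<delta> :: real \<Rightarrow> real.
    (\<forall>\<epsilon>\<in>{0<..<\<epsilon>\<^sub>0}. \<delta> \<epsilon> > 0) \<and> (\<delta> \<longlongrightarrow> 0) (at_right 0) \<and>
    (\<forall>\<epsilon>\<in>{0<..<\<epsilon>\<^sub>0}. \<forall>f \<in> competitors k l n.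
       (\<forall>z\<in>frontier (Q1 l). f z = stretch k n z) \<longrightarrow>
       distortion_energy \<phi> l f \<le> ennreal (1 + \<epsilon>) * distortion_energy \<phi> l (stretch k n) \<longrightarrow>
       (LINT z|lebesgue_on (Q1 l). cmod (f z - stretch k n z)) \<le> \<delta> \<epsilon>)"
proof -
  define X where "X = (\<lambda>\<epsilon>. {LINT z|lebesgue_on (Q1 l). cmod (f z - stretch k n z) | f. f \<in> competitors k l n \<and>
       (\<forall>z\<in>frontier (Q1 l). f z = stretch k n z) \<and>
       distortion_energy \<phi> l f \<le> ennreal (1 + \<epsilon>) * distortion_energy \<phi> l (stretch k n)})"
  have close: "\<exists>\<epsilon>\<^sub>1>0. \<forall>\<epsilon>\<in>{0<..<\<epsilon>\<^sub>1}. \<forall>x\<in>X \<epsilon>. x \<le> r" if "0 < r" for r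
    using small_energy_excess_imp_close[OF assms(1-5) that, of n] unfolding X_def by blast
  obtain \<epsilon>\<^sub>0 where \<epsilon>\<^sub>0: "0 < \<epsilon>\<^sub>0" "\<And>\<epsilon> x. \<epsilon> \<in> {0<..<\<epsilon>\<^sub>0} \<Longrightarrow> x \<in> X \<epsilon> \<Longrightarrow> x \<le> 1"
    using close[of 1] by auto
  \<comment> \<open>the summand \<open>\<epsilon>\<close> makes \<open>\<delta>\<close> positive; inserting \<open>0\<close> covers the case of no admissible map\<close>
  define \<delta> where "\<delta> = (\<lambda>\<epsilon>. \<epsilon> + Sup (insert 0 (X \<epsilon>)))"
  have bdd: "bdd_above (insert 0 (X \<epsilon>))" if "\<epsilon> \<in> {0<..<\<epsilon>\<^sub>0}" for \<epsilon>
    using \<epsilon>\<^sub>0(2)[OF that] by (auto intro!: bdd_aboveI[of _ 1])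
  have Sup0: "0 \<le> Sup (insert 0 (X \<epsilon>))" if "\<epsilon> \<in> {0<..<\<epsilon>\<^sub>0}" for \<epsilon>
    by (rule cSup_upper[OF _ bdd[OF that]]) simp
  have "(\<delta> \<longlongrightarrow> 0) (at_right 0)"
  proof (rule tendstoI)
    fix e :: real assume e: "0 < e"
    obtain \<epsilon>\<^sub>1 where \<epsilon>\<^sub>1: "0 < \<epsilon>\<^sub>1" "\<And>\<epsilon> x. \<epsilon> \<in> {0<..<\<epsilon>\<^sub>1} \<Longrightarrow> x \<in> X \<epsilon> \<Longrightarrow> x \<le> e / 2"
      using close[of "e / 2"] e by auto
    have "\<forall>\<^sub>F \<epsilon> in at_right 0. \<epsilon> \<in> {0<..<min (e / 2) (min \<epsilon>\<^sub>0 \<epsilon>\<^sub>1)}"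
      using e \<epsilon>\<^sub>0(1) \<epsilon>\<^sub>1(1) by (intro eventually_at_right_real) auto
    then show "\<forall>\<^sub>F \<epsilon> in at_right 0. dist (\<delta> \<epsilon>) 0 < e"
    proof eventually_elim
      case (elim \<epsilon>)
      have "Sup (insert 0 (X \<epsilon>)) \<le> e / 2"
        by (rule cSup_least) (use elim e \<epsilon>\<^sub>1(2)[of \<epsilon>] in auto)
      moreover have "0 \<le> Sup (insert 0 (X \<epsilon>))" using elim by (intro Sup0) auto
      ultimately show ?case using elim by (simp add: \<delta>_def dist_real_def)
    qed
  qed
  moreover have "0 < \<delta> \<epsilon>" if "\<epsilon> \<in> {0<..<\<epsilon>\<^sub>0}" for \<epsilon>
    using Sup0[OF that] that by (simp add: \<delta>_def)
  moreover have "x \<le> \<delta> \<epsilon>" if "\<epsilon> \<in> {0<..<\<epsilon>\<^sub>0}" "x \<in> X \<epsilon>" for \<epsilon> x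
  proof -
    have "x \<le> Sup (insert 0 (X \<epsilon>))" using that by (intro cSup_upper bdd) auto
    then show ?thesis using that by (simp add: \<delta>_def)
  qed
  ultimately show ?thesis
    using \<epsilon>\<^sub>0(1) unfolding X_def by (intro exI[of _ \<epsilon>\<^sub>0] conjI exI[of _ \<delta>] ballI impI) blast+
qed

end
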